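(* Let $\psi\in C^1(\mathbb{R})$ have bounded derivative and let $c$ be a continuous function with $c(1)=1$ such that $(v,v')\mapsto c(v\cdot v')$ is positive definite on $\mathcal{B}$. Then the cavity mapping from the space of ROSt's to itself, which sends a law $\mathbb{P}$ with sampling measure $\mu$ to the law (under $\mathbb{P}\times P_l$) of the ROSt with sampling measure $$\Phi_{\psi,l_c}\mu(dv)= \frac{E_z\big[e^{\psi(l_c(v)+z\sqrt{1-c(\|v\|^2)})}\big]\,\mu(dv)}{\int_{\mathcal{B}}E_z\big[e^{\psi(l_c(w)+z\sqrt{1-c(\|w\|^2)})}\big]\,\mu(dw)}$$ is continuous.
   Context: Let $\mathbb{N}=\{1,2,\dots\}$. A Random Overlap Structure (ROSt) is a random symmetric positive semidefinite $\mathbb{N}\times\mathbb{N}$ matrix $Q=\{q_{ij}\}$ with $1$'s on the diagonal which is weakly exchangeable: $\tau Q\tau^{-1}$ has the same law as $Q$ for every permutation matrix $\tau$ that fixes all but finitely many elements. The space of ROSt's is the set of laws $\mathbb{P}$ of ROSt's, equipped with the weak-$*$ topology (as Borel probability measures on the compact set of such matrices in $[-1,1]^{\mathbb{N}\times\mathbb{N}}$ with the product topology); it is a compact convex metrizable space. $\mathbb{E}$ denotes expectation under $\mathbb{P}$. $\mathcal{H}$ is a fixed infinite-dimensional separable real Hilbert space with inner product $\cdot$ and norm $\|\cdot\|$, $\mathcal{B}$ is its closed unit ball, and $\mathcal{M}(\mathcal{B})$ is the set of Borel probability measures on $\mathcal{B}$. By the Dovbysh–Sudakov theorem, for every ROSt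 $Q$ there is a random element $\mu$ of $\mathcal{M}(\mathcal{B})$, called a sampling measure of $Q$, such that conditionally on $\mu$, $(q_{ij})_{i\neq j}$ has the law of $(v^i\cdot v^j)_{i\ne j}$ with $v^1,v^2,\dots$ i.i.d. of law $\mu$. Conversely every random element of $\mathcal{M}(\mathcal{B})$ is a sampling measure of the ROSt so constructed (diagonal entries set to $1$). The sampling measure is determined by the law of $Q$ up to isometry of $\mathcal{B}$. The cavity field $l_c=(l_c(v),v\in\mathcal{B})$ is a centered Gaussian process, independent of $\mathbb{P}$, with law $P_l$ and expectation $E_l$, and covariance $E_l[l_c(v)l_c(v')]=c(v\cdot v')$ (in a jointly measurable version). $z$ is a standard Gaussian variable independent of everything else, with expectation $E_z$. The image law does not depend on the choice of sampling measure $\mu$ of the given ROSt. *)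

theory Defs
  imports "HOL-Probability.Probability"
begin

section \<open>Random overlap structures\<close>

definition positive_semidefinite_on :: "'a set \<Rightarrow> ('a \<Rightarrow> 'a \<Rightarrow> real) \<Rightarrow> bool" where
  "positive_semidefinite_on S K \<longleftrightarrow>
     (\<forall>x\<in>S. \<forall>y\<in>S. K x y = K y x) \<and>
     (\<forall>F a. finite F \<and> F \<subseteq> S \<longrightarrow> 0 \<le> (\<Sum>x\<in>F. \<Sum>y\<in>F. a x * a y * K x y))"

text \<open>Matrices are indexed by \<^typ>\<open>nat\<close> (starting at 0 rather than 1).  The function type carries
  the product topology, and its Borel sets are those of the product \<open>\<sigma>\<close>-algebra.\<close>

definition overlap_matrices :: "(nat \<Rightarrow> nat \<Rightarrow> real) set" where
  "overlap_matrices = {q. positive_semidefinite_on UNIV q \<and> (\<forall>i. q i i = 1)}"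

abbreviation overlap_space :: "(nat \<Rightarrow> nat \<Rightarrow> real) measure" where
  "overlap_space \<equiv> restrict_space borel overlap_matrices"

definition weakly_exchangeable :: "(nat \<Rightarrow> nat \<Rightarrow> real) measure \<Rightarrow> bool" where
  "weakly_exchangeable P \<longleftrightarrow>
     (\<forall>\<pi>. bij \<pi> \<and> finite {i. \<pi> i \<noteq> i} \<longrightarrow>
        distr P overlap_space (\<lambda>q i j. q (\<pi> i) (\<pi> j)) = P)"

definition rost_laws :: "(nat \<Rightarrow> nat \<Rightarrow> real) measure set" where
  "rost_laws = {P \<in> space (prob_algebra overlap_space). weakly_exchangeable P}"

text \<open>The weak-* topology: the coarsest one for which integration of each continuous function on
  the compact set of overlap matrices is continuous.\<close>

definition rost_topology :: "(nat \<Rightarrow> nat \<Rightarrow> real) measure topology" where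
  "rost_topology = topology_generated_by
     {{P \<in> rost_laws. (\<integral>q. f q \<partial>P) \<in> U} | f U.
        continuous_on overlap_matrices (f :: (nat \<Rightarrow> nat \<Rightarrow> real) \<Rightarrow> real) \<and> open U}"


section \<open>Sampling measures\<close>

abbreviation ball_space :: "'h::real_inner measure" where
  "ball_space \<equiv> restrict_space borel (cball 0 1)"

text \<open>\<^term>\<open>prob_algebra ball_space\<close> is the measurable space of Borel probability measures on the
  unit ball, with the \<open>\<sigma>\<close>-algebra generated by the evaluations \<open>\<mu> \<mapsto> \<mu>(A)\<close>; this is the Borel
  \<open>\<sigma>\<close>-algebra of the topology of weak convergence.\<close>

definition sampled_matrix :: "(nat \<Rightarrow> 'h::real_inner) \<Rightarrow> nat \<Rightarrow> nat \<Rightarrow> real" where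
  "sampled_matrix v i j = (if i = j then 1 else v i \<bullet> v j)"

text \<open>The law of the matrix sampled from a deterministic \<open>\<mu>\<close>, and, by mixing, from a random \<open>\<mu>\<close>
  whose law is \<open>M\<close>.\<close>

definition sampled_law :: "'h::real_inner measure \<Rightarrow> (nat \<Rightarrow> nat \<Rightarrow> real) measure" where
  "sampled_law \<mu> = distr (PiM UNIV (\<lambda>_::nat. \<mu>)) overlap_space sampled_matrix"

definition rost_of :: "'h::real_inner measure measure \<Rightarrow> (nat \<Rightarrow> nat \<Rightarrow> real) measure" where
  "rost_of M = M \<bind> sampled_law"

text \<open>A random element of the space of probability measures on the ball enters only through its
  law \<open>M\<close>.\<close>

definition is_sampling_measure ::
    "'h::real_inner measure measure \<Rightarrow> (nat \<Rightarrow> nat \<Rightarrow> real) measure \<Rightarrow> bool" where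
  "is_sampling_measure M P \<longleftrightarrow>
     M \<in> space (prob_algebra (prob_algebra ball_space)) \<and> rost_of M = P"


section \<open>The cavity mapping\<close>

text \<open>The centered normal law of standard deviation \<open>\<bar>\<sigma>\<bar>\<close> is the image of the standard one under
  multiplication by \<open>\<sigma>\<close>; this includes the degenerate case \<open>\<sigma> = 0\<close>.\<close>

definition centered_gaussian_process ::
    "'w measure \<Rightarrow> 'a set \<Rightarrow> ('w \<Rightarrow> 'a \<Rightarrow> real) \<Rightarrow> bool" where
  "centered_gaussian_process N S l \<longleftrightarrow>
     (\<forall>v\<in>S. (\<lambda>\<omega>. l \<omega> v) \<in> borel_measurable N) \<and>
     (\<forall>F a. finite F \<and> F \<subseteq> S \<longrightarrow>
        (\<exists>\<sigma>::real. distr N borel (\<lambda>\<omega>. \<Sum>v\<in>F. a v * l \<omega> v) =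
                   distr std_normal_distribution borel (\<lambda>z. \<sigma> * z)))"

definition cavity_field ::
    "(real \<Rightarrow> real) \<Rightarrow> 'w measure \<Rightarrow> ('w \<Rightarrow> 'h::real_inner \<Rightarrow> real) \<Rightarrow> bool" where
  "cavity_field c N l \<longleftrightarrow>
     prob_space N \<and>
     (\<lambda>(\<omega>, v). l \<omega> v) \<in> borel_measurable (N \<Otimes>\<^sub>M ball_space) \<and>
     centered_gaussian_process N (cball 0 1) l \<and>
     (\<forall>v\<in>cball 0 1. \<forall>v'\<in>cball 0 1. (\<integral>\<omega>. l \<omega> v * l \<omega> v' \<partial>N) = c (v \<bullet> v'))"

definition cavity_weight ::
    "(real \<Rightarrow> real) \<Rightarrow> (real \<Rightarrow> real) \<Rightarrow> ('h::real_inner \<Rightarrow> real) \<Rightarrow> 'h \<Rightarrow> real" where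
  "cavity_weight \<psi> c x v =
     (\<integral>z. exp (\<psi> (x v + z * sqrt (1 - c ((norm v)\<^sup>2)))) \<partial>std_normal_distribution)"

text \<open>The quotient makes sense only if the normalisation is finite.  For each \<open>\<mu>\<close> this
  holds for almost every realisation \<open>x\<close> of the cavity field; on the exceptional null set we
  put the value \<open>\<mu>\<close>, so that the result is always a probability measure.\<close>

definition cavity_tilt ::
    "(real \<Rightarrow> real) \<Rightarrow> (real \<Rightarrow> real) \<Rightarrow> ('h::real_inner \<Rightarrow> real) \<Rightarrow> 'h measure \<Rightarrow> 'h measure" where
  "cavity_tilt \<psi> c x \<mu> =
     (if integrable \<mu> (cavity_weight \<psi> c x)
      then density \<mu> (\<lambda>v. ennreal (cavity_weight \<psi> c x v / (\<integral>w. cavity_weight \<psi> c x w \<partial>\<mu>)))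
      else \<mu>)"

text \<open>The law of the tilted random measure when \<open>\<mu>\<close> has law \<open>M\<close> and the field is independent of it.\<close>

definition cavity_sampling_law ::
    "(real \<Rightarrow> real) \<Rightarrow> (real \<Rightarrow> real) \<Rightarrow> 'w measure \<Rightarrow> ('w \<Rightarrow> 'h::real_inner \<Rightarrow> real) \<Rightarrow>
     'h measure measure \<Rightarrow> 'h measure measure" where
  "cavity_sampling_law \<psi> c N l M =
     distr (M \<Otimes>\<^sub>M N) (prob_algebra ball_space) (\<lambda>(\<mu>, \<omega>). cavity_tilt \<psi> c (l \<omega>) \<mu>)"

text \<open>The description is proper: a sampling measure exists for every law in \<^term>\<open>rost_laws\<close> by the
  Dovbysh--Sudakov theorem, and the resulting law does not depend on which one is taken.\<close>

definition cavity_map ::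
    "(real \<Rightarrow> real) \<Rightarrow> (real \<Rightarrow> real) \<Rightarrow> 'w measure \<Rightarrow> ('w \<Rightarrow> 'h::real_inner \<Rightarrow> real) \<Rightarrow>
     (nat \<Rightarrow> nat \<Rightarrow> real) measure \<Rightarrow> (nat \<Rightarrow> nat \<Rightarrow> real) measure" where
  "cavity_map \<psi> c N l P =
     (THE P'. \<exists>M. is_sampling_measure M P \<and> P' = rost_of (cavity_sampling_law \<psi> c N l M))"

end

theory Submission
  imports Defs
begin

text \<open>Existence of a sampling measure (Dovbysh--Sudakov): represent the overlaps as a Gram matrix and
  project the even-indexed vectors onto the closed span of the odd-indexed ones.  By exchangeability
  the mean residual variance given \<open>n\<close> pivots depends on \<open>n\<close> only; being decreasing, it converges, so
  that in the limit a further pivot has no effect and the residual covariances vanish.  Hence the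
  projections have the right inner products.  Their coordinates in the Gram--Schmidt basis of the
  pivots form an exchangeable sequence in the Hilbert space, to which de Finetti's theorem applies.

  Continuity: replace \<open>exp \<psi>\<close> by a trigonometric polynomial \<open>T\<close> that lies between two positive
  constants and is close to it in \<open>L\<^sup>1\<close> of the Gaussian law, and replace the power \<open>1 / Z ^ n\<close> of the
  normalisation by a polynomial in \<open>Z\<close>.  The expected value of \<open>1 / Z\<close> is bounded by Jensen's
  inequality, so the error is small uniformly in the sampling measure.  Since the noise \<open>z\<close> makes all
  variances equal to 1, the mean over the field of a product of the approximate weights of sampled
  points is an explicit continuous function of their overlaps.  So each observable of the image is a
  uniform limit of continuous observables of the original law; this also shows that the image does
  not depend on the choice of the sampling measure.\<close>


section \<open>Overlap matrices and cylinder functions\<close>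

text \<open>The denominator Z of the tilted measure has no positive lower bound over fields and
  measures, and the lower bound \<open>\<delta>\<close> of the trigonometric \<open>T\<close> may
  degenerate as \<open>T\<close> approaches \<open>exp \<psi>\<close>. The comparison of weights
  therefore divides only by the true normalisation. The means of \<open>1 / total \<omega>\<close>
  and of the L1 distance of the weights are bounded independently of the measure, but the mean of
  their product is not controlled; a threshold \<open>\<eta>\<close> on \<open>total\<close>
  separates them. The size of \<open>\<delta>\<close> matters only when \<open>1 / Z ^ n\<close> is
  replaced by a polynomial. There \<open>Z ^ m\<close> is an integral over m further sample points,
  so the quotient becomes an observable of a larger block. Trigonometric polynomials inherit
  two-sided bounds on the whole line from one period, and the field mean of a product of
  exponentials is a characteristic function. In the existence part only the even-indexed vectors are
  kept; this loses nothing, since on finitely many indices the map i to 2i agrees with a finite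
  permutation.\<close>

lemma overlap_matrices_psd:
  assumes "q \<in> overlap_matrices" "finite F"
  shows "0 \<le> (\<Sum>x\<in>F. \<Sum>y\<in>F. a x * a y * q x y)"
  using assms unfolding overlap_matrices_def positive_semidefinite_on_def by auto

lemma overlap_matrices_sym: "q \<in> overlap_matrices \<Longrightarrow> q i j = q j i"
  unfolding overlap_matrices_def positive_semidefinite_on_def by auto

lemma overlap_matrices_diag: "q \<in> overlap_matrices \<Longrightarrow> q i i = 1"
  unfolding overlap_matrices_def by auto

lemma psd_two_by_two:
  assumes K: "positive_semidefinite_on S K" and "x \<in> S" "y \<in> S" "x \<noteq> y"
  shows "0 \<le> a\<^sup>2 * K x x + 2 * a * b * K x y + b\<^sup>2 * K y y"
proof -
  have "finite {x, y} \<and> {x, y} \<subseteq> S" using assms by auto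
  then have "0 \<le> (\<Sum>i\<in>{x, y}. \<Sum>j\<in>{x, y}.
      (if i = x then a else b) * (if j = x then a else b) * K i j)"
    using K[unfolded positive_semidefinite_on_def, THEN conjunct2, rule_format, of "{x, y}" "\<lambda>i. if i = x then a else b"]
    by simp
  also have "\<dots> = a\<^sup>2 * K x x + 2 * a * b * K x y + b\<^sup>2 * K y y"
    using assms unfolding positive_semidefinite_on_def
    by (simp add: power2_eq_square algebra_simps)
  finally show ?thesis .
qed

lemma overlap_matrices_abs_le_1:
  assumes q: "q \<in> overlap_matrices"
  shows "\<bar>q i j\<bar> \<le> 1"
proof (cases "i = j")
  case True
  then show ?thesis using overlap_matrices_diag[OF q] by simp
next
  case False
  have psd: "positive_semidefinite_on UNIV q" using q by (simp add: overlap_matrices_def)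
  show ?thesis
    using psd_two_by_two[OF psd UNIV_I UNIV_I False, of 1 1] psd_two_by_two[OF psd UNIV_I UNIV_I False, of 1 "-1"]
    by (simp add: overlap_matrices_diag[OF q] abs_le_iff)
qed

lemma continuous_on_entry: "continuous_on S (\<lambda>q::nat \<Rightarrow> nat \<Rightarrow> real. q i j)"
  by (rule continuous_on_product_then_coordinatewise[OF continuous_on_product_then_coordinatewise[OF continuous_on_id]])

lemma closed_overlap_matrices: "closed overlap_matrices"
proof -
  have eq: "overlap_matrices = (\<Inter>i. {q. q i i = 1}) \<inter> (\<Inter>i j. {q. q i j = q j i}) \<inter>
      (\<Inter>a. \<Inter>F\<in>{F. finite F}. {q. 0 \<le> (\<Sum>x\<in>F. \<Sum>y\<in>F. a x * a y * q x y)})"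
    unfolding overlap_matrices_def positive_semidefinite_on_def
    by (rule set_eqI, unfold Int_iff INT_iff mem_Collect_eq) blast
  show ?thesis
    unfolding eq
    by (intro closed_Int closed_INT ballI closed_Collect_eq closed_Collect_le
        continuous_on_const continuous_on_entry continuous_on_sum continuous_on_mult)
qed

lemma compact_PiE_UNIV:
  fixes S :: "'i \<Rightarrow> 'b::topological_space set"
  assumes "\<And>i. compact (S i)"
  shows "compact (PiE UNIV S)"
proof -
  have "compactin (product_topology (\<lambda>i. euclidean) UNIV) (PiE UNIV S)"
    using assms by (simp add: compactin_PiE)
  then show ?thesis by (simp add: euclidean_product_topology)
qed

lemma compact_overlap_matrices: "compact overlap_matrices"
proof -
  have "compact (PiE UNIV (\<lambda>i::nat. PiE UNIV (\<lambda>j::nat. {-1..1::real})))"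
    by (intro compact_PiE_UNIV) auto
  moreover have "overlap_matrices \<subseteq> PiE UNIV (\<lambda>i::nat. PiE UNIV (\<lambda>j::nat. {-1..1::real}))"
    using overlap_matrices_abs_le_1 by (fastforce simp: abs_le_iff)
  ultimately show ?thesis
    using closed_overlap_matrices by (metis compact_Int_closed inf.absorb_iff2)
qed

lemma overlap_matrices_borel [measurable]: "overlap_matrices \<in> sets borel"
  using closed_overlap_matrices by (rule borel_closed)

lemma space_overlap_space [simp]: "space overlap_space = overlap_matrices"
  by (simp add: space_restrict_space)

lemma measurable_entry [measurable]:
  "(\<lambda>q::nat \<Rightarrow> nat \<Rightarrow> real. q i j) \<in> borel_measurable overlap_space"
  by (intro measurable_restrict_space1 borel_measurable_continuous_onI continuous_on_entry)

lemma measurable_into_overlap_space: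
  assumes "\<And>x. x \<in> space M \<Longrightarrow> f x \<in> overlap_matrices"
    and "\<And>i j. (\<lambda>x. f x i j) \<in> borel_measurable M"
  shows "f \<in> measurable M overlap_space"
proof (rule measurable_restrict_space2)
  show "f \<in> space M \<rightarrow> overlap_matrices" using assms(1) by auto
  show "f \<in> borel_measurable M"
    by (intro measurable_coordinatewise_then_product assms(2))
qed

lemma continuous_borel_measurable_overlap:
  "continuous_on overlap_matrices f \<Longrightarrow> f \<in> borel_measurable overlap_space"
  by (rule borel_measurable_continuous_on_restrict)

lemma continuous_overlap_bounded:
  assumes "continuous_on overlap_matrices (f :: _ \<Rightarrow> real)"
  obtains B where "B > 0" "\<And>q. q \<in> overlap_matrices \<Longrightarrow> \<bar>f q\<bar> \<le> B"
proof -
  have "bounded (f ` overlap_matrices)"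
    using compact_continuous_image[OF assms compact_overlap_matrices] by (rule compact_imp_bounded)
  then show ?thesis using that unfolding bounded_pos by (auto simp: image_iff)
qed

section \<open>Cylinder functions and their density\<close>

definition cylinder_function :: "((nat \<Rightarrow> nat \<Rightarrow> real) \<Rightarrow> real) \<Rightarrow> nat \<Rightarrow> bool" where
  "cylinder_function f n \<longleftrightarrow> continuous_on overlap_matrices f \<and>
     (\<forall>q\<in>overlap_matrices. \<forall>q'\<in>overlap_matrices. (\<forall>i<n. \<forall>j<n. q i j = q' i j) \<longrightarrow> f q = f q')"

lemma cylinder_function_mono: "cylinder_function f m \<Longrightarrow> m \<le> n \<Longrightarrow> cylinder_function f n"
  unfolding cylinder_function_def by (meson order_less_le_trans)

lemma cylinder_functionD:
  assumes "cylinder_function f n"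
  shows "continuous_on overlap_matrices f"
    and "\<And>q q'. q \<in> overlap_matrices \<Longrightarrow> q' \<in> overlap_matrices \<Longrightarrow>
      (\<And>i j. i < n \<Longrightarrow> j < n \<Longrightarrow> q i j = q' i j) \<Longrightarrow> f q = f q'"
  using assms unfolding cylinder_function_def by blast+

lemma cylinder_functionI:
  assumes "continuous_on overlap_matrices f"
    and "\<And>q q'. q \<in> overlap_matrices \<Longrightarrow> q' \<in> overlap_matrices \<Longrightarrow>
      (\<And>i j. i < n \<Longrightarrow> j < n \<Longrightarrow> q i j = q' i j) \<Longrightarrow> f q = f q'"
  shows "cylinder_function f n"
  using assms unfolding cylinder_function_def by blast

lemma cylinder_function_combine:
  assumes "cylinder_function f n" "cylinder_function g n"
    and "continuous_on overlap_matrices (\<lambda>q. h (f q) (g q))"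
  shows "cylinder_function (\<lambda>q. h (f q) (g q)) n"
proof (rule cylinder_functionI)
  fix q q' :: "nat \<Rightarrow> nat \<Rightarrow> real"
  assume "q \<in> overlap_matrices" "q' \<in> overlap_matrices" "\<And>i j. i < n \<Longrightarrow> j < n \<Longrightarrow> q i j = q' i j"
  then have "f q = f q'" "g q = g q'"
    using cylinder_functionD(2) assms(1,2) by blast+
  then show "h (f q) (g q) = h (f q') (g q')" by simp
qed (fact assms)

text \<open>Stone--Weierstrass: cylinder functions contain the constants, are closed under sums and
  products once both are viewed over the larger of the two blocks, and single entries separate
  matrices.\<close>

lemma cylinder_approximation:
  assumes f: "continuous_on overlap_matrices f" and e: "e > 0"
  obtains g n where "cylinder_function g n" "\<And>q. q \<in> overlap_matrices \<Longrightarrow> \<bar>f q - g q\<bar> < e"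
proof -
  have "\<exists>g. (\<exists>n. cylinder_function g n) \<and> (\<forall>q\<in>overlap_matrices. \<bar>f q - g q\<bar> < e)"
  proof (rule Stone_Weierstrass_HOL[OF compact_overlap_matrices _ _ _ _ _ f e])
    show "\<exists>n. cylinder_function (\<lambda>x. c) n" for c by (intro exI cylinder_functionI continuous_on_const refl)
    show "continuous_on overlap_matrices g" if "\<exists>n. cylinder_function g n" for g
      using that cylinder_functionD(1) by blast
    show "\<exists>n. cylinder_function (\<lambda>x. g x + h x) n"
      if "(\<exists>n. cylinder_function g n) \<and> (\<exists>n. cylinder_function h n)" for g h
    proof -
      obtain m n where "cylinder_function g m" "cylinder_function h n" using \<open>_ \<and> _\<close> by auto
      then have "cylinder_function g (max m n)" "cylinder_function h (max m n)"
        by (auto intro: cylinder_function_mono)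
      then have "cylinder_function (\<lambda>x. g x + h x) (max m n)"
        by (intro cylinder_function_combine[where h="(+)"] continuous_on_add)
          (auto dest: cylinder_functionD(1))
      then show ?thesis ..
    qed
    show "\<exists>n. cylinder_function (\<lambda>x. g x * h x) n"
      if "(\<exists>n. cylinder_function g n) \<and> (\<exists>n. cylinder_function h n)" for g h
    proof -
      obtain m n where "cylinder_function g m" "cylinder_function h n" using \<open>_ \<and> _\<close> by auto
      then have "cylinder_function g (max m n)" "cylinder_function h (max m n)"
        by (auto intro: cylinder_function_mono)
      then have "cylinder_function (\<lambda>x. g x * h x) (max m n)"
        by (intro cylinder_function_combine[where h="(*)"] continuous_on_mult)
          (auto dest: cylinder_functionD(1))
      then show ?thesis ..
    qed
    show "\<exists>g. (\<exists>n. cylinder_function g n) \<and> g x \<noteq> g y"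
      if xy: "x \<in> overlap_matrices \<and> y \<in> overlap_matrices \<and> x \<noteq> y" for x y
    proof -
      obtain i j where ij: "x i j \<noteq> y i j" using xy by (meson ext)
      have "cylinder_function (\<lambda>q. q i j) (Suc (max i j))"
        by (intro cylinder_functionI continuous_on_entry) auto
      show ?thesis
      proof (intro exI conjI)
        show "cylinder_function (\<lambda>q. q i j) (Suc (max i j))" by fact
        show "x i j \<noteq> y i j" by fact
      qed
    qed
  qed
  then show ?thesis using that by auto
qed

section \<open>Laws on the space of overlap matrices\<close>

lemma prob_overlap_integrable:
  fixes f :: "_ \<Rightarrow> real"
  assumes P: "P \<in> space (prob_algebra overlap_space)" and f: "continuous_on overlap_matrices f"
  shows "integrable P f"
proof -
  have sets: "sets P = sets overlap_space" and prob: "prob_space P" using P by (auto simp: space_prob_algebra)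
  interpret prob_space P by fact
  obtain B where "\<And>q. q \<in> overlap_matrices \<Longrightarrow> \<bar>f q\<bar> \<le> B"
    using continuous_overlap_bounded[OF f] by metis
  moreover have "space P = overlap_matrices" using sets_eq_imp_space_eq[OF sets] by simp
  moreover have "f \<in> borel_measurable P"
    using continuous_borel_measurable_overlap[OF f] measurable_cong_sets[OF sets refl] by blast
  ultimately show ?thesis by (intro integrable_const_bound[where B=B]) auto
qed

lemma prob_integral_diff_le:
  fixes f g :: "_ \<Rightarrow> real"
  assumes "prob_space M" "integrable M f" "integrable M g" "\<And>x. x \<in> space M \<Longrightarrow> \<bar>f x - g x\<bar> \<le> e"
  shows "\<bar>(\<integral>x. f x \<partial>M) - (\<integral>x. g x \<partial>M)\<bar> \<le> e"
proof -
  interpret prob_space M by fact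
  have "\<bar>(\<integral>x. f x \<partial>M) - (\<integral>x. g x \<partial>M)\<bar> = \<bar>\<integral>x. f x - g x \<partial>M\<bar>"
    using assms by simp
  also have "\<dots> \<le> (\<integral>x. \<bar>f x - g x\<bar> \<partial>M)" by (rule integral_abs_bound)
  also have "\<dots> \<le> (\<integral>x. e \<partial>M)"
    using assms by (intro integral_mono) auto
  finally show ?thesis by (simp add: prob_space)
qed

text \<open>Uniform approximation passes equality from cylinder functions to all continuous
  functions; these approximate the indicators of closed sets, and the traces of closed sets form an
  intersection-stable generator.\<close>

lemma overlap_law_eqI:
  assumes P: "P \<in> space (prob_algebra overlap_space)" and P': "P' \<in> space (prob_algebra overlap_space)"
    and eq: "\<And>f n. cylinder_function f n \<Longrightarrow> (\<integral>q. f q \<partial>P) = (\<integral>q. f q \<partial>P')"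
  shows "P = P'"
proof -
  have sets: "sets P = sets overlap_space" "sets P' = sets overlap_space"
    and prob: "prob_space P" "prob_space P'" using P P' by (auto simp: space_prob_algebra)
  interpret P: prob_space P by fact
  interpret P': prob_space P' by fact
  have space: "space P = overlap_matrices" "space P' = overlap_matrices"
    using sets[THEN sets_eq_imp_space_eq] by simp_all
  have cont: "(\<integral>q. f q \<partial>P) = (\<integral>q. f q \<partial>P')" if f: "continuous_on overlap_matrices f" for f :: "_ \<Rightarrow> real"
  proof -
    have "\<bar>(\<integral>q. f q \<partial>P) - (\<integral>q. f q \<partial>P')\<bar> \<le> 2 * e" if e: "e > 0" for e
    proof -
      obtain g n where g: "cylinder_function g n" "\<And>q. q \<in> overlap_matrices \<Longrightarrow> \<bar>f q - g q\<bar> < e"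
        using cylinder_approximation[OF f e] by metis
      have g': "continuous_on overlap_matrices g" using g(1) by (rule cylinder_functionD(1))
      have "\<bar>(\<integral>q. f q \<partial>P) - (\<integral>q. g q \<partial>P)\<bar> \<le> e" "\<bar>(\<integral>q. f q \<partial>P') - (\<integral>q. g q \<partial>P')\<bar> \<le> e"
        by (rule prob_integral_diff_le[OF prob(1) prob_overlap_integrable[OF P f] prob_overlap_integrable[OF P g']]
          prob_integral_diff_le[OF prob(2) prob_overlap_integrable[OF P' f] prob_overlap_integrable[OF P' g']];
          simp add: space g(2) less_imp_le)+
      then show ?thesis using eq[OF g(1)] by linarith
    qed
    \<comment> \<open>With e a quarter of the difference x the bound reads x <= x / 2, which forces
      x = 0.\<close>
    from this[of "\<bar>(\<integral>q. f q \<partial>P) - (\<integral>q. f q \<partial>P')\<bar> / 4"] show ?thesis by (cases "(\<integral>q. f q \<partial>P) = (\<integral>q. f q \<partial>P')") auto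
  qed
  have closed: "measure P (C \<inter> overlap_matrices) = measure P' (C \<inter> overlap_matrices)"
    if C: "closed C" "C \<noteq> {}" for C
  proof -
    \<comment> \<open>These cut-offs decrease to the indicator of \<open>C\<close>. The set must be
      nonempty: \<open>infdist\<close> to the empty set is 0, and \<open>f k\<close> would be
      constantly 1.\<close>
    define f where "f = (\<lambda>k q. max 0 (1 - real k * infdist q C))"
    have fc: "continuous_on overlap_matrices (f k)" for k
      unfolding f_def by (intro continuous_intros)
    have lim: "(\<lambda>k. f k q) \<longlonglongrightarrow> indicator (C \<inter> overlap_matrices) q" if "q \<in> overlap_matrices" for q
    proof (cases "q \<in> C")
      case True
      then show ?thesis using that by (simp add: f_def)
    next
      case False
      then have "infdist q C > 0"
        using C by (metis in_closed_iff_infdist_zero infdist_nonneg order_less_le)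
      then obtain k0 where k0: "1 < real k0 * infdist q C" using reals_Archimedean3 by blast
      have "f k q = 0" if "k \<ge> k0" for k
      proof -
        have "real k0 * infdist q C \<le> real k * infdist q C"
          using that by (intro mult_right_mono) (auto simp: infdist_nonneg)
        then show ?thesis using k0 by (simp add: f_def)
      qed
      then have "eventually (\<lambda>k. f k q = 0) sequentially" using eventually_sequentially by blast
      then show ?thesis using False by (simp add: tendsto_eventually)
    qed
    have meas: "indicat_real (C \<inter> overlap_matrices) \<in> borel_measurable overlap_space"
      using C(1) by (intro borel_measurable_indicator) (auto simp: sets_restrict_space_iff)
    have lim_int: "(\<lambda>k. \<integral>q. f k q \<partial>Q) \<longlonglongrightarrow> (\<integral>q. indicator (C \<inter> overlap_matrices) q \<partial>Q)"
      if Q: "Q \<in> {P, P'}" for Q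
    proof (rule integral_dominated_convergence[where w="\<lambda>_. 1"])
      have sQ: "sets Q = sets overlap_space" "space Q = overlap_matrices" using Q sets space by auto
      show "indicat_real (C \<inter> overlap_matrices) \<in> borel_measurable Q"
        using meas measurable_cong_sets[OF sQ(1) refl] by blast
      show "f k \<in> borel_measurable Q" for k
        using continuous_borel_measurable_overlap[OF fc] measurable_cong_sets[OF sQ(1) refl] by blast
      show "integrable Q (\<lambda>_. 1::real)" using Q by auto
      show "AE q in Q. (\<lambda>k. f k q) \<longlonglongrightarrow> indicator (C \<inter> overlap_matrices) q"
        using lim sQ by (intro AE_I2) auto
      show "AE q in Q. norm (f k q) \<le> 1" for k
        by (intro AE_I2) (auto simp: f_def infdist_nonneg)
    qed
    then have "(\<lambda>k. \<integral>q. f k q \<partial>P) \<longlonglongrightarrow> measure P (C \<inter> overlap_matrices)"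
      "(\<lambda>k. \<integral>q. f k q \<partial>P') \<longlonglongrightarrow> measure P' (C \<inter> overlap_matrices)"
      using lim_int[of P] lim_int[of P'] by (simp_all add: space Int_assoc)
    then show ?thesis using cont[OF fc] LIMSEQ_unique by auto
  qed
  have gen: "sets overlap_space = sigma_sets overlap_matrices ((\<lambda>C. C \<inter> overlap_matrices) ` {C. closed C})"
  proof -
    have "sets overlap_space = (\<lambda>C. C \<inter> overlap_matrices) ` sigma_sets UNIV {C. closed C}"
      by (auto simp: sets_restrict_space borel_eq_closed Int_commute)
    also have "\<dots> = sigma_sets overlap_matrices ((\<lambda>C. C \<inter> overlap_matrices) ` {C. closed C})"
      using sigma_sets_Int[of overlap_matrices UNIV "{C. closed C}"] overlap_matrices_borel
      by (simp add: borel_eq_closed Int_commute image_def)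
    finally show ?thesis .
  qed
  show ?thesis
  proof (rule measure_eqI_generator_eq[where \<Omega>=overlap_matrices and A="\<lambda>_. overlap_matrices"
        and E="(\<lambda>C. C \<inter> overlap_matrices) ` {C. closed C}"])
    show "Int_stable ((\<lambda>C. C \<inter> overlap_matrices) ` {C. closed C})"
    proof (rule Int_stableI_image)
      fix C D :: "(nat \<Rightarrow> nat \<Rightarrow> real) set" assume "C \<in> {C. closed C}" "D \<in> {C. closed C}"
      then show "\<exists>K\<in>{C. closed C}. C \<inter> overlap_matrices \<inter> (D \<inter> overlap_matrices) = K \<inter> overlap_matrices"
        by (intro bexI[of _ "C \<inter> D"]) auto
    qed
    show "emeasure P X = emeasure P' X" if "X \<in> (\<lambda>C. C \<inter> overlap_matrices) ` {C. closed C}" for X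
    proof -
      obtain C where C: "closed C" "X = C \<inter> overlap_matrices" using \<open>X \<in> _\<close> by auto
      show ?thesis
      proof (cases "C = {}")
        case False
        then show ?thesis using closed[OF C(1) False] C(2) P.emeasure_eq_measure P'.emeasure_eq_measure by simp
      qed (use C in simp)
    qed
    show "range (\<lambda>_::nat. overlap_matrices) \<subseteq> (\<lambda>C. C \<inter> overlap_matrices) ` {C. closed C}"
      using closed_overlap_matrices by auto
  qed (use sets gen in \<open>auto simp: P.emeasure_eq_measure\<close>)
qed


section \<open>Sampling from a random measure\<close>

text \<open>Finite-dimensional rectangles form an intersection-stable generator of the product
  sigma-algebra, and on them the infinite power of \<open>\<mu>\<close> is a finite product of
  evaluations of \<open>\<mu>\<close>.\<close>

lemma measurable_PiM_kernel:
  "(\<lambda>\<mu>. PiM UNIV (\<lambda>_::nat. \<mu>)) \<in> measurable (prob_algebra S) (prob_algebra (PiM UNIV (\<lambda>_::nat. S)))"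
proof (rule measurable_prob_algebra_generated[OF sets_PiM Int_stable_prod_algebra prod_algebra_sets_into_space])
  fix \<mu> assume "\<mu> \<in> space (prob_algebra S)"
  then have \<mu>: "sets \<mu> = sets S" "prob_space \<mu>" by (auto simp: space_prob_algebra)
  show "prob_space (PiM UNIV (\<lambda>_::nat. \<mu>))" using \<mu> by (intro prob_space_PiM)
  show "sets (PiM UNIV (\<lambda>_::nat. \<mu>)) = sets (PiM UNIV (\<lambda>_::nat. S))"
    using \<mu> by (intro sets_PiM_cong refl)
next
  fix A assume "A \<in> prod_algebra UNIV (\<lambda>_::nat. S)"
  from prod_algebraE[OF this] obtain J E where A: "A = prod_emb UNIV (\<lambda>_::nat. S) J (PiE J E)"
      and J: "finite J" "J \<noteq> {} \<or> (UNIV :: nat set) = {}" "J \<subseteq> UNIV"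
      and E: "\<And>i. i \<in> J \<Longrightarrow> E i \<in> sets S"
    by blast
  have "emeasure (PiM UNIV (\<lambda>_::nat. \<mu>)) A = (\<Prod>i\<in>J. emeasure \<mu> (E i))"
    if "\<mu> \<in> space (prob_algebra S)" for \<mu>
  proof -
    have \<mu>: "sets \<mu> = sets S" "prob_space \<mu>" using that by (auto simp: space_prob_algebra)
    have "A = prod_emb UNIV (\<lambda>_::nat. \<mu>) J (PiE J E)"
      by (simp add: A prod_emb_def sets_eq_imp_space_eq[OF \<mu>(1)])
    then show ?thesis using \<mu> J E by (simp add: emeasure_PiM_emb)
  qed
  moreover have "(\<lambda>\<mu>. \<Prod>i\<in>J. emeasure \<mu> (E i)) \<in> borel_measurable (prob_algebra S)"
    using E unfolding prob_algebra_def
    by (intro borel_measurable_prod_ennreal measurable_restrict_space1 measurable_emeasure_subprob_algebra)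
  ultimately show "(\<lambda>\<mu>. emeasure (PiM UNIV (\<lambda>_::nat. \<mu>)) A) \<in> borel_measurable (prob_algebra S)"
    by (simp cong: measurable_cong)
qed

lemma double_sum_inner:
  "(\<Sum>x\<in>F. \<Sum>y\<in>F. a x * a y * (v x \<bullet> v y)) = (norm (\<Sum>x\<in>F. a x *\<^sub>R v x :: 'h::real_inner))\<^sup>2"
  unfolding power2_norm_eq_inner inner_sum_left inner_sum_right
  by (intro sum.cong refl) (simp add: algebra_simps inner_commute)

text \<open>Setting the diagonal of a Gram matrix to 1 adds the diagonal matrix with entries
  \<open>1 - v i \<bullet> v i\<close>, which are nonnegative in the unit ball.\<close>

lemma sampled_matrix_in_overlap_matrices:
  fixes v :: "nat \<Rightarrow> 'h::real_inner"
  assumes v: "\<And>i. v i \<in> cball 0 1"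
  shows "sampled_matrix v \<in> overlap_matrices"
proof -
  have "0 \<le> (\<Sum>x\<in>F. \<Sum>y\<in>F. a x * a y * sampled_matrix v x y)" if F: "finite F" for F a
  proof -
    have n: "v x \<bullet> v x \<le> 1" for x
      using v[of x] by (simp add: norm_eq_sqrt_inner)
    have "(\<Sum>x\<in>F. \<Sum>y\<in>F. a x * a y * sampled_matrix v x y) =
        (\<Sum>x\<in>F. \<Sum>y\<in>F. a x * a y * (v x \<bullet> v y) + (if x = y then a x * a x * (1 - v x \<bullet> v x) else 0))"
      by (intro sum.cong refl) (auto simp: sampled_matrix_def algebra_simps)
    also have "\<dots> = (norm (\<Sum>x\<in>F. a x *\<^sub>R v x))\<^sup>2 + (\<Sum>x\<in>F. a x * a x * (1 - v x \<bullet> v x))"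
      using F by (simp add: sum.distrib double_sum_inner)
    also have "\<dots> \<ge> 0" using n by (intro add_nonneg_nonneg sum_nonneg mult_nonneg_nonneg[of "_ * _"]) auto
    finally show ?thesis .
  qed
  then show ?thesis
    by (auto simp: overlap_matrices_def positive_semidefinite_on_def sampled_matrix_def inner_commute)
qed

lemma measurable_sampled_matrix [measurable]:
  "sampled_matrix \<in> measurable (PiM UNIV (\<lambda>_. ball_space :: 'h::{real_inner, second_countable_topology} measure)) overlap_space"
proof (rule measurable_into_overlap_space)
  fix v :: "nat \<Rightarrow> 'h" assume "v \<in> space (PiM UNIV (\<lambda>_. ball_space))"
  then show "sampled_matrix v \<in> overlap_matrices"
    by (intro sampled_matrix_in_overlap_matrices) (auto simp: space_PiM space_restrict_space PiE_iff)
next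
  fix i j
  have [measurable]: "(\<lambda>v. v i) \<in> borel_measurable (PiM UNIV (\<lambda>_. ball_space :: 'h measure))" for i
    by (intro measurable_compose[OF measurable_component_singleton[of i]] measurable_restrict_space1) auto
  show "(\<lambda>v. sampled_matrix v i j) \<in> borel_measurable (PiM UNIV (\<lambda>_. ball_space :: 'h measure))"
    unfolding sampled_matrix_def by (cases "i = j") auto
qed

lemma measurable_sampled_law [measurable]:
  "sampled_law \<in> measurable (prob_algebra (ball_space :: 'h::{real_inner, second_countable_topology} measure)) (prob_algebra overlap_space)"
  unfolding sampled_law_def
  by (rule measurable_compose[OF measurable_PiM_kernel measurable_distr_prob_space[OF measurable_sampled_matrix]])

lemma rost_of_in_prob_algebra:
  fixes M :: "'h::{real_inner, second_countable_topology} measure measure"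
  assumes M: "M \<in> space (prob_algebra (prob_algebra ball_space))"
  shows "rost_of M \<in> space (prob_algebra overlap_space)"
  unfolding rost_of_def space_prob_algebra
  using prob_space_bind'[OF M measurable_sampled_law] sets_bind'[OF M measurable_sampled_law] by simp

text \<open>Stated for injections, because the Dovbysh--Sudakov argument also passes to the
  submatrix with even indices.\<close>

lemma measurable_permute_overlap:
  assumes f: "inj f"
  shows "(\<lambda>q i j. q (f i) (f j)) \<in> measurable overlap_space overlap_space"
proof (rule measurable_into_overlap_space)
  fix q :: "nat \<Rightarrow> nat \<Rightarrow> real" assume "q \<in> space overlap_space"
  then have q: "q \<in> overlap_matrices" by simp
  have "0 \<le> (\<Sum>x\<in>F. \<Sum>y\<in>F. a x * a y * q (f x) (f y))" if "finite F" for F a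
  proof -
    have inj: "inj_on f F" using f by (metis inj_on_subset subset_UNIV)
    have "0 \<le> (\<Sum>x\<in>f ` F. \<Sum>y\<in>f ` F. a (inv f x) * a (inv f y) * q x y)"
      using that by (intro overlap_matrices_psd[OF q]) auto
    then show ?thesis using f by (simp add: sum.reindex[OF inj])
  qed
  then show "(\<lambda>i j. q (f i) (f j)) \<in> overlap_matrices"
    using overlap_matrices_sym[OF q] overlap_matrices_diag[OF q]
    by (auto simp: overlap_matrices_def positive_semidefinite_on_def)
qed measurable

text \<open>Permuting the points does not change the law of an i.i.d. sequence. Injectivity of
  \<open>\<pi>\<close> keeps the diagonal, where \<open>sampled_matrix\<close> is 1 by decree, on
  the diagonal.\<close>

lemma sampled_law_permute:
  fixes \<mu> :: "'h::{real_inner, second_countable_topology} measure"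
  assumes \<mu>: "\<mu> \<in> space (prob_algebra ball_space)" and \<pi>: "bij \<pi>"
  shows "distr (sampled_law \<mu>) overlap_space (\<lambda>q i j. q (\<pi> i) (\<pi> j)) = sampled_law \<mu>"
proof -
  have sets: "sets \<mu> = sets ball_space" and prob: "prob_space \<mu>" using \<mu> by (auto simp: space_prob_algebra)
  have setsP: "sets (PiM UNIV (\<lambda>_::nat. \<mu>)) = sets (PiM UNIV (\<lambda>_::nat. ball_space))"
    using sets by (intro sets_PiM_cong refl)
  have m1: "sampled_matrix \<in> measurable (PiM UNIV (\<lambda>_::nat. \<mu>)) overlap_space"
    using measurable_sampled_matrix measurable_cong_sets[OF setsP refl] by blast
  have m2: "(\<lambda>q i j. q (\<pi> i) (\<pi> j)) \<in> measurable overlap_space overlap_space"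
    using \<pi> by (intro measurable_permute_overlap) (simp add: bij_def)
  have m3: "(\<lambda>v i. v (\<pi> i)) \<in> measurable (PiM UNIV (\<lambda>_::nat. \<mu>)) (PiM UNIV (\<lambda>_::nat. \<mu>))"
    by (rule measurable_PiM_single') (auto simp: space_PiM PiE_iff)
  have reindex: "distr (PiM UNIV (\<lambda>_::nat. \<mu>)) (PiM UNIV (\<lambda>_::nat. \<mu>)) (\<lambda>v i. v (\<pi> i)) = PiM UNIV (\<lambda>_::nat. \<mu>)"
    using distr_PiM_reindex[of UNIV "\<lambda>_. \<mu>" \<pi> UNIV] prob \<pi> by (simp add: bij_is_inj restrict_UNIV)
  have "distr (sampled_law \<mu>) overlap_space (\<lambda>q i j. q (\<pi> i) (\<pi> j)) =
      distr (PiM UNIV (\<lambda>_::nat. \<mu>)) overlap_space (\<lambda>v. sampled_matrix (\<lambda>i. v (\<pi> i)))"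
    unfolding sampled_law_def using \<pi>
    by (subst distr_distr[OF m2 m1]) (simp add: comp_def sampled_matrix_def[abs_def] bij_def inj_eq)
  also have "\<dots> = distr (distr (PiM UNIV (\<lambda>_::nat. \<mu>)) (PiM UNIV (\<lambda>_::nat. \<mu>)) (\<lambda>v i. v (\<pi> i))) overlap_space sampled_matrix"
    by (subst distr_distr[OF m1 m3]) (simp add: comp_def)
  finally show ?thesis unfolding reindex sampled_law_def .
qed

text \<open>The invariance holds for each deterministic measure and survives mixing.\<close>

lemma rost_of_in_rost_laws:
  fixes M :: "'h::{real_inner, second_countable_topology} measure measure"
  assumes M: "M \<in> space (prob_algebra (prob_algebra ball_space))"
  shows "rost_of M \<in> rost_laws"
proof -
  have sets: "sets M = sets (prob_algebra ball_space)" and prob: "prob_space M"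
    using M by (auto simp: space_prob_algebra)
  have ne: "space M \<noteq> {}" using prob by (rule prob_space.not_empty)
  have mM: "sampled_law \<in> measurable M (subprob_algebra overlap_space)"
    using measurable_prob_algebraD[OF measurable_sampled_law] measurable_cong_sets[OF sets refl] by blast
  have "distr (rost_of M) overlap_space (\<lambda>q i j. q (\<pi> i) (\<pi> j)) = rost_of M"
    if \<pi>: "bij \<pi>" for \<pi>
  proof -
    have "distr (rost_of M) overlap_space (\<lambda>q i j. q (\<pi> i) (\<pi> j)) =
        M \<bind> (\<lambda>\<mu>. distr (sampled_law \<mu>) overlap_space (\<lambda>q i j. q (\<pi> i) (\<pi> j)))"
      unfolding rost_of_def
      using \<pi> by (intro distr_bind[OF mM ne] measurable_permute_overlap) (simp add: bij_def)
    also have "\<dots> = M \<bind> sampled_law"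
      using \<pi> sets by (intro bind_cong refl sampled_law_permute) (auto dest: sets_eq_imp_space_eq)
    finally show ?thesis by (simp add: rost_of_def)
  qed
  then show ?thesis
    using rost_of_in_prob_algebra[OF M] by (auto simp: rost_laws_def weakly_exchangeable_def)
qed

lemma integral_sampled_law:
  fixes \<mu> :: "'h::{real_inner, second_countable_topology} measure" and f :: "_ \<Rightarrow> real"
  assumes \<mu>: "\<mu> \<in> space (prob_algebra ball_space)" and f: "f \<in> borel_measurable overlap_space"
  shows "(\<lambda>v. f (sampled_matrix v)) \<in> borel_measurable (PiM UNIV (\<lambda>_::nat. \<mu>))"
    and "integral\<^sup>L (sampled_law \<mu>) f = (\<integral>v. f (sampled_matrix v) \<partial>PiM UNIV (\<lambda>_::nat. \<mu>))"
proof -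
  have "sets \<mu> = sets ball_space" using \<mu> by (simp add: space_prob_algebra)
  then have setsP: "sets (PiM UNIV (\<lambda>_::nat. \<mu>)) = sets (PiM UNIV (\<lambda>_::nat. ball_space))"
    by (intro sets_PiM_cong refl)
  have m: "sampled_matrix \<in> measurable (PiM UNIV (\<lambda>_::nat. \<mu>)) overlap_space"
    using measurable_sampled_matrix measurable_cong_sets[OF setsP refl] by blast
  show "(\<lambda>v. f (sampled_matrix v)) \<in> borel_measurable (PiM UNIV (\<lambda>_::nat. \<mu>))"
    by (rule measurable_compose[OF m f])
  show "integral\<^sup>L (sampled_law \<mu>) f = (\<integral>v. f (sampled_matrix v) \<partial>PiM UNIV (\<lambda>_::nat. \<mu>))"
    unfolding sampled_law_def by (rule integral_distr[OF m f])
qed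

lemma integral_rost_of:
  fixes M :: "'h::{real_inner, second_countable_topology} measure measure" and f :: "_ \<Rightarrow> real"
  assumes M: "M \<in> space (prob_algebra (prob_algebra ball_space))"
    and f: "continuous_on overlap_matrices f"
  shows "(\<integral>q. f q \<partial>rost_of M) = (\<integral>\<mu>. (\<integral>v. f (sampled_matrix v) \<partial>PiM UNIV (\<lambda>_::nat. \<mu>)) \<partial>M)"
proof -
  have sets: "sets M = sets (prob_algebra ball_space)" and prob: "prob_space M"
    using M by (auto simp: space_prob_algebra)
  interpret prob_space M by fact
  have mM: "sampled_law \<in> measurable M (subprob_algebra overlap_space)"
    using measurable_prob_algebraD[OF measurable_sampled_law] measurable_cong_sets[OF sets refl] by blast
  obtain B where B: "\<And>q. q \<in> overlap_matrices \<Longrightarrow> \<bar>f q\<bar> \<le> B"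
    using continuous_overlap_bounded[OF f] by metis
  have fm: "f \<in> borel_measurable overlap_space" using f by (rule continuous_borel_measurable_overlap)
  have "(\<integral>q. f q \<partial>rost_of M) = (\<integral>\<mu>. integral\<^sup>L (sampled_law \<mu>) f \<partial>M)"
    unfolding rost_of_def
  proof (rule integral_bind[OF fm _ mM])
    show "AE \<mu> in M. emeasure (sampled_law \<mu>) (space (sampled_law \<mu>)) \<le> ennreal 1"
      using subprob_space_kernel[OF mM] by (intro AE_I2) (simp add: subprob_space.emeasure_space_le_1)
    show "finite_measure M" by unfold_locales
  qed (use B in auto)
  also have "\<dots> = (\<integral>\<mu>. (\<integral>v. f (sampled_matrix v) \<partial>PiM UNIV (\<lambda>_::nat. \<mu>)) \<partial>M)"
  proof (rule Bochner_Integration.integral_cong[OF refl])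
    fix \<mu> assume "\<mu> \<in> space M"
    then have "\<mu> \<in> space (prob_algebra ball_space)" using sets_eq_imp_space_eq[OF sets] by simp
    then show "integral\<^sup>L (sampled_law \<mu>) f = (\<integral>v. f (sampled_matrix v) \<partial>PiM UNIV (\<lambda>_::nat. \<mu>))"
      by (rule integral_sampled_law(2)[OF _ fm])
  qed
  finally show ?thesis .
qed


section \<open>De Finetti's theorem\<close>

text \<open>Weak exchangeability speaks of finitely supported permutations, while the arguments
  below move a finite set of indices to prescribed places. Inside the union of \<open>J\<close> and
  its image the complements of the two sets are equally large, so any bijection between them
  completes the injection.\<close>

lemma finite_injection_extends:
  assumes J: "finite (J :: 'a set)" and f: "inj_on f J"
  obtains \<pi> where "bij \<pi>" "finite {i. \<pi> i \<noteq> i}" "\<And>i. i \<in> J \<Longrightarrow> \<pi> i = f i"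
proof -
  define S where "S = J \<union> f ` J"
  have fin: "finite S" using J by (simp add: S_def)
  have "card (S - J) = card (S - f ` J)"
    using J f by (subst (1 2) card_Diff_subset) (auto simp: S_def card_image)
  then obtain h where h: "bij_betw h (S - J) (S - f ` J)"
    using fin by (metis finite_Diff finite_same_card_bij)
  define \<pi> where "\<pi> = (\<lambda>i. if i \<in> J then f i else if i \<in> S then h i else i)"
  have "bij_betw \<pi> J (f ` J)"
    using f by (auto simp: bij_betw_def inj_on_def \<pi>_def)
  moreover have "bij_betw \<pi> (S - J) (S - f ` J)"
    using h by (subst bij_betw_cong[of _ \<pi> h]) (auto simp: \<pi>_def)
  ultimately have "bij_betw \<pi> (J \<union> (S - J)) (f ` J \<union> (S - f ` J))"
    by (rule bij_betw_combine) auto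
  moreover have "J \<union> (S - J) = S" "f ` J \<union> (S - f ` J) = S" by (auto simp: S_def)
  ultimately have "bij_betw \<pi> S S" by simp
  then have "\<pi> permutes S"
    by (rule bij_imp_permutes) (auto simp: \<pi>_def S_def)
  then have "bij \<pi>" by (rule permutes_bij)
  moreover have "finite {i. \<pi> i \<noteq> i}"
    by (rule finite_subset[OF _ fin]) (auto simp: \<pi>_def S_def split: if_splits)
  ultimately show ?thesis using that by (simp add: \<pi>_def)
qed

locale exchangeable_sequence = prob_space N for N :: "'w measure" +
  fixes S :: "'s measure" and Y :: "nat \<Rightarrow> 'w \<Rightarrow> 's"
  assumes measurable_Y [measurable]: "\<And>i. Y i \<in> measurable N S"
    and exchangeable: "\<And>J f A. finite J \<Longrightarrow> inj_on f J \<Longrightarrow> (\<And>i. i \<in> J \<Longrightarrow> A i \<in> sets S) \<Longrightarrow>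
      measure N {\<omega> \<in> space N. \<forall>i\<in>J. Y (f i) \<omega> \<in> A i} = measure N {\<omega> \<in> space N. \<forall>i\<in>J. Y i \<omega> \<in> A i}"
begin

definition freq :: "nat set \<Rightarrow> 's set \<Rightarrow> 'w \<Rightarrow> real" where
  "freq I A \<omega> = (\<Sum>i\<in>I. indicator A (Y i \<omega>)) / real (card I)"

lemma freq_measurable [measurable]: "A \<in> sets S \<Longrightarrow> freq I A \<in> borel_measurable N"
  unfolding freq_def
  by (intro borel_measurable_divide borel_measurable_sum borel_measurable_const
      measurable_compose[OF measurable_Y borel_measurable_indicator])

lemma freq_nonneg: "0 \<le> freq I A \<omega>"
  unfolding freq_def by (intro divide_nonneg_nonneg sum_nonneg) auto

lemma freq_le_1: "freq I A \<omega> \<le> 1"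
proof (cases "card I = 0")
  case False
  have "(\<Sum>i\<in>I. indicator A (Y i \<omega>)) \<le> (\<Sum>i\<in>I. 1::real)"
    by (intro sum_mono) (auto simp: indicator_def)
  then show ?thesis using False by (simp add: freq_def divide_le_eq_1)
qed (simp add: freq_def)

lemma freq_mono: "A \<subseteq> B \<Longrightarrow> freq I A \<omega> \<le> freq I B \<omega>"
  unfolding freq_def by (intro divide_right_mono sum_mono) (auto simp: indicator_def)

lemma bounded_integrable:
  fixes f :: "'w \<Rightarrow> real"
  assumes "f \<in> borel_measurable N" "\<And>\<omega>. \<omega> \<in> space N \<Longrightarrow> \<bar>f \<omega>\<bar> \<le> B"
  shows "integrable N f"
  using assms by (intro integrable_const_bound[where B=B]) auto

lemma freq_integrable: "A \<in> sets S \<Longrightarrow> integrable N (freq I A)"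
  using freq_nonneg freq_le_1 by (intro bounded_integrable[where B=1]) auto

lemma prob_single:
  assumes A: "A \<in> sets S"
  shows "prob {\<omega> \<in> space N. Y i \<omega> \<in> A} = prob {\<omega> \<in> space N. Y 0 \<omega> \<in> A}"
  using exchangeable[of "{0}" "\<lambda>_. i" "\<lambda>_. A"] A by simp

lemma prob_pair:
  assumes A: "A \<in> sets S" and "i \<noteq> j"
  shows "prob {\<omega> \<in> space N. Y i \<omega> \<in> A \<and> Y j \<omega> \<in> A} = prob {\<omega> \<in> space N. Y 0 \<omega> \<in> A \<and> Y 1 \<omega> \<in> A}"
  using exchangeable[of "{0, 1}" "\<lambda>k. if k = 0 then i else j" "\<lambda>_. A"] assms
  by (simp add: inj_on_def)

text \<open>By exchangeability a product of two indicators has mean \<open>p1\<close> or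
  \<open>p2\<close>, according to whether the indices agree. The sums are grouped so that only the
  squares of the coefficients remain when these add up to 0.\<close>

lemma second_moment:
  assumes A: "A \<in> sets S" and I: "finite I"
  defines "p1 \<equiv> prob {\<omega> \<in> space N. Y 0 \<omega> \<in> A}"
    and "p2 \<equiv> prob {\<omega> \<in> space N. Y 0 \<omega> \<in> A \<and> Y 1 \<omega> \<in> A}"
  shows "expectation (\<lambda>\<omega>. (\<Sum>i\<in>I. c i * indicator A (Y i \<omega>))\<^sup>2) =
      (\<Sum>i\<in>I. (c i)\<^sup>2) * (p1 - p2) + (\<Sum>i\<in>I. c i)\<^sup>2 * p2"
proof -
  have pair: "expectation (\<lambda>\<omega>. indicat_real A (Y i \<omega>) * indicator A (Y j \<omega>)) = p2 + (if i = j then p1 - p2 else 0)"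
    for i j
  proof -
    have "expectation (\<lambda>\<omega>. indicat_real A (Y i \<omega>) * indicator A (Y j \<omega>)) =
        expectation (indicat_real {\<omega> \<in> space N. Y i \<omega> \<in> A \<and> Y j \<omega> \<in> A})"
      by (intro Bochner_Integration.integral_cong) (auto simp: indicator_def)
    also have "\<dots> = prob {\<omega> \<in> space N. Y i \<omega> \<in> A \<and> Y j \<omega> \<in> A}" using A by simp
    also have "\<dots> = p2 + (if i = j then p1 - p2 else 0)"
      using prob_single[OF A, of i] prob_pair[OF A, of i j] by (auto simp: p1_def p2_def)
    finally show ?thesis .
  qed
  have int: "integrable N (\<lambda>\<omega>. c i * indicator A (Y i \<omega>) * (c j * indicator A (Y j \<omega>)))" for i j
    using A by (intro bounded_integrable[where B="\<bar>c i\<bar> * \<bar>c j\<bar>"]) (auto simp: indicator_def abs_mult)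
  have "expectation (\<lambda>\<omega>. (\<Sum>i\<in>I. c i * indicator A (Y i \<omega>))\<^sup>2) =
      expectation (\<lambda>\<omega>. \<Sum>i\<in>I. \<Sum>j\<in>I. c i * indicator A (Y i \<omega>) * (c j * indicator A (Y j \<omega>)))"
    by (simp add: power2_eq_square sum_product)
  also have "\<dots> = (\<Sum>i\<in>I. \<Sum>j\<in>I. expectation (\<lambda>\<omega>. c i * indicator A (Y i \<omega>) * (c j * indicator A (Y j \<omega>))))"
    by (subst Bochner_Integration.integral_sum, intro Bochner_Integration.integrable_sum int,
      intro sum.cong refl, subst Bochner_Integration.integral_sum) (auto intro: int)
  also have "\<dots> = (\<Sum>i\<in>I. \<Sum>j\<in>I. c i * c j * expectation (\<lambda>\<omega>. indicat_real A (Y i \<omega>) * indicator A (Y j \<omega>)))"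
  proof (intro sum.cong refl)
    fix i j
    have "expectation (\<lambda>\<omega>. c i * indicator A (Y i \<omega>) * (c j * indicator A (Y j \<omega>))) =
        expectation (\<lambda>\<omega>. (c i * c j) * (indicator A (Y i \<omega>) * indicator A (Y j \<omega>)))"
      by (intro Bochner_Integration.integral_cong) auto
    then show "expectation (\<lambda>\<omega>. c i * indicator A (Y i \<omega>) * (c j * indicator A (Y j \<omega>))) =
        c i * c j * expectation (\<lambda>\<omega>. indicat_real A (Y i \<omega>) * indicator A (Y j \<omega>))" by simp
  qed
  also have "\<dots> = (\<Sum>i\<in>I. \<Sum>j\<in>I. c i * c j * p2 + (if i = j then c i * c j * (p1 - p2) else 0))"
    by (intro sum.cong refl) (auto simp: pair distrib_left)
  also have "\<dots> = (\<Sum>i\<in>I. \<Sum>j\<in>I. c i * c j * p2) + (\<Sum>i\<in>I. c i * c i * (p1 - p2))"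
    using I by (simp add: sum.distrib sum.delta)
  also have "\<dots> = (\<Sum>i\<in>I. c i)\<^sup>2 * p2 + (\<Sum>i\<in>I. (c i)\<^sup>2) * (p1 - p2)"
    by (simp only: power2_eq_square sum_product) (simp add: sum_distrib_right)
  finally show ?thesis by simp
qed

text \<open>This is nonnegativity of the variance of the absolute value.\<close>

lemma expectation_abs_le_sqrt:
  assumes X: "integrable N X" "integrable N (\<lambda>\<omega>. (X \<omega>)\<^sup>2)"
  shows "expectation (\<lambda>\<omega>. \<bar>X \<omega>\<bar>) \<le> sqrt (expectation (\<lambda>\<omega>. (X \<omega>)\<^sup>2))"
proof (rule real_le_rsqrt)
  have "0 \<le> variance (\<lambda>\<omega>. \<bar>X \<omega>\<bar>)" by (rule variance_positive)
  also have "\<dots> = expectation (\<lambda>\<omega>. \<bar>X \<omega>\<bar>\<^sup>2) - (expectation (\<lambda>\<omega>. \<bar>X \<omega>\<bar>))\<^sup>2"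
    using X by (intro variance_eq) auto
  finally show "(expectation (\<lambda>\<omega>. \<bar>X \<omega>\<bar>))\<^sup>2 \<le> expectation (\<lambda>\<omega>. (X \<omega>)\<^sup>2)" by simp
qed

text \<open>The difference is a combination of indicators whose coefficients sum to 0, so its second
  moment is at most the sum of their squares. Bounding \<open>(a - b)\<^sup>2\<close> by
  \<open>2 * a\<^sup>2 + 2 * b\<^sup>2\<close> allows the index sets to overlap.\<close>

lemma freq_diff:
  assumes A: "A \<in> sets S" and I: "finite I" "I \<noteq> {}" and T: "finite T" "T \<noteq> {}"
  shows "expectation (\<lambda>\<omega>. \<bar>freq I A \<omega> - freq T A \<omega>\<bar>) \<le> sqrt (2 / card I + 2 / card T)"
proof -
  define c where "c = (\<lambda>i. indicator I i / real (card I) - indicator T i / real (card T))"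
  have pos: "real (card I) > 0" "real (card T) > 0" using I T by (auto simp: card_gt_0_iff)
  have sumI: "(\<Sum>i\<in>I \<union> T. indicator I i * f i) = sum f I" "(\<Sum>i\<in>I \<union> T. indicator T i * f i) = sum f T"
    for f :: "nat \<Rightarrow> real"
    using I T by (auto simp: indicator_def if_distrib sum.If_cases Int_absorb1 Int_absorb2 Int_commute
        intro!: sum.mono_neutral_cong_right)
  have freq: "freq I A \<omega> - freq T A \<omega> = (\<Sum>i\<in>I \<union> T. c i * indicator A (Y i \<omega>))" for \<omega>
    using sumI[of "\<lambda>i. indicator A (Y i \<omega>)"]
    by (simp add: c_def freq_def left_diff_distrib sum_subtractf flip: sum_divide_distrib)
  have csum: "(\<Sum>i\<in>I \<union> T. c i) = 0"
    using sumI[of "\<lambda>_. 1"] pos by (simp add: c_def sum_subtractf flip: sum_divide_distrib)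
  have "(\<Sum>i\<in>I \<union> T. (c i)\<^sup>2) \<le> (\<Sum>i\<in>I \<union> T. 2 * (indicator I i * (1 / (real (card I))\<^sup>2)) + 2 * (indicator T i * (1 / (real (card T))\<^sup>2)))"
  proof (intro sum_mono)
    fix i
    have "(a - b)\<^sup>2 \<le> 2 * a\<^sup>2 + 2 * b\<^sup>2" for a b :: real
      using zero_le_power2[of "a + b"] by (simp add: power2_eq_square algebra_simps)
    from this[of "indicator I i / real (card I)" "indicator T i / real (card T)"]
    show "(c i)\<^sup>2 \<le> 2 * (indicator I i * (1 / (real (card I))\<^sup>2)) + 2 * (indicator T i * (1 / (real (card T))\<^sup>2))"
      by (cases "i \<in> I"; cases "i \<in> T") (auto simp: c_def power_divide)
  qed
  also have "\<dots> = 2 / card I + 2 / card T"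
    using pos by (simp only: sum.distrib sumI flip: sum_distrib_left) (simp add: power2_eq_square field_simps)
  finally have c2: "(\<Sum>i\<in>I \<union> T. (c i)\<^sup>2) \<le> 2 / card I + 2 / card T" .
  have "expectation (\<lambda>\<omega>. (freq I A \<omega> - freq T A \<omega>)\<^sup>2) =
     (\<Sum>i\<in>I \<union> T. (c i)\<^sup>2) * (prob {\<omega> \<in> space N. Y 0 \<omega> \<in> A} - prob {\<omega> \<in> space N. Y 0 \<omega> \<in> A \<and> Y 1 \<omega> \<in> A})"
    unfolding freq using A I T by (subst second_moment) (auto simp: csum)
  also have "\<dots> \<le> (\<Sum>i\<in>I \<union> T. (c i)\<^sup>2) * 1"
    by (intro mult_left_mono sum_nonneg order_trans[OF _ prob_le_1[of "{\<omega> \<in> space N. Y 0 \<omega> \<in> A}"]])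
      auto
  finally have "expectation (\<lambda>\<omega>. (freq I A \<omega> - freq T A \<omega>)\<^sup>2) \<le> 2 / card I + 2 / card T"
    using c2 by simp
  moreover have "\<bar>freq I A \<omega> - freq T A \<omega>\<bar> \<le> 1" for \<omega>
    using freq_nonneg[of I A \<omega>] freq_nonneg[of T A \<omega>] freq_le_1[of I A \<omega>] freq_le_1[of T A \<omega>] by linarith
  then have "expectation (\<lambda>\<omega>. \<bar>freq I A \<omega> - freq T A \<omega>\<bar>) \<le> sqrt (expectation (\<lambda>\<omega>. (freq I A \<omega> - freq T A \<omega>)\<^sup>2))"
    using A by (intro expectation_abs_le_sqrt bounded_integrable[where B=1]) (auto simp: abs_square_le_1)
  ultimately show ?thesis by (meson order_trans real_sqrt_le_mono)
qed

text \<open>Lengths growing like \<open>4 ^ k\<close> bound the L1 distance of consecutive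
  frequencies by \<open>2 * (1 / 2) ^ k\<close>. This is summable, whence almost sure
  convergence.\<close>

abbreviation emp :: "nat \<Rightarrow> 's set \<Rightarrow> 'w \<Rightarrow> real" where "emp k \<equiv> freq {..<4 ^ k}"

lemma expectation_freq:
  assumes A: "A \<in> sets S" and I: "finite I" "I \<noteq> {}"
  shows "expectation (freq I A) = prob {\<omega> \<in> space N. Y 0 \<omega> \<in> A}"
proof -
  have "expectation (\<lambda>\<omega>. indicat_real A (Y i \<omega>)) = prob {\<omega> \<in> space N. Y 0 \<omega> \<in> A}" for i
  proof -
    have "expectation (\<lambda>\<omega>. indicat_real A (Y i \<omega>)) = expectation (indicat_real {\<omega> \<in> space N. Y i \<omega> \<in> A})"
      by (intro Bochner_Integration.integral_cong) (auto simp: indicator_def)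
    then show ?thesis using A prob_single[OF A, of i] by simp
  qed
  moreover have "integrable N (\<lambda>\<omega>. indicat_real A (Y i \<omega>))" for i
    using A by (intro bounded_integrable[where B=1]) (auto simp: indicator_def)
  ultimately show ?thesis using I
    by (simp add: freq_def[abs_def] Bochner_Integration.integral_sum)
qed

lemma emp_converges:
  assumes A: "A \<in> sets S"
  shows "AE \<omega> in N. convergent (\<lambda>k. emp k A \<omega>)"
proof -
  have le: "(\<integral>\<^sup>+\<omega>. ennreal \<bar>emp (Suc k) A \<omega> - emp k A \<omega>\<bar> \<partial>N) \<le> ennreal (2 * (1 / 2) ^ k)" for k
  proof -
    have "(\<integral>\<^sup>+\<omega>. ennreal \<bar>emp (Suc k) A \<omega> - emp k A \<omega>\<bar> \<partial>N) = ennreal (expectation (\<lambda>\<omega>. \<bar>emp (Suc k) A \<omega> - emp k A \<omega>\<bar>))"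
      using A by (intro nn_integral_eq_integral integrable_abs Bochner_Integration.integrable_diff freq_integrable) auto
    also have "\<dots> \<le> ennreal (sqrt (2 / card {..<4 ^ Suc k :: nat} + 2 / card {..<4 ^ k :: nat}))"
      using A by (intro ennreal_leI freq_diff) (auto simp: lessThan_empty_iff)
    also have "\<dots> \<le> ennreal (2 * (1 / 2) ^ k)"
    proof (intro ennreal_leI real_le_lsqrt)
      have "((1 / 2) ^ k)\<^sup>2 = (1 / 4 :: real) ^ k"
        by (simp add: power2_eq_square flip: power_mult_distrib)
      then show "2 / card {..<4 ^ Suc k :: nat} + 2 / card {..<4 ^ k :: nat} \<le> (2 * (1 / 2) ^ k :: real)\<^sup>2"
        by (simp add: power_mult_distrib power_divide) (simp add: field_simps)
    qed auto
    finally show ?thesis .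
  qed
  have "(\<integral>\<^sup>+\<omega>. (\<Sum>k. ennreal \<bar>emp (Suc k) A \<omega> - emp k A \<omega>\<bar>) \<partial>N) =
      (\<Sum>k. \<integral>\<^sup>+\<omega>. ennreal \<bar>emp (Suc k) A \<omega> - emp k A \<omega>\<bar> \<partial>N)"
    using A by (intro nn_integral_suminf) auto
  also have "\<dots> \<le> (\<Sum>k. ennreal (2 * (1 / 2) ^ k))"
    by (intro suminf_le le) auto
  also have "\<dots> = ennreal (\<Sum>k. 2 * (1 / 2) ^ k)"
    by (intro suminf_ennreal2 summable_mult summable_geometric) auto
  also have "\<dots> < \<infinity>" by simp
  finally have "AE \<omega> in N. (\<Sum>k. ennreal \<bar>emp (Suc k) A \<omega> - emp k A \<omega>\<bar>) \<noteq> \<infinity>"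
    using A by (intro nn_integral_PInf_AE) auto
  then show ?thesis
  proof eventually_elim
    case (elim \<omega>)
    then have "summable (\<lambda>k. \<bar>emp (Suc k) A \<omega> - emp k A \<omega>\<bar>)"
      by (intro summable_suminf_not_top) auto
    then have "summable (\<lambda>k. emp (Suc k) A \<omega> - emp k A \<omega>)" by (rule summable_rabs_cancel)
    then have "convergent (\<lambda>n. \<Sum>k<n. emp (Suc k) A \<omega> - emp k A \<omega>)"
      by (simp add: summable_iff_convergent)
    then have "convergent (\<lambda>n. emp n A \<omega> - emp 0 A \<omega>)"
      by (simp only: sum_lessThan_telescope[of "\<lambda>k. emp k A \<omega>"])
    then have "convergent (\<lambda>n. (emp n A \<omega> - emp 0 A \<omega>) + emp 0 A \<omega>)"
      by (intro convergent_add convergent_const)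
    then show ?case by simp
  qed
qed

text \<open>Taking the lower limit instead of the limit makes monotonicity in the set hold everywhere.\<close>

definition efreq :: "'s set \<Rightarrow> 'w \<Rightarrow> real" where
  "efreq A \<omega> = enn2real (liminf (\<lambda>k. ennreal (emp k A \<omega>)))"

lemma efreq_liminf_le_1: "liminf (\<lambda>k. ennreal (emp k A \<omega>)) \<le> 1"
  by (intro Liminf_le) (auto intro!: always_eventually simp: freq_le_1)

lemma efreq_measurable [measurable]: "A \<in> sets S \<Longrightarrow> efreq A \<in> borel_measurable N"
  unfolding efreq_def by measurable

lemma efreq_nonneg: "0 \<le> efreq A \<omega>" by (simp add: efreq_def)

lemma efreq_le_1: "efreq A \<omega> \<le> 1"
proof -
  have "efreq A \<omega> \<le> enn2real 1"
    unfolding efreq_def by (intro enn2real_mono efreq_liminf_le_1) simp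
  then show ?thesis by simp
qed

lemma efreq_mono: "A \<subseteq> B \<Longrightarrow> efreq A \<omega> \<le> efreq B \<omega>"
  unfolding efreq_def
  by (intro enn2real_mono Liminf_mono always_eventually allI ennreal_leI freq_mono le_less_trans[OF efreq_liminf_le_1]) auto

lemma efreq_eqI: "(\<lambda>k. emp k A \<omega>) \<longlonglongrightarrow> x \<Longrightarrow> efreq A \<omega> = x"
proof -
  assume l: "(\<lambda>k. emp k A \<omega>) \<longlonglongrightarrow> x"
  then have "x \<ge> 0" by (rule LIMSEQ_le_const) (auto intro: freq_nonneg)
  moreover have "liminf (\<lambda>k. ennreal (emp k A \<omega>)) = ennreal x"
    using l by (intro lim_imp_Liminf) auto
  ultimately show "efreq A \<omega> = x" by (simp add: efreq_def)
qed

lemma efreq_integrable: "A \<in> sets S \<Longrightarrow> integrable N (efreq A)"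
  using efreq_nonneg efreq_le_1 by (intro bounded_integrable[where B=1]) auto

lemma emp_tendsto_efreq:
  assumes A: "A \<in> sets S"
  shows "(\<lambda>k. expectation (\<lambda>\<omega>. \<bar>emp k A \<omega> - efreq A \<omega>\<bar>)) \<longlonglongrightarrow> 0"
proof -
  have "(\<lambda>k. expectation (\<lambda>\<omega>. \<bar>emp k A \<omega> - efreq A \<omega>\<bar>)) \<longlonglongrightarrow> expectation (\<lambda>\<omega>. 0)"
  proof (rule integral_dominated_convergence[where w="\<lambda>_. 1"])
    show "AE \<omega> in N. (\<lambda>k. \<bar>emp k A \<omega> - efreq A \<omega>\<bar>) \<longlonglongrightarrow> 0"
      using emp_converges[OF A]
    proof eventually_elim
      case (elim \<omega>)
      then obtain x where x: "(\<lambda>k. emp k A \<omega>) \<longlonglongrightarrow> x" by (auto simp: convergent_def)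
      then show ?case
        using efreq_eqI[OF x] by (simp add: tendsto_rabs_zero_iff LIM_zero)
    qed
    show "AE \<omega> in N. norm \<bar>emp k A \<omega> - efreq A \<omega>\<bar> \<le> 1" for k
    proof (rule AE_I2)
      fix \<omega>
      show "norm \<bar>emp k A \<omega> - efreq A \<omega>\<bar> \<le> 1"
        using freq_nonneg[of "{..<4^k}" A \<omega>] freq_le_1[of "{..<4^k}" A \<omega>] efreq_nonneg[of A \<omega>] efreq_le_1[of A \<omega>]
        by simp
    qed
  qed (use A in auto)
  then show ?thesis by simp
qed

end


section \<open>The directing measure of a sequence in the unit interval\<close>

locale exchangeable_unit_sequence = exchangeable_sequence N borel Y
  for N :: "'w measure" and Y :: "nat \<Rightarrow> 'w \<Rightarrow> real" +
  assumes Y_unit: "\<And>i \<omega>. \<omega> \<in> space N \<Longrightarrow> Y i \<omega> \<in> {0..1}"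
begin

text \<open>The map from x to \<open>efreq {..x} \<omega>\<close> is monotone for every
  \<open>\<omega>\<close> but may fail to be right-continuous. Its right-hand regularisation is a
  distribution function at every point of the probability space, not just almost everywhere.\<close>

definition ecdf :: "'w \<Rightarrow> real \<Rightarrow> real" where
  "ecdf \<omega> x = (INF n. efreq {..x + 1 / real (Suc n)} \<omega>)"

lemma efreq_bdd_below: "bdd_below (range (\<lambda>n. efreq (A n) \<omega>))"
  by (intro bdd_belowI[where m=0]) (auto intro: efreq_nonneg)

lemma ecdf_le: "x < y \<Longrightarrow> ecdf \<omega> x \<le> efreq {..y} \<omega>"
proof -
  assume "x < y"
  then obtain n where n: "1 / real (Suc n) < y - x"
    using reals_Archimedean[of "y - x"] by (auto simp: inverse_eq_divide)
  have "ecdf \<omega> x \<le> efreq {..x + 1 / real (Suc n)} \<omega>"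
    unfolding ecdf_def by (intro cINF_lower efreq_bdd_below) auto
  also have "\<dots> \<le> efreq {..y} \<omega>" using n by (intro efreq_mono) auto
  finally show ?thesis .
qed

lemma efreq_le_ecdf: "efreq {..x} \<omega> \<le> ecdf \<omega> x"
  unfolding ecdf_def by (intro cINF_greatest efreq_mono) auto

lemma ecdf_mono: "x \<le> y \<Longrightarrow> ecdf \<omega> x \<le> ecdf \<omega> y"
  unfolding ecdf_def
proof (intro cINF_mono efreq_bdd_below)
  fix m assume "x \<le> y"
  then show "\<exists>n\<in>UNIV. efreq {..x + 1 / real (Suc n)} \<omega> \<le> efreq {..y + 1 / real (Suc m)} \<omega>"
    by (intro bexI[of _ m] efreq_mono) auto
qed auto

lemma ecdf_nonneg: "0 \<le> ecdf \<omega> x"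
  unfolding ecdf_def by (intro cINF_greatest efreq_nonneg) auto

lemma ecdf_le_1: "ecdf \<omega> x \<le> 1"
  using ecdf_le[of x "x + 1" \<omega>] efreq_le_1[of "{..x + 1}" \<omega>] by linarith

lemma ecdf_tendsto: "(\<lambda>n. efreq {..x + 1 / real (Suc n)} \<omega>) \<longlonglongrightarrow> ecdf \<omega> x"
  unfolding ecdf_def
  by (intro LIMSEQ_decseq_INF efreq_bdd_below decseq_SucI efreq_mono) (auto simp: field_simps)

lemma ecdf_right_continuous: "continuous (at_right a) (ecdf \<omega>)"
proof (subst continuous_at_right_real_increasing)
  show "\<forall>e>0. \<exists>d>0. ecdf \<omega> (a + d) - ecdf \<omega> a < e"
  proof (intro allI impI)
    fix e :: real assume "e > 0"
    then have "eventually (\<lambda>n. efreq {..a + 1 / real (Suc n)} \<omega> < ecdf \<omega> a + e) sequentially"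
      by (intro order_tendstoD(2)[OF ecdf_tendsto]) simp
    then obtain n where n: "efreq {..a + 1 / real (Suc n)} \<omega> < ecdf \<omega> a + e"
      by (auto simp: eventually_sequentially)
    \<comment> \<open>Half the step provides the strict inequality that \<open>ecdf_le\<close> asks
      for.\<close>
    have "ecdf \<omega> (a + 1 / (2 * real (Suc n))) \<le> efreq {..a + 1 / real (Suc n)} \<omega>"
      by (intro ecdf_le) (simp add: field_simps)
    then show "\<exists>d>0. ecdf \<omega> (a + d) - ecdf \<omega> a < e"
      using n by (intro exI[of _ "1 / (2 * real (Suc n))"]) auto
  qed
qed (fact ecdf_mono)

lemma efreq_zero: "x < 0 \<Longrightarrow> \<omega> \<in> space N \<Longrightarrow> efreq {..x} \<omega> = 0"
proof (rule efreq_eqI)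
  assume "x < 0" "\<omega> \<in> space N"
  then have "Y i \<omega> \<notin> {..x}" for i using Y_unit[of \<omega> i] by auto
  then have "emp k {..x} \<omega> = 0" for k by (simp add: freq_def)
  then show "(\<lambda>k. emp k {..x} \<omega>) \<longlonglongrightarrow> 0" by simp
qed

lemma efreq_one: "1 \<le> x \<Longrightarrow> \<omega> \<in> space N \<Longrightarrow> efreq {..x} \<omega> = 1"
proof (rule efreq_eqI)
  assume "1 \<le> x" "\<omega> \<in> space N"
  then have "Y i \<omega> \<in> {..x}" for i using Y_unit[of \<omega> i] by auto
  then have "emp k {..x} \<omega> = 1" for k by (simp add: freq_def)
  then show "(\<lambda>k. emp k {..x} \<omega>) \<longlonglongrightarrow> 1" by simp
qed

lemma ecdf_at_bot: "\<omega> \<in> space N \<Longrightarrow> (ecdf \<omega> \<longlongrightarrow> 0) at_bot"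
proof (rule tendsto_eventually)
  assume \<omega>: "\<omega> \<in> space N"
  have "ecdf \<omega> x = 0" if "x \<le> -1" for x
    using ecdf_le[of x "-1/2" \<omega>] efreq_zero[of "-1/2" \<omega>] ecdf_nonneg[of \<omega> x] \<omega> that by simp
  then show "\<forall>\<^sub>F x in at_bot. ecdf \<omega> x = 0"
    using eventually_at_bot_linorder by blast
qed

lemma ecdf_at_top: "\<omega> \<in> space N \<Longrightarrow> (ecdf \<omega> \<longlongrightarrow> 1) at_top"
proof (rule tendsto_eventually)
  assume \<omega>: "\<omega> \<in> space N"
  have "ecdf \<omega> x = 1" if "x \<ge> 1" for x
    using efreq_le_ecdf[of x \<omega>] efreq_one[of x \<omega>] ecdf_le_1[of \<omega> x] \<omega> that by simp
  then show "\<forall>\<^sub>F x in at_top. ecdf \<omega> x = 1"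
    using eventually_at_top_linorder by blast
qed

lemma ecdf_measurable [measurable]: "(\<lambda>\<omega>. ecdf \<omega> x) \<in> borel_measurable N"
  unfolding ecdf_def
  by (intro borel_measurable_cINF efreq_measurable efreq_bdd_below) auto

definition directing :: "'w \<Rightarrow> real measure" where
  "directing \<omega> = interval_measure (ecdf \<omega>)"

lemma sets_directing [simp]: "sets (directing \<omega>) = sets borel"
  by (simp add: directing_def)

lemma prob_space_directing: "\<omega> \<in> space N \<Longrightarrow> prob_space (directing \<omega>)"
proof -
  assume "\<omega> \<in> space N"
  then have "real_distribution (directing \<omega>)"
    unfolding directing_def
    by (intro real_distribution_interval_measure ecdf_mono ecdf_right_continuous ecdf_at_bot ecdf_at_top)
  then show ?thesis by (simp add: real_distribution_def)
qed

lemma directing_atMost: "\<omega> \<in> space N \<Longrightarrow> measure (directing \<omega>) {..x} = ecdf \<omega> x"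
  using cdf_interval_measure[of "ecdf \<omega>"] ecdf_mono ecdf_right_continuous ecdf_at_bot
  by (metis cdf_def directing_def)

lemma directing_measurable [measurable]: "directing \<in> measurable N (prob_algebra borel)"
proof (rule measurable_prob_algebra_generated[where \<Omega>=UNIV and G="range atMost"])
  show "sets borel = sigma_sets UNIV (range (atMost :: real \<Rightarrow> _))"
    by (subst borel_eq_atMost) auto
  show "Int_stable (range (atMost :: real \<Rightarrow> _))"
    by (auto simp: Int_stable_def)
  show "(\<lambda>\<omega>. emeasure (directing \<omega>) A) \<in> borel_measurable N" if A: "A \<in> range atMost" for A
  proof -
    obtain x where x: "A = {..x}" using A by auto
    have "emeasure (directing \<omega>) A = ennreal (ecdf \<omega> x)" if "\<omega> \<in> space N" for \<omega>
    proof -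
      interpret D: prob_space "directing \<omega>" using prob_space_directing[OF that] .
      show ?thesis using directing_atMost[OF that] by (simp add: D.emeasure_eq_measure x)
    qed
    then show ?thesis by (simp cong: measurable_cong)
  qed
qed (auto simp: prob_space_directing)

lemma directing_measure_measurable [measurable]:
  "A \<in> sets borel \<Longrightarrow> (\<lambda>\<omega>. measure (directing \<omega>) A) \<in> borel_measurable N"
  by (rule measurable_compose[OF directing_measurable measurable_measure_prob_algebra])

lemma directing_le_1: "\<omega> \<in> space N \<Longrightarrow> measure (directing \<omega>) A \<le> 1"
  using prob_space_directing[of \<omega>] by (simp add: prob_space.prob_le_1)

lemma directing_integrable: "A \<in> sets borel \<Longrightarrow> integrable N (\<lambda>\<omega>. measure (directing \<omega>) A)"
  by (intro bounded_integrable[where B=1]) (auto simp: directing_le_1)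

definition dist_emp :: "nat \<Rightarrow> real set \<Rightarrow> real" where
  "dist_emp k A = expectation (\<lambda>\<omega>. \<bar>emp k A \<omega> - measure (directing \<omega>) A\<bar>)"

lemma expectation_bound3:
  fixes f g1 g2 g3 :: "'w \<Rightarrow> real"
  assumes "integrable N f" "integrable N g1" "integrable N g2" "integrable N g3"
    and "\<And>\<omega>. \<omega> \<in> space N \<Longrightarrow> f \<omega> \<le> g1 \<omega> + g2 \<omega> + g3 \<omega>"
  shows "expectation f \<le> expectation g1 + expectation g2 + expectation g3"
proof -
  have "expectation f \<le> expectation (\<lambda>\<omega>. g1 \<omega> + g2 \<omega> + g3 \<omega>)"
    using assms by (intro integral_mono) auto
  also have "\<dots> = expectation g1 + expectation g2 + expectation g3" using assms by simp
  finally show ?thesis .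
qed

lemma lessThan_4: "finite {..<4 ^ k :: nat}" "{..<4 ^ k :: nat} \<noteq> {}"
  by (auto simp: lessThan_empty_iff)

lemma freq_Un:
  assumes "A \<inter> B = {}"
  shows "freq I (A \<union> B) \<omega> = freq I A \<omega> + freq I B \<omega>"
  using assms by (simp add: freq_def indicator_add[of A B, symmetric] sum.distrib add_divide_distrib)

text \<open>Since \<open>ecdf\<close> is a limit from the right, the half-line is compared through
  slightly larger ones, \<open>{..y n}\<close>. The three errors are the frequency of the gap
  \<open>{x<..y n}\<close>, whose mean is its probability under the law of \<open>Y 0\<close>, the
  L1 error of the frequency at \<open>y n\<close>, and the distance of \<open>efreq\<close> at
  \<open>y n\<close> from \<open>ecdf\<close> at x.\<close>

lemma dist_emp_atMost: "(\<lambda>k. dist_emp k {..x}) \<longlonglongrightarrow> 0"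
proof (rule LIMSEQ_I)
  fix e :: real assume e: "e > 0"
  define y where "y n = x + 1 / real (Suc n)" for n
  have y: "x < y n" for n by (simp add: y_def)
  have "(\<lambda>n. prob {\<omega> \<in> space N. Y 0 \<omega> \<in> {x<..y n}}) \<longlonglongrightarrow> prob (\<Inter>n. {\<omega> \<in> space N. Y 0 \<omega> \<in> {x<..y n}})"
    by (intro finite_Lim_measure_decseq) (auto simp: decseq_def y_def frac_le le_diff_eq intro: order_trans)
  also have "(\<Inter>n. {\<omega> \<in> space N. Y 0 \<omega> \<in> {x<..y n}}) = {}"
  proof -
    have "\<exists>n. \<not> (x < r \<and> r \<le> y n)" for r
    proof (cases "x < r")
      case True
      then obtain n where "1 / real (Suc n) < r - x"
        using reals_Archimedean[of "r - x"] by (auto simp: inverse_eq_divide)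
      then show ?thesis by (intro exI[of _ n]) (auto simp: y_def)
    qed auto
    then show ?thesis by auto
  qed
  finally have l1: "(\<lambda>n. prob {\<omega> \<in> space N. Y 0 \<omega> \<in> {x<..y n}}) \<longlonglongrightarrow> 0" by simp
  have "(\<lambda>n. expectation (\<lambda>\<omega>. \<bar>efreq {..y n} \<omega> - ecdf \<omega> x\<bar>)) \<longlonglongrightarrow> expectation (\<lambda>\<omega>. 0)"
  proof (rule integral_dominated_convergence[where w="\<lambda>_. 1"])
    show "AE \<omega> in N. (\<lambda>n. \<bar>efreq {..y n} \<omega> - ecdf \<omega> x\<bar>) \<longlonglongrightarrow> 0"
      using ecdf_tendsto by (intro AE_I2) (simp add: tendsto_rabs_zero_iff LIM_zero y_def)
    show "AE \<omega> in N. norm \<bar>efreq {..y n} \<omega> - ecdf \<omega> x\<bar> \<le> 1" for n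
    proof (rule AE_I2)
      fix \<omega> show "norm \<bar>efreq {..y n} \<omega> - ecdf \<omega> x\<bar> \<le> 1"
        using efreq_nonneg[of "{..y n}" \<omega>] efreq_le_1[of "{..y n}" \<omega>] ecdf_nonneg[of \<omega> x] ecdf_le_1[of \<omega> x] by simp
    qed
  qed auto
  then have l2: "(\<lambda>n. expectation (\<lambda>\<omega>. \<bar>efreq {..y n} \<omega> - ecdf \<omega> x\<bar>)) \<longlonglongrightarrow> 0" by simp
  have "eventually (\<lambda>n. prob {\<omega> \<in> space N. Y 0 \<omega> \<in> {x<..y n}} < e / 3 \<and>
     expectation (\<lambda>\<omega>. \<bar>efreq {..y n} \<omega> - ecdf \<omega> x\<bar>) < e / 3) sequentially"
    using e by (intro eventually_conj order_tendstoD(2)[OF l1] order_tendstoD(2)[OF l2]) auto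
  then obtain n where n: "prob {\<omega> \<in> space N. Y 0 \<omega> \<in> {x<..y n}} < e / 3"
      "expectation (\<lambda>\<omega>. \<bar>efreq {..y n} \<omega> - ecdf \<omega> x\<bar>) < e / 3"
    by (auto simp: eventually_sequentially)
  have "eventually (\<lambda>k. expectation (\<lambda>\<omega>. \<bar>emp k {..y n} \<omega> - efreq {..y n} \<omega>\<bar>) < e / 3) sequentially"
    using e by (intro order_tendstoD(2)[OF emp_tendsto_efreq]) auto
  then obtain K where K: "\<And>k. k \<ge> K \<Longrightarrow> expectation (\<lambda>\<omega>. \<bar>emp k {..y n} \<omega> - efreq {..y n} \<omega>\<bar>) < e / 3"
    by (auto simp: eventually_sequentially)
  have "dist_emp k {..x} < e" if k: "k \<ge> K" for k
  proof -
    have "dist_emp k {..x} \<le> expectation (\<lambda>\<omega>. emp k {x<..y n} \<omega>) +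
        expectation (\<lambda>\<omega>. \<bar>emp k {..y n} \<omega> - efreq {..y n} \<omega>\<bar>) + expectation (\<lambda>\<omega>. \<bar>efreq {..y n} \<omega> - ecdf \<omega> x\<bar>)"
      unfolding dist_emp_def
    proof (rule expectation_bound3)
      fix \<omega> assume \<omega>: "\<omega> \<in> space N"
      have "emp k {..y n} \<omega> = emp k {..x} \<omega> + emp k {x<..y n} \<omega>"
        using y[of n] by (subst freq_Un[symmetric]) (auto intro!: arg_cong[where f="\<lambda>A. freq _ A \<omega>"])
      then show "\<bar>emp k {..x} \<omega> - measure (directing \<omega>) {..x}\<bar> \<le> emp k {x<..y n} \<omega> +
        \<bar>emp k {..y n} \<omega> - efreq {..y n} \<omega>\<bar> + \<bar>efreq {..y n} \<omega> - ecdf \<omega> x\<bar>"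
        using freq_nonneg[of "{..<4^k}" "{x<..y n}" \<omega>] directing_atMost[OF \<omega>, of x] by simp
    next
      show "integrable N (\<lambda>\<omega>. \<bar>efreq {..y n} \<omega> - ecdf \<omega> x\<bar>)"
        by (intro integrable_abs Bochner_Integration.integrable_diff efreq_integrable bounded_integrable[where B=1])
          (auto simp: ecdf_nonneg ecdf_le_1)
    qed (auto intro!: integrable_abs Bochner_Integration.integrable_diff freq_integrable efreq_integrable directing_integrable)
    also have "expectation (\<lambda>\<omega>. emp k {x<..y n} \<omega>) = prob {\<omega> \<in> space N. Y 0 \<omega> \<in> {x<..y n}}"
      by (intro expectation_freq lessThan_4) auto
    finally show ?thesis using n K[OF k] by linarith
  qed
  moreover have "0 \<le> dist_emp k {..x}" for k unfolding dist_emp_def by simp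
  ultimately show "\<exists>no. \<forall>n\<ge>no. norm (dist_emp n {..x} - 0) < e" by (intro exI[of _ K]) auto
qed

text \<open>The sets with vanishing L1 error form a Dynkin class containing the half-lines. A
  complement has the same error; a countable disjoint union is cut after m pieces, its tail being
  small in mean both for the frequencies and for the directing measure.\<close>

lemma dist_emp_tendsto:
  assumes "A \<in> sets borel"
  shows "(\<lambda>k. dist_emp k A) \<longlonglongrightarrow> 0"
proof -
  have gen: "sets borel = sigma_sets UNIV (range (atMost :: real \<Rightarrow> _))"
    by (subst borel_eq_atMost) auto
  have A: "A \<in> sigma_sets UNIV (range atMost)" using assms gen by simp
  have stable: "Int_stable (range (atMost :: real \<Rightarrow> _))" by (auto simp: Int_stable_def)
  have "range atMost \<subseteq> Pow (UNIV :: real set)" by auto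
  from stable this A show ?thesis
  proof (induction rule: sigma_sets_induct_disjoint)
    show "(\<lambda>k. dist_emp k A) \<longlonglongrightarrow> 0" if "A \<in> range atMost" for A
      using that dist_emp_atMost by auto
    show "(\<lambda>k. dist_emp k {}) \<longlonglongrightarrow> 0" by (simp add: dist_emp_def freq_def)
  next
    fix A :: "real set" assume A: "A \<in> sigma_sets UNIV (range atMost)" and l: "(\<lambda>k. dist_emp k A) \<longlonglongrightarrow> 0"
    have A': "A \<in> sets borel" using A gen by simp
    have "dist_emp k (UNIV - A) = dist_emp k A" for k
      unfolding dist_emp_def
    proof (intro Bochner_Integration.integral_cong refl)
      fix \<omega> assume \<omega>: "\<omega> \<in> space N"
      interpret D: prob_space "directing \<omega>" using prob_space_directing[OF \<omega>] .
      have "emp k (UNIV - A) \<omega> + emp k A \<omega> = emp k UNIV \<omega>"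
        by (subst freq_Un[symmetric]) (auto intro!: arg_cong[where f="\<lambda>A. freq _ A \<omega>"])
      moreover have "emp k UNIV \<omega> = 1" by (simp add: freq_def)
      moreover have "measure (directing \<omega>) (UNIV - A) = 1 - measure (directing \<omega>) A"
        using D.prob_compl[of A] A' by (simp add: directing_def)
      ultimately show "\<bar>emp k (UNIV - A) \<omega> - measure (directing \<omega>) (UNIV - A)\<bar> = \<bar>emp k A \<omega> - measure (directing \<omega>) A\<bar>"
        by linarith
    qed
    then show "(\<lambda>k. dist_emp k (UNIV - A)) \<longlonglongrightarrow> 0" using l by simp
  next
    fix A :: "nat \<Rightarrow> real set"
    assume disj: "disjoint_family A" and A: "range A \<subseteq> sigma_sets UNIV (range atMost)"
      and l: "\<And>i. (\<lambda>k. dist_emp k (A i)) \<longlonglongrightarrow> 0"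
    have A' [measurable]: "A i \<in> sets borel" for i using A gen by auto
    \<comment> \<open>\<open>R m\<close> is the tail of the union; it decreases to the empty set
      because the pieces are disjoint.\<close>
    define R where "R m = (\<Union>i\<in>{m..}. A i)" for m
    have R [measurable]: "R m \<in> sets borel" for m unfolding R_def by measurable
    have UR1: "(\<Union>i. A i) = (\<Union>i<m. A i) \<union> R m" for m
      unfolding R_def by (auto simp: not_less) (metis atLeast_iff lessThan_iff not_less)
    have UR2: "(\<Union>i<m. A i) \<inter> R m = {}" for m
    proof -
      have "A i \<inter> A j = {}" if "i < m" "j \<ge> m" for i j
        using disj that unfolding disjoint_family_on_def by auto
      then show ?thesis unfolding R_def by (simp add: Int_UN_distrib2)
    qed
    note UR = UR1 UR2
    have Rdec: "decseq R" unfolding R_def decseq_def by force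
    have RInt: "(\<Inter>m. R m) = {}"
    proof (rule equals0I)
      fix x assume x: "x \<in> (\<Inter>m. R m)"
      then obtain i where i: "x \<in> A i" unfolding R_def by blast
      have "x \<in> R (Suc i)" using x by blast
      moreover have "x \<in> (\<Union>i<Suc i. A i)" using i by blast
      ultimately show False using UR2[of "Suc i"] by blast
    qed
    have "(\<lambda>m. prob {\<omega> \<in> space N. Y 0 \<omega> \<in> R m}) \<longlonglongrightarrow> prob (\<Inter>m. {\<omega> \<in> space N. Y 0 \<omega> \<in> R m})"
      using Rdec by (intro finite_Lim_measure_decseq) (auto simp: decseq_def)
    also have "(\<Inter>m. {\<omega> \<in> space N. Y 0 \<omega> \<in> R m}) = {}" using RInt by auto
    finally have l1: "(\<lambda>m. prob {\<omega> \<in> space N. Y 0 \<omega> \<in> R m}) \<longlonglongrightarrow> 0" by simp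
    have "(\<lambda>m. expectation (\<lambda>\<omega>. measure (directing \<omega>) (R m))) \<longlonglongrightarrow> expectation (\<lambda>\<omega>. 0)"
    proof (rule integral_dominated_convergence[where w="\<lambda>_. 1"])
      show "AE \<omega> in N. (\<lambda>m. measure (directing \<omega>) (R m)) \<longlonglongrightarrow> 0"
      proof (rule AE_I2)
        fix \<omega> assume \<omega>: "\<omega> \<in> space N"
        interpret D: prob_space "directing \<omega>" using prob_space_directing[OF \<omega>] .
        have "(\<lambda>m. measure (directing \<omega>) (R m)) \<longlonglongrightarrow> measure (directing \<omega>) (\<Inter>m. R m)"
          using Rdec by (intro D.finite_Lim_measure_decseq) auto
        then show "(\<lambda>m. measure (directing \<omega>) (R m)) \<longlonglongrightarrow> 0" using RInt by simp
      qed
    qed (auto simp: directing_le_1 intro!: AE_I2)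
    then have l2: "(\<lambda>m. expectation (\<lambda>\<omega>. measure (directing \<omega>) (R m))) \<longlonglongrightarrow> 0" by simp
    show "(\<lambda>k. dist_emp k (\<Union>i. A i)) \<longlonglongrightarrow> 0"
    proof (rule LIMSEQ_I)
      fix e :: real assume e: "e > 0"
      have "eventually (\<lambda>m. prob {\<omega> \<in> space N. Y 0 \<omega> \<in> R m} < e / 3 \<and>
          expectation (\<lambda>\<omega>. measure (directing \<omega>) (R m)) < e / 3) sequentially"
        using e by (intro eventually_conj order_tendstoD(2)[OF l1] order_tendstoD(2)[OF l2]) auto
      then obtain m where m: "prob {\<omega> \<in> space N. Y 0 \<omega> \<in> R m} < e / 3"
          "expectation (\<lambda>\<omega>. measure (directing \<omega>) (R m)) < e / 3"
        by (auto simp: eventually_sequentially)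
      have "(\<lambda>k. \<Sum>i<m. dist_emp k (A i)) \<longlonglongrightarrow> 0" using l by (intro tendsto_null_sum)
      then have "eventually (\<lambda>k. (\<Sum>i<m. dist_emp k (A i)) < e / 3) sequentially"
        using e by (intro order_tendstoD(2)) auto
      then obtain K where K: "\<And>k. k \<ge> K \<Longrightarrow> (\<Sum>i<m. dist_emp k (A i)) < e / 3"
        by (auto simp: eventually_sequentially)
      have "dist_emp k (\<Union>i. A i) < e" if k: "k \<ge> K" for k
      proof -
        have int: "integrable N (\<lambda>\<omega>. \<bar>emp k (A i) \<omega> - measure (directing \<omega>) (A i)\<bar>)" for i
          by (intro integrable_abs Bochner_Integration.integrable_diff freq_integrable directing_integrable A')
        have "dist_emp k (\<Union>i. A i) \<le> expectation (\<lambda>\<omega>. \<Sum>i<m. \<bar>emp k (A i) \<omega> - measure (directing \<omega>) (A i)\<bar>)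
          + expectation (emp k (R m)) + expectation (\<lambda>\<omega>. measure (directing \<omega>) (R m))"
          unfolding dist_emp_def
        proof (rule expectation_bound3)
          fix \<omega> assume \<omega>: "\<omega> \<in> space N"
          interpret D: prob_space "directing \<omega>" using prob_space_directing[OF \<omega>] .
          have "emp k (\<Union>i<m. A i) \<omega> = (\<Sum>i<m. emp k (A i) \<omega>)"
          proof (induction m)
            case (Suc m)
            have "(\<Union>i<Suc m. A i) = (\<Union>i<m. A i) \<union> A m" by (auto simp: less_Suc_eq)
            moreover have "A i \<inter> A m = {}" if "i < m" for i
              using disj that unfolding disjoint_family_on_def by auto
            then have "(\<Union>i<m. A i) \<inter> A m = {}" by blast
            ultimately show ?case using Suc freq_Un by simp
          qed (simp add: freq_def)
          then have e1: "emp k (\<Union>i. A i) \<omega> = (\<Sum>i<m. emp k (A i) \<omega>) + emp k (R m) \<omega>"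
            using UR[of m] freq_Un by simp
          have "measure (directing \<omega>) (\<Union>i<m. A i) = (\<Sum>i<m. measure (directing \<omega>) (A i))"
            using disj by (intro D.finite_measure_finite_Union) (auto simp: disjoint_family_on_def)
          then have e2: "measure (directing \<omega>) (\<Union>i. A i) = (\<Sum>i<m. measure (directing \<omega>) (A i)) + measure (directing \<omega>) (R m)"
            unfolding UR(1)[of m] using UR(2)[of m] by (subst D.finite_measure_Union) auto
          have "\<bar>(\<Sum>i<m. emp k (A i) \<omega>) - (\<Sum>i<m. measure (directing \<omega>) (A i))\<bar> \<le>
              (\<Sum>i<m. \<bar>emp k (A i) \<omega> - measure (directing \<omega>) (A i)\<bar>)"
            by (simp add: sum_abs flip: sum_subtractf)
          then show "\<bar>emp k (\<Union>i. A i) \<omega> - measure (directing \<omega>) (\<Union>i. A i)\<bar> \<le>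
              (\<Sum>i<m. \<bar>emp k (A i) \<omega> - measure (directing \<omega>) (A i)\<bar>) + emp k (R m) \<omega> + measure (directing \<omega>) (R m)"
            unfolding e1 e2 using freq_nonneg[of "{..<4^k}" "R m" \<omega>] measure_nonneg[of "directing \<omega>" "R m"] by linarith
        qed (auto intro!: int integrable_abs Bochner_Integration.integrable_sum Bochner_Integration.integrable_diff freq_integrable directing_integrable)
        also have "expectation (\<lambda>\<omega>. \<Sum>i<m. \<bar>emp k (A i) \<omega> - measure (directing \<omega>) (A i)\<bar>) = (\<Sum>i<m. dist_emp k (A i))"
          unfolding dist_emp_def by (intro Bochner_Integration.integral_sum int)
        also have "expectation (emp k (R m)) = prob {\<omega> \<in> space N. Y 0 \<omega> \<in> R m}"
          by (intro expectation_freq lessThan_4 R)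
        finally show ?thesis using m K[OF k] by linarith
      qed
      moreover have "0 \<le> dist_emp k (\<Union>i. A i)" for k unfolding dist_emp_def by simp
      ultimately show "\<exists>no. \<forall>n\<ge>no. norm (dist_emp n (\<Union>i. A i) - 0) < e" by (intro exI[of _ K]) auto
    qed
  qed
qed

text \<open>Over disjoint index blocks the frequencies factorise exactly: expanding their product
  selects distinct indices, so every summand has the probability on the left as its mean. Each
  frequency is then exchanged for the directing measure at a cost that tends to 0.\<close>

lemma directing_prob:
  assumes J: "finite J" and A: "\<And>i. i \<in> J \<Longrightarrow> A i \<in> sets borel"
  shows "prob {\<omega> \<in> space N. \<forall>i\<in>J. Y i \<omega> \<in> A i} = expectation (\<lambda>\<omega>. \<Prod>i\<in>J. measure (directing \<omega>) (A i))"
proof -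
  define p where "p = prob {\<omega> \<in> space N. \<forall>i\<in>J. Y i \<omega> \<in> A i}"
  \<comment> \<open>\<open>prod_encode\<close> gives each event its own block of
    \<open>4 ^ k\<close> indices, disjoint from the others, so that every selection is
    injective.\<close>
  define I where "I = (\<lambda>k i. (\<lambda>m. prod_encode (i, m)) ` {..<4 ^ k :: nat})"
  have finI: "finite (I k i)" for k i by (simp add: I_def)
  have cardI: "card (I k i) = 4 ^ k" for k i
    unfolding I_def by (subst card_image) (auto intro: inj_onI)
  have neI: "I k i \<noteq> {}" for k i using cardI[of k i] by auto
  have block: "expectation (\<lambda>\<omega>. \<Prod>i\<in>J. freq (I k i) (A i) \<omega>) = p" for k
  proof -
    have card: "card (PiE J (I k)) = (4 ^ k) ^ card J"
      using J by (simp add: card_PiE cardI)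
    have "(\<Prod>i\<in>J. freq (I k i) (A i) \<omega>) =
        (\<Sum>f\<in>PiE J (I k). \<Prod>i\<in>J. indicat_real (A i) (Y (f i) \<omega>)) / (4 ^ k) ^ card J" for \<omega>
      using J by (simp add: freq_def cardI prod_dividef prod_sum_PiE finI)
    moreover have "expectation (\<lambda>\<omega>. \<Prod>i\<in>J. indicat_real (A i) (Y (f i) \<omega>)) = p \<and>
        integrable N (\<lambda>\<omega>. \<Prod>i\<in>J. indicat_real (A i) (Y (f i) \<omega>))" if f: "f \<in> PiE J (I k)" for f
    proof -
      have inj: "inj_on f J"
      proof (rule inj_onI)
        fix i j assume "i \<in> J" "j \<in> J" "f i = f j"
        then have "f i \<in> I k i" "f i \<in> I k j" using f by (auto simp: PiE_iff)
        then show "i = j" by (auto simp: I_def)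
      qed
      have meas: "{\<omega> \<in> space N. \<forall>i\<in>J. Y (f i) \<omega> \<in> A i} \<in> sets N"
        using J A by (intro sets.sets_Collect_finite_All) (auto intro!: measurable_sets_Collect[OF measurable_Y])
      have eq: "(\<Prod>i\<in>J. indicat_real (A i) (Y (f i) \<omega>)) = indicat_real {\<omega> \<in> space N. \<forall>i\<in>J. Y (f i) \<omega> \<in> A i} \<omega>"
        if "\<omega> \<in> space N" for \<omega>
        using J that by (auto simp: indicator_def prod_zero_iff intro!: prod.neutral)
      have "expectation (\<lambda>\<omega>. \<Prod>i\<in>J. indicat_real (A i) (Y (f i) \<omega>)) =
         expectation (indicat_real {\<omega> \<in> space N. \<forall>i\<in>J. Y (f i) \<omega> \<in> A i})"
        by (intro Bochner_Integration.integral_cong eq refl)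
      also have "\<dots> = p" using meas exchangeable[OF J inj A] by (simp add: p_def)
      finally have e1: "expectation (\<lambda>\<omega>. \<Prod>i\<in>J. indicat_real (A i) (Y (f i) \<omega>)) = p" .
      have "integrable N (\<lambda>\<omega>. \<Prod>i\<in>J. indicat_real (A i) (Y (f i) \<omega>)) \<longleftrightarrow>
        integrable N (indicat_real {\<omega> \<in> space N. \<forall>i\<in>J. Y (f i) \<omega> \<in> A i})"
        by (intro Bochner_Integration.integrable_cong eq refl)
      moreover have "integrable N (indicat_real {\<omega> \<in> space N. \<forall>i\<in>J. Y (f i) \<omega> \<in> A i})"
        using meas by (intro integrable_real_indicator) (auto simp: emeasure_eq_measure)
      ultimately show ?thesis using e1 by simp
    qed
    ultimately show ?thesis
      using card by (simp add: Bochner_Integration.integral_sum)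
  qed
  have bound: "\<bar>p - expectation (\<lambda>\<omega>. \<Prod>i\<in>J. measure (directing \<omega>) (A i))\<bar> \<le>
     (\<Sum>i\<in>J. sqrt (4 / 4 ^ k) + dist_emp k (A i))" for k
  proof -
    have int1: "integrable N (\<lambda>\<omega>. \<bar>freq (I k i) (A i) \<omega> - measure (directing \<omega>) (A i)\<bar>)" if "i \<in> J" for i
      using A[OF that] by (intro integrable_abs Bochner_Integration.integrable_diff freq_integrable directing_integrable)
    have le1: "\<bar>\<Prod>i\<in>J. f i\<bar> \<le> 1" if "\<And>i. i \<in> J \<Longrightarrow> 0 \<le> f i \<and> f i \<le> 1" for f :: "nat \<Rightarrow> real"
      using that by (simp add: abs_prod prod_le_1)
    have int2: "integrable N (\<lambda>\<omega>. \<Prod>i\<in>J. freq (I k i) (A i) \<omega>)"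
      using A by (intro bounded_integrable[where B=1] le1) (auto intro: freq_nonneg freq_le_1)
    have int3: "integrable N (\<lambda>\<omega>. \<Prod>i\<in>J. measure (directing \<omega>) (A i))"
      using A by (intro bounded_integrable[where B=1] le1) (auto intro: directing_le_1)
    have "\<bar>p - expectation (\<lambda>\<omega>. \<Prod>i\<in>J. measure (directing \<omega>) (A i))\<bar> =
       \<bar>expectation (\<lambda>\<omega>. (\<Prod>i\<in>J. freq (I k i) (A i) \<omega>) - (\<Prod>i\<in>J. measure (directing \<omega>) (A i)))\<bar>"
      using int2 int3 by (simp add: block)
    also have "\<dots> \<le> expectation (\<lambda>\<omega>. \<bar>(\<Prod>i\<in>J. freq (I k i) (A i) \<omega>) - (\<Prod>i\<in>J. measure (directing \<omega>) (A i))\<bar>)"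
      by (rule integral_abs_bound)
    also have "\<dots> \<le> expectation (\<lambda>\<omega>. \<Sum>i\<in>J. \<bar>freq (I k i) (A i) \<omega> - measure (directing \<omega>) (A i)\<bar>)"
    proof (intro integral_mono integrable_abs Bochner_Integration.integrable_diff int2 int3 Bochner_Integration.integrable_sum int1)
      fix \<omega> assume "\<omega> \<in> space N"
      then show "\<bar>(\<Prod>i\<in>J. freq (I k i) (A i) \<omega>) - (\<Prod>i\<in>J. measure (directing \<omega>) (A i))\<bar> \<le>
          (\<Sum>i\<in>J. \<bar>freq (I k i) (A i) \<omega> - measure (directing \<omega>) (A i)\<bar>)"
        using norm_prod_diff[of J "\<lambda>i. freq (I k i) (A i) \<omega>" "\<lambda>i. measure (directing \<omega>) (A i)"]
        by (simp add: freq_nonneg freq_le_1 directing_le_1)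
    qed (use A in \<open>auto intro!: freq_integrable directing_integrable\<close>)
    also have "\<dots> = (\<Sum>i\<in>J. expectation (\<lambda>\<omega>. \<bar>freq (I k i) (A i) \<omega> - measure (directing \<omega>) (A i)\<bar>))"
      by (intro Bochner_Integration.integral_sum int1)
    also have "\<dots> \<le> (\<Sum>i\<in>J. sqrt (4 / 4 ^ k) + dist_emp k (A i))"
    proof (intro sum_mono)
      fix i assume i: "i \<in> J"
      have "expectation (\<lambda>\<omega>. \<bar>freq (I k i) (A i) \<omega> - measure (directing \<omega>) (A i)\<bar>) \<le>
        expectation (\<lambda>\<omega>. \<bar>freq (I k i) (A i) \<omega> - emp k (A i) \<omega>\<bar>) + dist_emp k (A i) + expectation (\<lambda>\<omega>. 0)"
        unfolding dist_emp_def using A[OF i]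
        by (intro expectation_bound3 integrable_abs Bochner_Integration.integrable_diff freq_integrable directing_integrable) auto
      \<comment> \<open>Both blocks have \<open>4 ^ k\<close> elements, so \<open>freq_diff\<close>
        puts \<open>2 / 4 ^ k + 2 / 4 ^ k\<close> under the root.\<close>
      moreover have "expectation (\<lambda>\<omega>. \<bar>freq (I k i) (A i) \<omega> - emp k (A i) \<omega>\<bar>) \<le> sqrt (4 / 4 ^ k)"
        using freq_diff[OF A[OF i] finI[of k i] neI[of k i] lessThan_4[of k]] by (simp add: cardI flip: add_divide_distrib)
      ultimately show "expectation (\<lambda>\<omega>. \<bar>freq (I k i) (A i) \<omega> - measure (directing \<omega>) (A i)\<bar>) \<le> sqrt (4 / 4 ^ k) + dist_emp k (A i)"
        by simp
    qed
    finally show ?thesis .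
  qed
  have "(\<lambda>k. sqrt (4 / 4 ^ k)) \<longlonglongrightarrow> sqrt 0"
    by (intro tendsto_real_sqrt) real_asymp
  then have "(\<lambda>k. \<Sum>i\<in>J. sqrt (4 / 4 ^ k) + dist_emp k (A i)) \<longlonglongrightarrow> 0"
    using A by (intro tendsto_null_sum tendsto_add_zero dist_emp_tendsto) auto
  then have "\<bar>p - expectation (\<lambda>\<omega>. \<Prod>i\<in>J. measure (directing \<omega>) (A i))\<bar> \<le> 0"
    by (rule LIMSEQ_le_const) (use bound in auto)
  then show ?thesis by (simp add: p_def)
qed

end


section \<open>De Finetti's theorem for state spaces coded by reals\<close>

context exchangeable_sequence
begin

text \<open>The code reduces the claim to sequences in the unit interval. As \<open>g\<close> is
  defined on all reals, pushing the directing measure forward by \<open>g\<close> gives a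
  probability measure on \<open>S\<close> at every point. On product sets the two sides match
  because \<open>j (Y i \<omega>)\<close> lies in the preimage of \<open>A i\<close> under
  \<open>g\<close> exactly when \<open>Y i \<omega>\<close> lies in \<open>A i\<close>.\<close>

lemma de_finetti:
  fixes j :: "'s \<Rightarrow> real"
  assumes j [measurable]: "j \<in> borel_measurable S" and j01: "\<And>x. x \<in> space S \<Longrightarrow> j x \<in> {0..1}"
    and g [measurable]: "g \<in> measurable borel S" and gj: "\<And>x. x \<in> space S \<Longrightarrow> g (j x) = x"
  obtains \<kappa> where "\<kappa> \<in> measurable N (prob_algebra S)"
    "distr N (PiM UNIV (\<lambda>_. S)) (\<lambda>\<omega> i. Y i \<omega>) = N \<bind> (\<lambda>\<omega>. PiM UNIV (\<lambda>_::nat. \<kappa> \<omega>))"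
proof -
  have Ysp: "Y i \<omega> \<in> space S" if "\<omega> \<in> space N" for i \<omega>
    using measurable_space[OF measurable_Y that] .
  interpret E: exchangeable_unit_sequence N "\<lambda>i \<omega>. j (Y i \<omega>)"
  proof unfold_locales
    show "(\<lambda>\<omega>. j (Y i \<omega>)) \<in> borel_measurable N" for i by measurable
    show "j (Y i \<omega>) \<in> {0..1}" if "\<omega> \<in> space N" for i \<omega> using j01[OF Ysp[OF that]] .
    fix J :: "nat set" and f :: "nat \<Rightarrow> nat" and A :: "nat \<Rightarrow> real set"
    assume J: "finite J" and f: "inj_on f J" and A: "\<And>i. i \<in> J \<Longrightarrow> A i \<in> sets borel"
    have "prob {\<omega> \<in> space N. \<forall>i\<in>J. Y (f i) \<omega> \<in> j -` A i \<inter> space S} =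
        prob {\<omega> \<in> space N. \<forall>i\<in>J. Y i \<omega> \<in> j -` A i \<inter> space S}"
      using measurable_sets[OF j] A by (intro exchangeable J f) auto
    then show "prob {\<omega> \<in> space N. \<forall>i\<in>J. j (Y (f i) \<omega>) \<in> A i} =
        prob {\<omega> \<in> space N. \<forall>i\<in>J. j (Y i \<omega>) \<in> A i}"
      using Ysp by (simp cong: conj_cong)
  qed
  define \<kappa> where "\<kappa> = (\<lambda>\<omega>. distr (E.directing \<omega>) S g)"
  have \<kappa>: "\<kappa> \<in> measurable N (prob_algebra S)"
    unfolding \<kappa>_def by (rule measurable_compose[OF E.directing_measurable measurable_distr_prob_space[OF g]])
  have K: "(\<lambda>\<omega>. PiM UNIV (\<lambda>_::nat. \<kappa> \<omega>)) \<in> measurable N (prob_algebra (PiM UNIV (\<lambda>_. S)))"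
    by (rule measurable_compose[OF \<kappa> measurable_PiM_kernel])
  have N: "N \<in> space (prob_algebra N)"
    using prob_space_axioms by (simp add: space_prob_algebra)
  have Y: "(\<lambda>\<omega> i. Y i \<omega>) \<in> measurable N (PiM UNIV (\<lambda>_. S))"
    by (rule measurable_PiM_single') (auto simp: Ysp)
  have "distr N (PiM UNIV (\<lambda>_. S)) (\<lambda>\<omega> i. Y i \<omega>) = N \<bind> (\<lambda>\<omega>. PiM UNIV (\<lambda>_::nat. \<kappa> \<omega>))"
  proof (rule measure_eqI_PiM_infinite)
    show "finite_measure (distr N (PiM UNIV (\<lambda>_. S)) (\<lambda>\<omega> i. Y i \<omega>))"
      by (intro finite_measure_distr Y)
    show "sets (N \<bind> (\<lambda>\<omega>. PiM UNIV (\<lambda>_::nat. \<kappa> \<omega>))) = sets (PiM UNIV (\<lambda>_. S))"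
      by (rule sets_bind'[OF N K])
    fix A :: "nat \<Rightarrow> 's set" and J :: "nat set"
    assume J: "finite J" and A: "\<And>i. i \<in> J \<Longrightarrow> A i \<in> sets S"
    let ?X = "prod_emb UNIV (\<lambda>_. S) J (PiE J A)"
    have X: "?X \<in> sets (PiM UNIV (\<lambda>_. S))" using J A by (intro sets_PiM_I) auto
    have gA: "g -` A i \<in> sets borel" if "i \<in> J" for i
      using measurable_sets[OF g A[OF that]] by simp
    have "emeasure (N \<bind> (\<lambda>\<omega>. PiM UNIV (\<lambda>_::nat. \<kappa> \<omega>))) ?X = (\<integral>\<^sup>+\<omega>. emeasure (PiM UNIV (\<lambda>_::nat. \<kappa> \<omega>)) ?X \<partial>N)"
      by (rule emeasure_bind_prob_algebra[OF N K X])
    also have "\<dots> = (\<integral>\<^sup>+\<omega>. ennreal (\<Prod>i\<in>J. measure (E.directing \<omega>) (g -` A i)) \<partial>N)"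
    proof (rule nn_integral_cong)
      fix \<omega> assume \<omega>: "\<omega> \<in> space N"
      interpret D: prob_space "E.directing \<omega>" using E.prob_space_directing[OF \<omega>] .
      have gm: "g \<in> measurable (E.directing \<omega>) S"
        using g measurable_cong_sets[OF E.sets_directing[of \<omega>] refl] by blast
      have "prob_space (\<kappa> \<omega>)" unfolding \<kappa>_def by (rule D.prob_space_distr[OF gm])
      moreover have "?X = prod_emb UNIV (\<lambda>_. \<kappa> \<omega>) J (PiE J A)"
        by (simp add: prod_emb_def \<kappa>_def)
      ultimately have "emeasure (PiM UNIV (\<lambda>_::nat. \<kappa> \<omega>)) ?X = (\<Prod>i\<in>J. emeasure (\<kappa> \<omega>) (A i))"
        using J A by (simp add: emeasure_PiM_emb \<kappa>_def)
      also have "\<dots> = (\<Prod>i\<in>J. ennreal (measure (E.directing \<omega>) (g -` A i)))"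
        using A sets_eq_imp_space_eq[OF E.sets_directing[of \<omega>]]
        by (intro prod.cong refl) (simp add: \<kappa>_def emeasure_distr[OF gm] D.emeasure_eq_measure)
      also have "\<dots> = ennreal (\<Prod>i\<in>J. measure (E.directing \<omega>) (g -` A i))"
        by (rule prod_ennreal) simp
      finally show "emeasure (PiM UNIV (\<lambda>_::nat. \<kappa> \<omega>)) ?X = ennreal (\<Prod>i\<in>J. measure (E.directing \<omega>) (g -` A i))" .
    qed
    also have "\<dots> = ennreal (expectation (\<lambda>\<omega>. \<Prod>i\<in>J. measure (E.directing \<omega>) (g -` A i)))"
    proof (rule nn_integral_eq_integral)
      show "integrable N (\<lambda>\<omega>. \<Prod>i\<in>J. measure (E.directing \<omega>) (g -` A i))"
        using gA by (intro bounded_integrable[where B=1])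
          (auto simp: abs_prod intro!: prod_le_1 E.directing_le_1)
    qed (auto intro!: AE_I2 prod_nonneg)
    also have "\<dots> = ennreal (prob {\<omega> \<in> space N. \<forall>i\<in>J. j (Y i \<omega>) \<in> g -` A i})"
      by (subst E.directing_prob[OF J gA]) auto
    also have "\<dots> = emeasure N ((\<lambda>\<omega> i. Y i \<omega>) -` ?X \<inter> space N)"
      using gj Ysp by (auto simp: emeasure_eq_measure prod_emb_def PiE_iff space_PiM intro!: arg_cong[where f="measure N"])
    also have "\<dots> = emeasure (distr N (PiM UNIV (\<lambda>_. S)) (\<lambda>\<omega> i. Y i \<omega>)) ?X"
      by (rule emeasure_distr[OF Y X, symmetric])
    finally show "emeasure (distr N (PiM UNIV (\<lambda>_. S)) (\<lambda>\<omega> i. Y i \<omega>)) ?X =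
      emeasure (N \<bind> (\<lambda>\<omega>. PiM UNIV (\<lambda>_::nat. \<kappa> \<omega>))) ?X" by simp
  qed simp
  then show ?thesis using that \<kappa> by blast
qed

end

text \<open>A point is coded by the ternary expansion (with digits 0 and 1) that records which balls of
  radius \<open>2\<^sup>-\<^sup>m\<close> around a dense sequence contain it.\<close>

lemma polish_space_code:
  obtains j :: "'a::polish_space \<Rightarrow> real" and g :: "real \<Rightarrow> 'a"
  where "j \<in> borel_measurable borel" "\<And>x. j x \<in> {0..1}" "g \<in> borel_measurable borel" "\<And>x. g (j x) = x"
proof -
  obtain D :: "'a set" where D: "countable D" "\<And>X. open X \<Longrightarrow> X \<noteq> {} \<Longrightarrow> \<exists>d\<in>D. d \<in> X"
    using countable_dense_setE by blast
  have "D \<noteq> {}" using D(2)[of UNIV] by auto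
  define d where "d = from_nat_into D"
  have dense: "\<exists>k. dist x (d k) < e" if "e > 0" for x e
  proof -
    obtain y where "y \<in> D" "y \<in> ball x e" using D(2)[of "ball x e"] \<open>e > 0\<close> by auto
    then show ?thesis
      using from_nat_into_surj[OF D(1)] by (metis d_def mem_ball)
  qed
  define b where "b n x = (dist x (d (snd (prod_decode n))) < (1 / 2) ^ fst (prod_decode n))" for n x
  define t where "t x n = (\<Sum>m. of_bool (b (n + m) x) * (1 / 3 :: real) ^ Suc m)" for x n
  have geo: "(\<lambda>m. (1 / 3 :: real) ^ Suc m) sums (1 / 2)"
    using sums_mult[OF geometric_sums[of "1 / 3 :: real"], of "1 / 3"] by simp
  have summ: "summable (\<lambda>m. of_bool (b (n + m) x) * (1 / 3 :: real) ^ Suc m)" for n x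
    by (rule summable_comparison_test'[OF sums_summable[OF geo], of 0]) auto
  have t_nonneg: "0 \<le> t x n" for x n unfolding t_def by (intro suminf_nonneg summ) auto
  have t_le: "t x n \<le> 1 / 2" for x n
    unfolding t_def sums_unique[OF geo] by (intro suminf_le summ sums_summable[OF geo]) auto
  have t_rec: "t x n = (of_bool (b n x) + t x (Suc n)) / 3" for x n
  proof -
    have "(\<Sum>m. of_bool (b (n + Suc m) x) * (1 / 3 :: real) ^ Suc (Suc m)) = t x n - of_bool (b n x) * (1 / 3)"
      unfolding t_def using suminf_split_head[OF summ[of n x]] by simp
    moreover have "(\<Sum>m. of_bool (b (n + Suc m) x) * (1 / 3 :: real) ^ Suc (Suc m)) =
        (\<Sum>m. (1 / 3) * (of_bool (b (Suc n + m) x) * (1 / 3 :: real) ^ Suc m))" by (simp add: mult_ac)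
    moreover have "\<dots> = (1 / 3) * t x (Suc n)" unfolding t_def by (rule suminf_mult[OF summ])
    ultimately show ?thesis by simp
  qed
  \<comment> \<open>After a digit 0 at most \<open>(1 / 2) / 3\<close> remains, which is below
    \<open>1 / 3\<close>. This gap makes the digits readable from the sum; in base 2 it would
    close.\<close>
  have digit: "1 / 3 \<le> t x n \<longleftrightarrow> b n x" for x n
    using t_rec[of x n] t_nonneg[of x "Suc n"] t_le[of x "Suc n"] by (cases "b n x") auto
  define j where "j x = t x 0" for x
  have bm [measurable]: "Measurable.pred borel (b n)" for n unfolding b_def by measurable
  have jm: "j \<in> borel_measurable borel"
    unfolding j_def t_def by (intro borel_measurable_suminf) measurable
  \<comment> \<open>Multiplying by 3 and removing the leading digit shifts the expansion by one
    place; the recursion makes sense, and is measurable, for every real start value.\<close>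
  define r where "r y = rec_nat y (\<lambda>_ u. 3 * u - (if 1 / 3 \<le> u then 1 else 0 :: real))" for y
  have r0: "r y 0 = y" and rS: "r y (Suc n) = 3 * r y n - (if 1 / 3 \<le> r y n then 1 else 0)" for y n
    by (simp_all add: r_def)
  have rm [measurable]: "(\<lambda>y. r y n) \<in> borel_measurable borel" for n
    by (induction n) (simp_all add: r0 rS)
  have rj: "r (j x) n = t x n" for x n
  proof (induction n)
    case (Suc n)
    then show ?case using digit[of x n] t_rec[of x n] by (cases "b n x") (auto simp: rS)
  qed (simp add: r0 j_def)
  \<comment> \<open>\<open>z m\<close> returns the first dense point whose ball of radius
    \<open>(1 / 2) ^ m\<close> contains the coded point, so on a code the values converge to that
    point.\<close>
  define z where "z m y = d (LEAST k. 1 / 3 \<le> r y (prod_encode (m, k)))" for m y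
  have zm [measurable]: "z m \<in> borel_measurable borel" for m
    unfolding z_def
    by (rule measurable_compose[of _ _ "count_space UNIV"]) measurable
  \<comment> \<open>Off the range of \<open>j\<close> the points need not converge; replacing the
    sequence by a constant there gives a limit at every real, which is then measurable.\<close>
  define z' where "z' m y = (if Cauchy (\<lambda>m. z m y) then z m y else d 0)" for m y
  have z'm: "z' m \<in> borel_measurable borel" for m
    unfolding z'_def by (intro measurable_If zm measurable_const) (auto intro: sets_Collect_Cauchy)
  have conv: "(\<lambda>m. z' m y) \<longlonglongrightarrow> lim (\<lambda>m. z' m y)" for y
  proof -
    have "convergent (\<lambda>m. z' m y)"
      by (cases "Cauchy (\<lambda>m. z m y)") (auto simp: z'_def convergent_const intro: Cauchy_convergent)
    then show ?thesis by (simp add: convergent_LIMSEQ_iff)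
  qed
  have zj: "(\<lambda>m. z m (j x)) \<longlonglongrightarrow> x" for x
  proof -
    have "dist (z m (j x)) x \<le> (1 / 2) ^ m" for m
    proof -
      have "\<exists>k. 1 / 3 \<le> r (j x) (prod_encode (m, k))"
        using dense[of "(1 / 2) ^ m" x] unfolding rj digit b_def by simp
      then have "1 / 3 \<le> r (j x) (prod_encode (m, LEAST k. 1 / 3 \<le> r (j x) (prod_encode (m, k))))"
        by (rule LeastI_ex)
      then show ?thesis unfolding z_def rj digit unfolding b_def by (simp add: dist_commute)
    qed
    moreover have "(\<lambda>m. (1 / 2 :: real) ^ m) \<longlonglongrightarrow> 0" by (rule LIMSEQ_power_zero) simp
    ultimately show ?thesis
      by (subst tendsto_dist_iff) (rule tendsto_sandwich[OF always_eventually always_eventually tendsto_const], auto)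
  qed
  have "lim (\<lambda>m. z' m (j x)) = x" for x
    using zj[of x] LIMSEQ_imp_Cauchy[OF zj[of x]] by (simp add: z'_def limI)
  moreover have "(\<lambda>y. lim (\<lambda>m. z' m y)) \<in> borel_measurable borel"
    by (rule borel_measurable_LIMSEQ_metric[OF z'm conv])
  moreover have "j x \<in> {0..1}" for x using t_nonneg[of x 0] t_le[of x 0] by (simp add: j_def)
  ultimately show ?thesis using that jm by blast
qed

lemma ball_space_code:
  obtains j :: "'h::{real_inner, polish_space} \<Rightarrow> real" and g :: "real \<Rightarrow> 'h"
  where "j \<in> borel_measurable ball_space" "\<And>x. j x \<in> {0..1}" "g \<in> measurable borel ball_space"
    "\<And>x. x \<in> space ball_space \<Longrightarrow> g (j x) = x"
proof -
  obtain j :: "'h \<Rightarrow> real" and g :: "real \<Rightarrow> 'h"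
    where j: "j \<in> borel_measurable borel" "\<And>x. j x \<in> {0..1}"
      and g [measurable]: "g \<in> borel_measurable borel" and gj: "\<And>x. g (j x) = x"
    using polish_space_code by blast
  have "(\<lambda>y. if g y \<in> cball 0 1 then g y else 0) \<in> measurable borel ball_space"
    by (intro measurable_restrict_space2) auto
  then show ?thesis
    using that[of j "\<lambda>y. if g y \<in> cball 0 1 then g y else 0"] j gj
    by (auto simp: space_restrict_space measurable_restrict_space1)
qed


section \<open>The Dovbysh--Sudakov representation\<close>

text \<open>The covariance that remains after projecting off coordinate p. If
  \<open>K p p = 0\<close>, the quotient is 0 by convention and \<open>K\<close> is unchanged; for a
  positive semidefinite \<open>K\<close> this is right, since column p then vanishes by
  Cauchy--Schwarz.\<close>

definition schur_complement :: "('i \<Rightarrow> 'i \<Rightarrow> real) \<Rightarrow> 'i \<Rightarrow> 'i \<Rightarrow> 'i \<Rightarrow> real" where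
  "schur_complement K p i j = K i j - K i p * K j p / K p p"

lemma psd_sym: "positive_semidefinite_on UNIV K \<Longrightarrow> K i j = K j i"
  unfolding positive_semidefinite_on_def by auto

lemma psd_diag_nonneg:
  assumes "positive_semidefinite_on UNIV K"
  shows "0 \<le> K i i"
  using assms[unfolded positive_semidefinite_on_def, THEN conjunct2, rule_format, of "{i}" "\<lambda>_. 1"] by simp

lemma psd_Cauchy_Schwarz:
  assumes K: "positive_semidefinite_on UNIV K"
  shows "(K i j)\<^sup>2 \<le> K i i * K j j"
proof (cases "i = j")
  case False
  have two: "0 \<le> a\<^sup>2 * K i i + 2 * a * b * K i j + b\<^sup>2 * K j j" for a b
    by (rule psd_two_by_two[OF K UNIV_I UNIV_I False])
  show ?thesis
  proof (cases "K j j = 0")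
    case True
    have "K i j = 0"
    proof (rule ccontr)
      assume "K i j \<noteq> 0"
      \<comment> \<open>The witness makes the form equal to \<open>K i i - (K i i + 1)\<close>, that
        is, to -1.\<close>
      then show False
        using two[of 1 "- (K i i + 1) / (2 * K i j)"] True by (simp add: field_simps)
    qed
    then show ?thesis using True by simp
  next
    case False
    then have pos: "K j j > 0" using psd_diag_nonneg[OF K, of j] by simp
    \<comment> \<open>Up to scaling, the chosen pair minimises the form in b for fixed a; the
      scaling avoids a division.\<close>
    have "0 \<le> K j j * (K i i * K j j - (K i j)\<^sup>2)"
      using two[of "K j j" "- K i j"] by (simp add: power2_eq_square algebra_simps)
    then show ?thesis using pos by (simp add: zero_le_mult_iff)
  qed
qed (simp add: power2_eq_square)

text \<open>Lowering the coefficient at p by \<open>s = B / K p p\<close> minimises the quadratic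
  form of \<open>K\<close> in that coefficient, and the minimum is the form of the Schur complement.
  If p is missing from the finite set, it is adjoined with coefficient 0.\<close>

lemma schur_complement_psd:
  assumes K: "positive_semidefinite_on UNIV K"
  shows "positive_semidefinite_on UNIV (schur_complement K p)"
proof (cases "K p p = 0")
  case True
  then have "schur_complement K p = K" by (auto simp: schur_complement_def fun_eq_iff)
  then show ?thesis using K by simp
next
  case False
  have "0 \<le> (\<Sum>x\<in>F. \<Sum>y\<in>F. a x * a y * schur_complement K p x y)" if F: "finite F" for F a
  proof -
    define G where "G = insert p F"
    define A where "A x = (if x \<in> F then a x else 0)" for x
    define B where "B = (\<Sum>x\<in>G. A x * K x p)"
    define s where "s = B / K p p"
    have G: "finite G" "p \<in> G" using F by (auto simp: G_def)
    have "0 \<le> (\<Sum>x\<in>G. \<Sum>y\<in>G. (A x - (if x = p then s else 0)) * (A y - (if y = p then s else 0)) * K x y)"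
      using K[unfolded positive_semidefinite_on_def, THEN conjunct2, rule_format, of G "\<lambda>x. A x - (if x = p then s else 0)"] G
      by simp
    also have "\<dots> = (\<Sum>x\<in>G. \<Sum>y\<in>G. A x * A y * K x y - (if y = p then s * (A x * K x p) else 0)
        - (if x = p then s * (A y * K y p) else 0) + (if x = p then if y = p then s * s * K p p else 0 else 0))"
      using psd_sym[OF K] by (intro sum.cong refl) (auto simp: algebra_simps)
    also have "\<dots> = (\<Sum>x\<in>G. \<Sum>y\<in>G. A x * A y * K x y) - s * B - s * B + s * s * K p p"
    proof -
      have "(\<Sum>x\<in>G. \<Sum>y\<in>G. if x = p then f y else 0) = (\<Sum>y\<in>G. f y)" for f :: "'a \<Rightarrow> real"
        using G by (subst sum.swap) (simp add: sum.delta)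
      then show ?thesis
        using G by (simp add: sum.distrib sum_subtractf sum.delta B_def flip: sum_distrib_left)
    qed
    also have "\<dots> = (\<Sum>x\<in>G. \<Sum>y\<in>G. A x * A y * K x y) - B * B / K p p"
      using False by (simp add: s_def)
    also have "\<dots> = (\<Sum>x\<in>G. \<Sum>y\<in>G. A x * A y * schur_complement K p x y)"
      unfolding B_def sum_product sum_divide_distrib schur_complement_def
      by (simp add: sum_subtractf algebra_simps)
    also have "\<dots> = (\<Sum>x\<in>F. \<Sum>y\<in>F. a x * a y * schur_complement K p x y)"
    proof -
      have "(\<Sum>x\<in>G. A x * f x) = (\<Sum>x\<in>F. a x * f x)" for f
        using G unfolding A_def G_def by (intro sum.mono_neutral_cong_right) auto
      then show ?thesis
        by (simp only: mult.assoc flip: sum_distrib_left)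
    qed
    finally show ?thesis .
  qed
  then show ?thesis
    using psd_sym[OF K] by (auto simp: positive_semidefinite_on_def schur_complement_def mult.commute)
qed

text \<open>Gram--Schmidt carried out on covariances: after n steps the first n pivots have been
  projected off. Everything is computed from the entries of \<open>K\<close>, which makes
  measurability and equivariance under relabelling immediate.\<close>

primrec residual :: "('i \<Rightarrow> 'i \<Rightarrow> real) \<Rightarrow> (nat \<Rightarrow> 'i) \<Rightarrow> nat \<Rightarrow> 'i \<Rightarrow> 'i \<Rightarrow> real" where
  "residual K p 0 = K"
| "residual K p (Suc n) = schur_complement (residual K p n) (p n)"

text \<open>The coordinate of vector i along the m-th Gram--Schmidt direction. A pivot that depends
  on its predecessors has residual variance 0 and contributes coordinate 0.\<close>

definition residual_coord :: "('i \<Rightarrow> 'i \<Rightarrow> real) \<Rightarrow> (nat \<Rightarrow> 'i) \<Rightarrow> nat \<Rightarrow> 'i \<Rightarrow> real" where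
  "residual_coord K p m i = residual K p m i (p m) / sqrt (residual K p m (p m) (p m))"

lemma residual_psd:
  "positive_semidefinite_on UNIV K \<Longrightarrow> positive_semidefinite_on UNIV (residual K p n)"
  by (induction n) (auto intro: schur_complement_psd)

text \<open>This transports exchangeability first to the mean residual variances and later to the
  limit vectors.\<close>

lemma residual_equivariant:
  "residual (\<lambda>i j. K (\<sigma> i) (\<sigma> j)) p n i j = residual K (\<lambda>k. \<sigma> (p k)) n (\<sigma> i) (\<sigma> j)"
  by (induction n arbitrary: i j) (simp_all add: schur_complement_def)

lemma residual_cong:
  "(\<And>k. k < n \<Longrightarrow> p k = p' k) \<Longrightarrow> residual K p n = residual K p' n"
  by (induction n) auto

lemma residual_decomposition:
  assumes K: "positive_semidefinite_on UNIV K"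
  shows "K i j = residual K p n i j + (\<Sum>m<n. residual_coord K p m i * residual_coord K p m j)"
proof (induction n)
  case (Suc n)
  have "residual_coord K p n i * residual_coord K p n j =
      residual K p n i (p n) * residual K p n j (p n) / residual K p n (p n) (p n)"
    using psd_diag_nonneg[OF residual_psd[OF K, of p n]]
    by (simp add: residual_coord_def flip: real_sqrt_mult)
  then show ?case using Suc by (simp add: schur_complement_def)
qed simp

lemma overlap_psd: "q \<in> overlap_matrices \<Longrightarrow> positive_semidefinite_on UNIV q"
  by (simp add: overlap_matrices_def)

lemma residual_coord_square_le_1:
  assumes q: "q \<in> overlap_matrices"
  shows "(\<Sum>m<n. (residual_coord q p m i)\<^sup>2) \<le> 1"
  using residual_decomposition[OF overlap_psd[OF q], of i i p n]
    psd_diag_nonneg[OF residual_psd[OF overlap_psd[OF q]], of p n i] overlap_matrices_diag[OF q, of i]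
  by (simp add: power2_eq_square)

lemma residual_diag_le_1:
  assumes q: "q \<in> overlap_matrices"
  shows "residual q p n i i \<le> 1"
proof -
  have "0 \<le> (\<Sum>m<n. residual_coord q p m i * residual_coord q p m i)"
    by (intro sum_nonneg) simp
  then show ?thesis
    using residual_decomposition[OF overlap_psd[OF q], of i i p n] overlap_matrices_diag[OF q, of i] by simp
qed

lemma residual_abs_le_1:
  assumes q: "q \<in> overlap_matrices"
  shows "\<bar>residual q p n i j\<bar> \<le> 1"
proof -
  note psd = residual_psd[OF overlap_psd[OF q], of p n]
  have "(residual q p n i j)\<^sup>2 \<le> residual q p n i i * residual q p n j j"
    by (rule psd_Cauchy_Schwarz[OF psd])
  also have "\<dots> \<le> 1" using psd_diag_nonneg[OF psd] residual_diag_le_1[OF q] by (intro mult_le_one) auto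
  finally show ?thesis by (simp add: abs_square_le_1)
qed

lemma measurable_residual [measurable]:
  "(\<lambda>q. residual q p n i j) \<in> borel_measurable overlap_space"
  by (induction n arbitrary: i j) (auto simp: schur_complement_def)

lemma measurable_residual_coord [measurable]:
  "(\<lambda>q. residual_coord q p m i) \<in> borel_measurable overlap_space"
  unfolding residual_coord_def by measurable

section \<open>Residual variances under weak exchangeability\<close>

lemma rost_lawsD:
  assumes "P \<in> rost_laws"
  shows "P \<in> space (prob_algebra overlap_space)" "sets P = sets overlap_space" "prob_space P"
    "space P = overlap_matrices"
    "\<And>\<pi>. bij \<pi> \<Longrightarrow> finite {i. \<pi> i \<noteq> i} \<Longrightarrow> distr P overlap_space (\<lambda>q i j. q (\<pi> i) (\<pi> j)) = P"
proof -
  show P: "P \<in> space (prob_algebra overlap_space)" using assms by (simp add: rost_laws_def)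
  then show sets: "sets P = sets overlap_space" and "prob_space P" by (auto simp: space_prob_algebra)
  show "space P = overlap_matrices" using sets_eq_imp_space_eq[OF sets] by simp
qed (use assms in \<open>auto simp: rost_laws_def weakly_exchangeable_def\<close>)

lemma rost_integral_permute:
  fixes g :: "_ \<Rightarrow> real"
  assumes P: "P \<in> rost_laws" and \<pi>: "bij \<pi>" "finite {i. \<pi> i \<noteq> i}"
    and g: "g \<in> borel_measurable overlap_space"
  shows "(\<integral>q. g (\<lambda>i j. q (\<pi> i) (\<pi> j)) \<partial>P) = (\<integral>q. g q \<partial>P)"
proof -
  have m: "(\<lambda>q i j. q (\<pi> i) (\<pi> j)) \<in> measurable P overlap_space"
    using measurable_permute_overlap[OF bij_is_inj[OF \<pi>(1)]] measurable_cong_sets[OF rost_lawsD(2)[OF P] refl] by blast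
  have "(\<integral>q. g q \<partial>P) = (\<integral>q. g q \<partial>distr P overlap_space (\<lambda>q i j. q (\<pi> i) (\<pi> j)))"
    using rost_lawsD(5)[OF P \<pi>] by simp
  also have "\<dots> = (\<integral>q. g (\<lambda>i j. q (\<pi> i) (\<pi> j)) \<partial>P)" by (rule integral_distr[OF m g])
  finally show ?thesis by simp
qed

text \<open>The pivots followed by i, and the other pivots followed by i', are injective lists of
  equal length; hence a finite permutation takes one to the other.\<close>

lemma residual_expectation_eq:
  assumes P: "P \<in> rost_laws"
    and p: "inj_on p {..<n}" "i \<notin> p ` {..<n}" and p': "inj_on p' {..<n}" "i' \<notin> p' ` {..<n}"
  shows "(\<integral>q. residual q p n i i \<partial>P) = (\<integral>q. residual q p' n i' i' \<partial>P)"
proof -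
  define f where "f k = (if k = i then i' else p' (the_inv_into {..<n} p k))" for k
  have fp: "f (p k) = p' k" if "k < n" for k
    using that p by (auto simp: f_def the_inv_into_f_f)
  have "inj_on f (insert i (p ` {..<n}))"
  proof (rule inj_onI)
    fix x y assume xy: "x \<in> insert i (p ` {..<n})" "y \<in> insert i (p ` {..<n})" "f x = f y"
    have fi: "f i = i'" by (simp add: f_def)
    show "x = y"
      using xy p' fp fi by (auto simp: inj_on_def image_iff) (metis lessThan_iff)+
  qed
  then obtain \<pi> where \<pi>: "bij \<pi>" "finite {i. \<pi> i \<noteq> i}" "\<And>k. k \<in> insert i (p ` {..<n}) \<Longrightarrow> \<pi> k = f k"
    using finite_injection_extends[of "insert i (p ` {..<n})" f] by blast
  have "residual (\<lambda>i j. q (\<pi> i) (\<pi> j)) p n i i = residual q p' n i' i'" for q :: "nat \<Rightarrow> nat \<Rightarrow> real"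
  proof -
    have "residual q (\<lambda>k. \<pi> (p k)) n = residual q p' n"
      using \<pi>(3) fp by (intro residual_cong) auto
    moreover have "\<pi> i = i'" using \<pi>(3)[of i] by (simp add: f_def)
    ultimately show ?thesis by (simp add: residual_equivariant)
  qed
  then show ?thesis
    using rost_integral_permute[OF P \<pi>(1,2) measurable_residual[of p n i i]] by simp
qed

abbreviation odd_pivots :: "nat \<Rightarrow> nat" where "odd_pivots k \<equiv> 2 * k + 1"

lemma rost_bounded_integrable:
  fixes g :: "_ \<Rightarrow> real"
  assumes P: "P \<in> rost_laws" and g: "g \<in> borel_measurable overlap_space"
    and B: "\<And>q. q \<in> overlap_matrices \<Longrightarrow> \<bar>g q\<bar> \<le> B"
  shows "integrable P g"
proof -
  interpret prob_space P by (rule rost_lawsD(3)[OF P])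
  have "g \<in> borel_measurable P" using g measurable_cong_sets[OF rost_lawsD(2)[OF P] refl] by blast
  then show ?thesis
    using B by (intro integrable_const_bound[where B=B]) (auto simp: rost_lawsD(4)[OF P])
qed

text \<open>The residual variance of an entry given \<open>n\<close> pivots has, by exchangeability, a mean that
  depends only on \<open>n\<close>.  Using \<open>j\<close> as one more pivot therefore lowers it by \<open>d n - d (Suc n)\<close> on
  average, and this decrease dominates the square of the residual covariance.\<close>

lemma residual_covariance_vanishes:
  assumes P: "P \<in> rost_laws" and ij: "i \<noteq> j"
  shows "(\<lambda>n. \<integral>q. (residual q odd_pivots n (2 * i) (2 * j))\<^sup>2 \<partial>P) \<longlonglongrightarrow> 0"
proof -
  interpret prob_space P by (rule rost_lawsD(3)[OF P])
  define d where "d n = (\<integral>q. residual q odd_pivots n (2 * i) (2 * i) \<partial>P)" for n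
  have int: "integrable P (\<lambda>q. residual q p n k l)" for p n k l
    by (intro rost_bounded_integrable[OF P, where B=1] residual_abs_le_1) measurable
  have le: "(\<integral>q. (residual q odd_pivots n (2 * i) (2 * j))\<^sup>2 \<partial>P) \<le> d n - d (Suc n)" for n
  proof -
    \<comment> \<open>These pivots are odd below n and use \<open>2 * j\<close> as the next one, so
      that the last elimination divides by the residual variance of \<open>2 * j\<close>.\<close>
    define p where "p = (\<lambda>k. if k = n then 2 * j else odd_pivots k)"
    have dS: "d (Suc n) = (\<integral>q. residual q p (Suc n) (2 * i) (2 * i) \<partial>P)"
      unfolding d_def using ij
      by (intro residual_expectation_eq[OF P]) (auto simp: p_def inj_on_def, presburger+)
    have "d n - d (Suc n) = (\<integral>q. residual q odd_pivots n (2 * i) (2 * i) - residual q p (Suc n) (2 * i) (2 * i) \<partial>P)"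
      unfolding dS unfolding d_def by (intro Bochner_Integration.integral_diff[symmetric] int)
    moreover have "(\<integral>q. (residual q odd_pivots n (2 * i) (2 * j))\<^sup>2 \<partial>P) \<le>
        (\<integral>q. residual q odd_pivots n (2 * i) (2 * i) - residual q p (Suc n) (2 * i) (2 * i) \<partial>P)"
    proof (intro integral_mono Bochner_Integration.integrable_diff int)
      show "integrable P (\<lambda>q. (residual q odd_pivots n (2 * i) (2 * j))\<^sup>2)"
        by (intro rost_bounded_integrable[OF P, where B=1]) (auto simp: abs_square_le_1 residual_abs_le_1)
      fix q assume "q \<in> space P"
      then have q: "q \<in> overlap_matrices" using rost_lawsD(4)[OF P] by simp
      define K where "K = residual q odd_pivots n"
      have "residual q p n = K" unfolding K_def by (intro residual_cong) (simp add: p_def)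
      then have "residual q p (Suc n) (2 * i) (2 * i) = K (2 * i) (2 * i) - (K (2 * i) (2 * j))\<^sup>2 / K (2 * j) (2 * j)"
        by (simp add: schur_complement_def p_def power2_eq_square)
      \<comment> \<open>Dividing by a positive variance that is at most 1 can only enlarge. If the
        variance is 0, so is the quotient, but then Cauchy--Schwarz makes the covariance 0 as
        well.\<close>
      moreover have "(K (2 * i) (2 * j))\<^sup>2 \<le> (K (2 * i) (2 * j))\<^sup>2 / K (2 * j) (2 * j)"
      proof (cases "K (2 * j) (2 * j) = 0")
        case True
        have "(K (2 * i) (2 * j))\<^sup>2 \<le> K (2 * i) (2 * i) * K (2 * j) (2 * j)"
          unfolding K_def by (intro psd_Cauchy_Schwarz residual_psd overlap_psd q)
        then show ?thesis using True by simp
      next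
        case False
        have "0 \<le> K (2 * j) (2 * j)" "K (2 * j) (2 * j) \<le> 1"
          unfolding K_def by (intro psd_diag_nonneg residual_psd overlap_psd q residual_diag_le_1)+
        then show ?thesis using False
          by (simp add: le_divide_eq mult_left_le)
      qed
      ultimately show "(residual q odd_pivots n (2 * i) (2 * j))\<^sup>2 \<le>
          residual q odd_pivots n (2 * i) (2 * i) - residual q p (Suc n) (2 * i) (2 * i)"
        by (simp add: K_def)
    qed
    ultimately show ?thesis by simp
  qed
  have "0 \<le> (\<integral>q. (residual q odd_pivots n (2 * i) (2 * j))\<^sup>2 \<partial>P)" for n by simp
  then have "decseq d" using le by (intro decseq_SucI) (smt (verit))
  moreover have "0 \<le> d n" for n
    unfolding d_def using rost_lawsD(4)[OF P]
    by (intro integral_nonneg_AE AE_I2 psd_diag_nonneg residual_psd overlap_psd) simp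
  ultimately obtain L where L: "d \<longlonglongrightarrow> L" by (metis decseq_convergent)
  have lim: "(\<lambda>n. d n - d (Suc n)) \<longlonglongrightarrow> 0"
    using tendsto_diff[OF L LIMSEQ_Suc[OF L]] by simp
  show ?thesis
  proof (rule tendsto_sandwich[where f="\<lambda>_. 0" and h="\<lambda>n. d n - d (Suc n)"])
    show "\<forall>\<^sub>F n in sequentially. 0 \<le> (\<integral>q. (residual q odd_pivots n (2 * i) (2 * j))\<^sup>2 \<partial>P)"
      by (rule always_eventually) simp
    show "\<forall>\<^sub>F n in sequentially. (\<integral>q. (residual q odd_pivots n (2 * i) (2 * j))\<^sup>2 \<partial>P) \<le> d n - d (Suc n)"
      by (rule always_eventually) (rule allI, rule le)
  qed (use lim in auto)
qed

section \<open>Vectors built from residual coordinates\<close>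

lemma orthonormal_sequence:
  assumes inf: "\<not> (\<exists>F::'h::real_inner set. finite F \<and> span F = UNIV)"
  obtains e :: "nat \<Rightarrow> 'h::real_inner" where "\<And>i j. e i \<bullet> e j = (if i = j then 1 else 0)"
proof -
  have "\<exists>f::nat \<Rightarrow> 'h. \<forall>n. norm (f n) = 1 \<and> (\<forall>m<n. f m \<bullet> f n = 0)"
  proof (rule dependent_wellorder_choice)
    fix n :: nat and f :: "nat \<Rightarrow> 'h"
    assume f: "\<And>y. y < n \<Longrightarrow> norm (f y) = 1 \<and> (\<forall>m<y. f m \<bullet> f y = 0)"
    have on: "f m \<bullet> f k = (if m = k then 1 else 0)" if "m < n" "k < n" for m k
      using f[of m] f[of k] that
      by (cases m k rule: linorder_cases) (auto simp: inner_commute norm_eq_1)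
    obtain v where v: "v \<notin> span (f ` {..<n})" using inf by (metis UNIV_I finite_imageI finite_lessThan subsetI top.extremum_uniqueI)
    define w where "w = v - (\<Sum>k<n. (f k \<bullet> v) *\<^sub>R f k)"
    have "(\<Sum>k<n. (f k \<bullet> v) *\<^sub>R f k) \<in> span (f ` {..<n})"
      by (intro span_sum span_scale span_base) auto
    then have "w \<noteq> 0" using v by (auto simp: w_def)
    moreover have "f m \<bullet> w = 0" if m: "m < n" for m
    proof -
      have "f m \<bullet> (\<Sum>k<n. (f k \<bullet> v) *\<^sub>R f k) = (\<Sum>k<n. if m = k then f k \<bullet> v else 0)"
        unfolding inner_sum_right by (intro sum.cong refl) (auto simp: on m)
      then show ?thesis using m by (simp add: w_def inner_diff_right)
    qed
    ultimately show "\<exists>r. norm r = 1 \<and> (\<forall>m<n. f m \<bullet> r = 0)"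
      by (intro exI[of _ "w /\<^sub>R norm w"]) auto
  qed auto
  then obtain f :: "nat \<Rightarrow> 'h" where f: "\<And>n. norm (f n) = 1" "\<And>m n. m < n \<Longrightarrow> f m \<bullet> f n = 0" by blast
  have "f n \<bullet> f m = 0" if "m < n" for m n using f(2)[OF that] by (simp add: inner_commute)
  then have "f i \<bullet> f j = (if i = j then 1 else 0)" for i j
    using f by (cases i j rule: linorder_cases) (auto simp: norm_eq_1)
  then show ?thesis using that by blast
qed


lemma orthonormal_sum_inner:
  fixes e :: "nat \<Rightarrow> 'h::real_inner"
  assumes e: "\<And>i j. e i \<bullet> e j = (if i = j then 1 else 0)" and "finite I"
  shows "(\<Sum>m\<in>I. a m *\<^sub>R e m) \<bullet> (\<Sum>m\<in>I. b m *\<^sub>R e m) = (\<Sum>m\<in>I. a m * b m)"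
  using assms(2)
  by (simp add: inner_sum_left inner_sum_right e if_distrib sum.delta mult.commute cong: if_cong)

text \<open>Residual variances are nonnegative, so the squared coordinates sum to at most 1 and the
  series converges by completeness. One orthonormal system serves all matrices, which makes the
  limit vectors measurable in \<open>q\<close>. The residuals converge to what the projections leave
  unexplained.\<close>

lemma residual_vectors:
  fixes e :: "nat \<Rightarrow> 'h::{real_inner, polish_space}"
  assumes e: "\<And>i j. e i \<bullet> e j = (if i = j then 1 else 0)"
  obtains x :: "(nat \<Rightarrow> nat \<Rightarrow> real) \<Rightarrow> nat \<Rightarrow> 'h"
  where "\<And>q i. q \<in> overlap_matrices \<Longrightarrow> (\<lambda>n. \<Sum>m<n. residual_coord q p m i *\<^sub>R e m) \<longlonglongrightarrow> x q i"
    "\<And>q i. q \<in> overlap_matrices \<Longrightarrow> x q i \<in> cball 0 1"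
    "\<And>i. (\<lambda>q. x q i) \<in> measurable overlap_space ball_space"
    "\<And>q i j. q \<in> overlap_matrices \<Longrightarrow> (\<lambda>n. residual q p n i j) \<longlonglongrightarrow> q i j - x q i \<bullet> x q j"
proof -
  define s where "s q i n = (\<Sum>m<n. residual_coord q p m i *\<^sub>R e m)" for q i n
  define x where "x q i = lim (s q i)" for q i
  have inner: "s q i n \<bullet> s q j n = (\<Sum>m<n. residual_coord q p m i * residual_coord q p m j)" for q i j n
    unfolding s_def by (rule orthonormal_sum_inner[OF e]) simp
  have lim: "s q i \<longlonglongrightarrow> x q i" if q: "q \<in> overlap_matrices" for q i
  proof -
    define S where "S n = (\<Sum>m<n. (residual_coord q p m i)\<^sup>2)" for n
    have "summable (\<lambda>m. (residual_coord q p m i)\<^sup>2)"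
      by (rule summableI_nonneg_bounded[where x=1]) (auto intro: residual_coord_square_le_1[OF q])
    then have "Cauchy S"
      unfolding S_def by (intro convergent_Cauchy) (simp add: summable_iff_convergent)
    have diff: "(norm (s q i n - s q i m))\<^sup>2 = S n - S m" if "m \<le> n" for m n
    proof -
      have split: "{..<n} - {..<m} = {m..<n}" "{..<m} \<subseteq> {..<n}" using that by auto
      have "s q i n - s q i m = (\<Sum>k\<in>{m..<n}. residual_coord q p k i *\<^sub>R e k)"
        unfolding s_def using sum_diff[of "{..<n}" "{..<m}" "\<lambda>k. residual_coord q p k i *\<^sub>R e k"] split by simp
      then have "(norm (s q i n - s q i m))\<^sup>2 = (\<Sum>k\<in>{m..<n}. residual_coord q p k i * residual_coord q p k i)"
        by (simp add: power2_norm_eq_inner orthonormal_sum_inner[OF e])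
      also have "\<dots> = S n - S m"
        unfolding S_def using sum_diff[of "{..<n}" "{..<m}" "\<lambda>k. residual_coord q p k i * residual_coord q p k i"] split
        by (simp add: power2_eq_square)
      finally show ?thesis .
    qed
    have "Cauchy (s q i)"
    proof (rule metric_CauchyI)
      fix r :: real assume r: "r > 0"
      then obtain M where M: "\<And>m n. m \<ge> M \<Longrightarrow> n \<ge> M \<Longrightarrow> dist (S m) (S n) < r\<^sup>2"
        using metric_CauchyD[OF \<open>Cauchy S\<close>, of "r\<^sup>2"] by auto
      have "dist (s q i n) (s q i m) < r" if "m \<ge> M" "n \<ge> M" "m \<le> n" for m n
      proof -
        have "(norm (s q i n - s q i m))\<^sup>2 < r\<^sup>2"
          using diff[OF that(3)] M[OF that(2,1)] by (simp add: dist_real_def)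
        then show ?thesis using r by (simp add: dist_norm power2_less_imp_less)
      qed
      then show "\<exists>M. \<forall>m\<ge>M. \<forall>n\<ge>M. dist (s q i m) (s q i n) < r"
        by (metis dist_commute nle_le)
    qed
    then have "convergent (s q i)" by (rule Cauchy_convergent)
    then show ?thesis by (simp add: x_def convergent_LIMSEQ_iff)
  qed
  have ball: "x q i \<in> cball 0 1" if q: "q \<in> overlap_matrices" for q i
  proof -
    have "norm (s q i n) \<le> 1" for n
      using inner[of q i n i] residual_coord_square_le_1[OF q, of p i n]
      by (simp add: norm_eq_sqrt_inner power2_eq_square)
    then have "norm (x q i) \<le> 1"
      by (intro LIMSEQ_le_const2[OF tendsto_norm[OF lim[OF q]]]) auto
    then show ?thesis by simp
  qed
  have "(\<lambda>q. x q i) \<in> measurable overlap_space ball_space" for i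
  proof (rule measurable_restrict_space2)
    show "(\<lambda>q. x q i) \<in> borel_measurable overlap_space"
    proof (rule borel_measurable_LIMSEQ_metric)
      show "(\<lambda>q. s q i n) \<in> borel_measurable overlap_space" for n
        unfolding s_def by measurable
      show "(\<lambda>n. s q i n) \<longlonglongrightarrow> x q i" if "q \<in> space overlap_space" for q
        using that lim by simp
    qed
  qed (use ball in auto)
  moreover have "(\<lambda>n. residual q p n i j) \<longlonglongrightarrow> q i j - x q i \<bullet> x q j" if q: "q \<in> overlap_matrices" for q i j
  proof -
    have "residual q p n i j = q i j - s q i n \<bullet> s q j n" for n
      using residual_decomposition[OF overlap_psd[OF q], of i j p n] inner[of q i n j] by simp
    then show ?thesis by (simp only: tendsto_diff tendsto_const tendsto_inner lim[OF q])
  qed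
  moreover have "(\<lambda>n. \<Sum>m<n. residual_coord q p m i *\<^sub>R e m) \<longlonglongrightarrow> x q i" if "q \<in> overlap_matrices" for q i
    using lim[OF that, of i] by (simp add: s_def[abs_def])
  ultimately show ?thesis using that[of x] ball by blast
qed

text \<open>This is the Dovbysh--Sudakov theorem.\<close>

theorem sampling_measure_exists:
  assumes inf: "\<not> (\<exists>F::'h::{real_inner, polish_space} set. finite F \<and> span F = UNIV)"
    and P: "P \<in> rost_laws"
  obtains M :: "'h::{real_inner, polish_space} measure measure" where "is_sampling_measure M P"
proof -
  note sets = rost_lawsD(2)[OF P] and space = rost_lawsD(4)[OF P]
  interpret prob_space P by (rule rost_lawsD(3)[OF P])
  obtain e :: "nat \<Rightarrow> 'h" where e: "\<And>i j. e i \<bullet> e j = (if i = j then 1 else 0)"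
    using orthonormal_sequence[OF inf] by blast
  obtain x :: "(nat \<Rightarrow> nat \<Rightarrow> real) \<Rightarrow> nat \<Rightarrow> 'h"
    where x: "\<And>q i. q \<in> overlap_matrices \<Longrightarrow> (\<lambda>n. \<Sum>m<n. residual_coord q odd_pivots m i *\<^sub>R e m) \<longlonglongrightarrow> x q i"
      and x_ball: "\<And>q i. q \<in> overlap_matrices \<Longrightarrow> x q i \<in> cball 0 1"
      and x_meas: "\<And>i. (\<lambda>q. x q i) \<in> measurable overlap_space ball_space"
      and x_res: "\<And>q i j. q \<in> overlap_matrices \<Longrightarrow> (\<lambda>n. residual q odd_pivots n i j) \<longlonglongrightarrow> q i j - x q i \<bullet> x q j"
    using residual_vectors[OF e, of odd_pivots] by blast
  have [measurable]: "(\<lambda>q. x q i) \<in> borel_measurable overlap_space" for i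
    using x_meas[of i] by (rule measurable_restrict_space2_iff[THEN iffD1, THEN conjunct1])
  \<comment> \<open>\<open>L\<close> is the limit of the residual covariances, which are bounded by
    1. Their second moments tend to 0, so \<open>L\<close> vanishes almost surely.\<close>
  have orth: "AE q in P. x q (2 * i) \<bullet> x q (2 * j) = q (2 * i) (2 * j)" if ij: "i \<noteq> j" for i j
  proof -
    define L where "L q = q (2 * i) (2 * j) - x q (2 * i) \<bullet> x q (2 * j)" for q
    have Lm: "L \<in> borel_measurable overlap_space" unfolding L_def by measurable
    then have Lm': "(\<lambda>q. (L q)\<^sup>2) \<in> borel_measurable P"
      using measurable_cong_sets[OF sets refl] by (metis borel_measurable_power)
    have L1: "\<bar>L q\<bar> \<le> 1" if "q \<in> overlap_matrices" for q
      using residual_abs_le_1[OF that] x_res[OF that, of "2 * i" "2 * j"]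
      by (intro LIMSEQ_le_const2[OF tendsto_rabs]) (auto simp: L_def)
    have "(\<lambda>n. \<integral>q. (residual q odd_pivots n (2 * i) (2 * j))\<^sup>2 \<partial>P) \<longlonglongrightarrow> (\<integral>q. (L q)\<^sup>2 \<partial>P)"
    proof (rule integral_dominated_convergence[where w="\<lambda>_. 1", OF Lm'])
      show "(\<lambda>q. (residual q odd_pivots n (2 * i) (2 * j))\<^sup>2) \<in> borel_measurable P" for n
        using measurable_residual measurable_cong_sets[OF sets refl] by (metis borel_measurable_power)
      show "AE q in P. (\<lambda>n. (residual q odd_pivots n (2 * i) (2 * j))\<^sup>2) \<longlonglongrightarrow> (L q)\<^sup>2"
        unfolding L_def by (intro AE_I2 tendsto_power x_res) (simp add: space)
      show "AE q in P. norm ((residual q odd_pivots n (2 * i) (2 * j))\<^sup>2) \<le> 1" for n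
        by (intro AE_I2) (simp add: space abs_square_le_1 residual_abs_le_1)
    qed simp
    then have "(\<integral>q. (L q)\<^sup>2 \<partial>P) = 0"
      using residual_covariance_vanishes[OF P ij] LIMSEQ_unique by blast
    moreover have "integrable P (\<lambda>q. (L q)\<^sup>2)"
      using Lm L1 by (intro rost_bounded_integrable[OF P, where B=1]) (auto simp: abs_square_le_1)
    ultimately have "AE q in P. (L q)\<^sup>2 = 0"
      by (subst (asm) integral_nonneg_eq_0_iff_AE) auto
    then show ?thesis by eventually_elim (simp add: L_def)
  qed
  \<comment> \<open>A permutation that fixes the odd indices leaves all pivots in place and merely
    relabels the even-indexed limit vectors.\<close>
  have x_perm: "x (\<lambda>i j. q (\<sigma> i) (\<sigma> j)) (2 * i) = x q (2 * \<pi> i)"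
    if q: "q \<in> overlap_matrices" "(\<lambda>i j. q (\<sigma> i) (\<sigma> j)) \<in> overlap_matrices"
      and \<sigma>: "\<And>k. \<sigma> (2 * k + 1) = 2 * k + 1" "\<And>k. \<sigma> (2 * k) = 2 * \<pi> k" for q \<sigma> \<pi> i
  proof -
    have "residual_coord (\<lambda>i j. q (\<sigma> i) (\<sigma> j)) odd_pivots m (2 * i) = residual_coord q odd_pivots m (2 * \<pi> i)" for m
      unfolding residual_coord_def residual_equivariant \<sigma> ..
    then show ?thesis
      using x[OF q(1), of "2 * \<pi> i"] x[OF q(2), of "2 * i"] LIMSEQ_unique by simp
  qed
  interpret X: exchangeable_sequence P "ball_space :: 'h measure" "\<lambda>i q. x q (2 * i)"
  proof unfold_locales
    show "(\<lambda>q. x q (2 * i)) \<in> measurable P ball_space" for i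
      using x_meas measurable_cong_sets[OF sets refl] by blast
    fix J :: "nat set" and f :: "nat \<Rightarrow> nat" and A :: "nat \<Rightarrow> 'h set"
    assume J: "finite J" "inj_on f J" and A: "\<And>i. i \<in> J \<Longrightarrow> A i \<in> sets ball_space"
    obtain \<pi> where \<pi>: "bij \<pi>" "finite {i. \<pi> i \<noteq> i}" "\<And>i. i \<in> J \<Longrightarrow> \<pi> i = f i"
      using finite_injection_extends[OF J] by blast
    define \<sigma> where "\<sigma> k = (if even k then 2 * \<pi> (k div 2) else k)" for k
    have \<sigma>': "\<sigma> (2 * k + 1) = 2 * k + 1" "\<sigma> (2 * k) = 2 * \<pi> k" for k by (auto simp: \<sigma>_def)
    have "inj \<sigma>"
    proof (rule injI)
      fix a b assume ab: "\<sigma> a = \<sigma> b"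
      have "even (\<sigma> k) = even k" for k by (simp add: \<sigma>_def)
      then have "even a = even b" using ab by metis
      then show "a = b"
        using ab \<pi>(1) unfolding \<sigma>_def bij_def by (cases "even a") (auto simp: inj_eq elim!: evenE)
    qed
    moreover have "surj \<sigma>"
    proof (rule surjI)
      fix k show "\<sigma> (if even k then 2 * inv \<pi> (k div 2) else k) = k"
        using \<pi>(1) by (simp add: \<sigma>_def bij_def surj_f_inv_f)
    qed
    ultimately have \<sigma>: "bij \<sigma>" by (simp add: bij_def)
    have fin: "finite {i. \<sigma> i \<noteq> i}"
    proof (rule finite_subset[OF _ finite_imageI[OF \<pi>(2), of "\<lambda>k. 2 * k"]])
      show "{i. \<sigma> i \<noteq> i} \<subseteq> (\<lambda>k. 2 * k) ` {i. \<pi> i \<noteq> i}"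
        by (auto simp: \<sigma>_def split: if_splits elim!: evenE)
    qed
    have perm: "(\<lambda>q i j. q (\<sigma> i) (\<sigma> j)) \<in> measurable overlap_space overlap_space"
      using \<sigma> by (intro measurable_permute_overlap) (simp add: bij_def)
    have perm_P: "(\<lambda>q i j. q (\<sigma> i) (\<sigma> j)) \<in> measurable P overlap_space"
      using perm measurable_cong_sets[OF sets refl] by blast
    define E where "E = {q \<in> overlap_matrices. \<forall>i\<in>J. x q (2 * i) \<in> A i}"
    have E: "E \<in> sets overlap_space"
    proof -
      have "{q \<in> space overlap_space. x q (2 * i) \<in> A i} \<in> sets overlap_space" if "i \<in> J" for i
        using measurable_sets[OF x_meas A[OF that], of "2 * i"] by (simp add: vimage_def Int_def conj_commute)
      then have "{q \<in> space overlap_space. \<forall>i\<in>J. x q (2 * i) \<in> A i} \<in> sets overlap_space"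
        using J by (intro sets.sets_Collect_finite_All)
      then show ?thesis by (simp add: E_def)
    qed
    have "{q \<in> space P. \<forall>i\<in>J. x q (2 * f i) \<in> A i} = (\<lambda>q i j. q (\<sigma> i) (\<sigma> j)) -` E \<inter> space P"
      using measurable_space[OF perm] x_perm[OF _ _ \<sigma>'] \<pi>(3) by (auto simp: E_def space)
    then have "prob {q \<in> space P. \<forall>i\<in>J. x q (2 * f i) \<in> A i} =
        measure (distr P overlap_space (\<lambda>q i j. q (\<sigma> i) (\<sigma> j))) E"
      by (simp add: measure_distr[OF perm_P E])
    also have "\<dots> = prob E" using rost_lawsD(5)[OF P \<sigma> fin] by simp
    also have "E = {q \<in> space P. \<forall>i\<in>J. x q (2 * i) \<in> A i}" by (simp add: E_def space)
    finally show "prob {q \<in> space P. \<forall>i\<in>J. x q (2 * f i) \<in> A i} = prob {q \<in> space P. \<forall>i\<in>J. x q (2 * i) \<in> A i}" .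
  qed
  obtain j :: "'h \<Rightarrow> real" and g :: "real \<Rightarrow> 'h"
    where jg: "j \<in> borel_measurable ball_space" "\<And>x. j x \<in> {0..1}" "g \<in> measurable borel ball_space"
      "\<And>x. x \<in> space ball_space \<Longrightarrow> g (j x) = x"
    using ball_space_code by blast
  obtain \<kappa> where \<kappa>: "\<kappa> \<in> measurable P (prob_algebra (ball_space :: 'h measure))"
    and law: "distr P (PiM UNIV (\<lambda>_. ball_space)) (\<lambda>q i. x q (2 * i)) = P \<bind> (\<lambda>q. PiM UNIV (\<lambda>_::nat. \<kappa> q))"
    using X.de_finetti[OF jg(1) jg(2) jg(3) jg(4)] by blast
  define M where "M = distr P (prob_algebra ball_space) \<kappa>"
  have M: "M \<in> space (prob_algebra (prob_algebra ball_space))"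
    unfolding M_def using \<kappa> by (simp add: space_prob_algebra prob_space_distr)
  have ne: "space P \<noteq> {}" by (rule not_empty)
  have kernel: "(\<lambda>q. PiM UNIV (\<lambda>_::nat. \<kappa> q)) \<in> measurable P (subprob_algebra (PiM UNIV (\<lambda>_. ball_space)))"
    by (intro measurable_prob_algebraD measurable_compose[OF \<kappa> measurable_PiM_kernel])
  have X_meas: "(\<lambda>q i. x q (2 * i)) \<in> measurable P (PiM UNIV (\<lambda>_. ball_space))"
    using measurable_space[OF X.measurable_Y] by (intro measurable_PiM_single') (auto intro: X.measurable_Y)
  have even_meas: "(\<lambda>q i j. q (2 * i) (2 * j)) \<in> measurable overlap_space overlap_space"
    by (intro measurable_permute_overlap) (simp add: inj_def)
  have even_meas_P: "(\<lambda>q i j. q (2 * i) (2 * j)) \<in> measurable P overlap_space"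
    using even_meas measurable_cong_sets[OF sets refl] by blast
  have "rost_of M = P \<bind> (\<lambda>q. sampled_law (\<kappa> q))"
    unfolding rost_of_def M_def
    by (rule bind_distr[OF \<kappa> measurable_prob_algebraD[OF measurable_sampled_law] ne])
  also have "\<dots> = distr (P \<bind> (\<lambda>q. PiM UNIV (\<lambda>_::nat. \<kappa> q))) overlap_space sampled_matrix"
    unfolding sampled_law_def by (rule distr_bind[OF kernel ne measurable_sampled_matrix, symmetric])
  also have "\<dots> = distr P overlap_space (\<lambda>q. sampled_matrix (\<lambda>i. x q (2 * i)))"
    unfolding law[symmetric] by (subst distr_distr[OF measurable_sampled_matrix X_meas]) (simp add: comp_def)
  \<comment> \<open>Only the inner products of distinct vectors have to match: the projections may
    be shorter than 1, but \<open>sampled_matrix\<close> puts 1 on the diagonal.\<close>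
  also have "\<dots> = distr P overlap_space (\<lambda>q i j. q (2 * i) (2 * j))"
  proof (rule distr_cong_AE[OF refl refl])
    have "AE q in P. \<forall>i j. i \<noteq> j \<longrightarrow> x q (2 * i) \<bullet> x q (2 * j) = q (2 * i) (2 * j)"
      using orth by (simp add: AE_all_countable)
    then show "AE q in P. sampled_matrix (\<lambda>i. x q (2 * i)) = (\<lambda>i j. q (2 * i) (2 * j))"
      using AE_space
    proof eventually_elim
      case (elim q)
      then show ?case by (auto simp: sampled_matrix_def fun_eq_iff space overlap_matrices_diag)
    qed
    show "(\<lambda>q i j. q (2 * i) (2 * j)) \<in> measurable P overlap_space" by (rule even_meas_P)
    show "(\<lambda>q. sampled_matrix (\<lambda>i. x q (2 * i))) \<in> measurable P overlap_space"
      by (rule measurable_compose[OF X_meas measurable_sampled_matrix])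
  qed
  \<comment> \<open>The map i to 2i is no finite permutation. A cylinder function, however, sees
    finitely many indices, on which the map agrees with one.\<close>
  also have "\<dots> = P"
  proof (rule overlap_law_eqI[OF _ rost_lawsD(1)[OF P]])
    show "distr P overlap_space (\<lambda>q i j. q (2 * i) (2 * j)) \<in> space (prob_algebra overlap_space)"
      using prob_space_distr[OF even_meas_P] by (simp add: space_prob_algebra)
    fix f n assume f: "cylinder_function f n"
    note fm = continuous_borel_measurable_overlap[OF cylinder_functionD(1)[OF f]]
    obtain \<pi> where \<pi>: "bij \<pi>" "finite {i. \<pi> i \<noteq> i}" "\<And>i. i \<in> {..<n} \<Longrightarrow> \<pi> i = 2 * i"
      using finite_injection_extends[of "{..<n}" "\<lambda>i. 2 * i"] by (auto simp: inj_on_def)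
    have "(\<integral>q. f q \<partial>distr P overlap_space (\<lambda>q i j. q (2 * i) (2 * j))) = (\<integral>q. f (\<lambda>i j. q (2 * i) (2 * j)) \<partial>P)"
      by (rule integral_distr[OF even_meas_P fm])
    also have "\<dots> = (\<integral>q. f (\<lambda>i j. q (\<pi> i) (\<pi> j)) \<partial>P)"
    proof (intro Bochner_Integration.integral_cong refl cylinder_functionD(2)[OF f])
      fix q assume "q \<in> space P"
      then have q: "q \<in> space overlap_space" by (simp add: space)
      show "(\<lambda>i j. q (2 * i) (2 * j)) \<in> overlap_matrices" using measurable_space[OF even_meas q] by simp
      show "(\<lambda>i j. q (\<pi> i) (\<pi> j)) \<in> overlap_matrices"
        using measurable_space[OF measurable_permute_overlap[OF bij_is_inj[OF \<pi>(1)]] q] by simp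
    qed (simp add: \<pi>(3))
    also have "\<dots> = (\<integral>q. f q \<partial>P)" by (rule rost_integral_permute[OF P \<pi>(1,2) fm])
    finally show "(\<integral>q. f q \<partial>distr P overlap_space (\<lambda>q i j. q (2 * i) (2 * j))) = (\<integral>q. f q \<partial>P)" .
  qed
  finally show ?thesis using that M by (simp add: is_sampling_measure_def)
qed


section \<open>Approximation by trigonometric polynomials\<close>

text \<open>Pairs of a coefficient and an arbitrary real frequency, repetitions allowed. In the
  complex form products and Gaussian means of the terms are explicit.\<close>

fun trig_sum :: "(complex \<times> real) list \<Rightarrow> real \<Rightarrow> complex" where
  "trig_sum [] x = 0"
| "trig_sum ((k, a) # xs) x = k * cis (a * x) + trig_sum xs x"

definition trig_polynomial :: "(real \<Rightarrow> real) \<Rightarrow> bool" where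
  "trig_polynomial f \<longleftrightarrow> (\<exists>xs. \<forall>x. complex_of_real (f x) = trig_sum xs x)"

lemma trig_sum_append: "trig_sum (xs @ ys) x = trig_sum xs x + trig_sum ys x"
  by (induction xs) auto

lemma trig_sum_shift:
  "trig_sum (map (\<lambda>(l, b). (k * l, a + b)) xs) x = k * cis (a * x) * trig_sum xs x"
  by (induction xs) (auto simp: algebra_simps simp flip: cis_mult)

lemma trig_sum_mult: "\<exists>zs. \<forall>x. trig_sum zs x = trig_sum xs x * trig_sum ys x"
proof (induction xs)
  case Nil
  show ?case by (intro exI[of _ "[]"]) simp
next
  case (Cons p xs)
  obtain k a where p: "p = (k, a)" by force
  obtain zs where "\<forall>x. trig_sum zs x = trig_sum xs x * trig_sum ys x" using Cons by blast
  then show ?case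
    by (intro exI[of _ "map (\<lambda>(l, b). (k * l, a + b)) ys @ zs"])
      (simp add: p trig_sum_append trig_sum_shift distrib_right)
qed

lemma trig_polynomial_add: "trig_polynomial f \<Longrightarrow> trig_polynomial g \<Longrightarrow> trig_polynomial (\<lambda>x. f x + g x)"
  unfolding trig_polynomial_def by (metis of_real_add trig_sum_append)

lemma trig_polynomial_mult: "trig_polynomial f \<Longrightarrow> trig_polynomial g \<Longrightarrow> trig_polynomial (\<lambda>x. f x * g x)"
  unfolding trig_polynomial_def by (metis of_real_mult trig_sum_mult)

lemma trig_polynomial_const: "trig_polynomial (\<lambda>x. m)"
  unfolding trig_polynomial_def by (intro exI[of _ "[(of_real m, 0)]"]) simp

lemma trig_polynomial_cos: "trig_polynomial (\<lambda>x. cos (w * x))"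
  unfolding trig_polynomial_def
  by (intro exI[of _ "[(1 / 2, w), (1 / 2, - w)]"]) (auto simp: complex_eq_iff)

lemma trig_polynomial_sin: "trig_polynomial (\<lambda>x. sin (w * x))"
  unfolding trig_polynomial_def
  by (intro exI[of _ "[(- \<i> / 2, w), (\<i> / 2, - w)]"]) (auto simp: complex_eq_iff)

text \<open>A real-linear function of \<open>cis\<close> is a combination of cosine and sine, and
  polynomials are generated from such functions by sums and products.\<close>

lemma trig_polynomial_comp_cis:
  assumes "real_polynomial_function (p :: complex \<Rightarrow> real)"
  shows "trig_polynomial (\<lambda>x. p (cis (w * x)))"
  using assms
proof (induction rule: real_polynomial_function.induct)
  case (linear f)
  interpret bounded_linear f by fact
  have "f (cis (w * x)) = cos (w * x) * f 1 + sin (w * x) * f \<i>" for x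
  proof -
    have "cis (w * x) = cos (w * x) *\<^sub>R 1 + sin (w * x) *\<^sub>R \<i>" by (simp add: complex_eq_iff)
    then show ?thesis by (simp only: add scale) simp
  qed
  then show ?case
    by (simp add: trig_polynomial_add trig_polynomial_mult trig_polynomial_const trig_polynomial_cos trig_polynomial_sin)
qed (auto intro: trig_polynomial_add trig_polynomial_mult trig_polynomial_const)

text \<open>The interval is wrapped onto the right half of the unit circle; the left half carries the
  common value at the end points.\<close>

lemma trig_polynomial_approximation:
  fixes \<Phi> :: "real \<Rightarrow> real"
  assumes R: "R > 0" and cont: "continuous_on {-R..R} \<Phi>" and ends: "\<Phi> (-R) = \<Phi> R" and e: "e > 0"
  obtains T where "trig_polynomial T" "\<And>x. \<bar>x\<bar> \<le> R \<Longrightarrow> \<bar>\<Phi> x - T x\<bar> < e"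
    "\<And>x. \<exists>y. \<bar>y\<bar> \<le> R \<and> \<bar>\<Phi> y - T x\<bar> < e"
proof -
  \<comment> \<open>\<open>w\<close> scales the interval to [-pi/2, pi/2]. On the right half circle
    \<open>u\<close> inverts the map from x to \<open>cis (w * x)\<close>, whose imaginary part is a
    sine.\<close>
  define w where "w = pi / (2 * R)"
  define u where "u z = arcsin (Im z) / w" for z
  define F where "F z = (if Re z \<le> 0 then \<Phi> R else \<Phi> (u z))" for z
  have w: "w > 0" "w * R = pi / 2" using R by (auto simp: w_def)
  have Im: "- 1 \<le> Im z" "Im z \<le> 1" if "z \<in> sphere 0 1" for z
    using abs_Im_le_cmod[of z] that by auto
  have u: "\<bar>u z\<bar> \<le> R" if "z \<in> sphere 0 1" for z
  proof -
    have "\<bar>arcsin (Im z)\<bar> \<le> pi / 2" using arcsin_bounded[OF Im[OF that]] by auto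
    then have "\<bar>arcsin (Im z)\<bar> \<le> R * w" using w by (simp add: mult.commute)
    then show ?thesis using w by (simp add: u_def abs_divide pos_divide_le_eq)
  qed
  have "continuous_on (sphere 0 1) F"
    unfolding F_def
  proof (rule continuous_on_cases_le)
    show "continuous_on {z \<in> sphere 0 1. 0 \<le> Re z} (\<lambda>z. \<Phi> (u z))"
    proof (rule continuous_on_compose2[OF cont])
      show "continuous_on {z \<in> sphere 0 1. 0 \<le> Re z} u"
        unfolding u_def using w Im
        by (intro continuous_intros continuous_on_arcsin') auto
      show "u ` {z \<in> sphere 0 1. 0 \<le> Re z} \<subseteq> {-R..R}"
        using u by (force simp: abs_le_iff)
    qed
    fix z :: complex assume z: "z \<in> sphere 0 1" "Re z = 0"
    then have "Im z = 1 \<or> Im z = -1"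
      by (metis abs_eq_iff' abs_one cmod_eq_Im dist_0_norm mem_sphere)
    then have "u z = R \<or> u z = -R"
      using w by (auto simp: u_def field_simps)
    then show "\<Phi> R = \<Phi> (u z)" using ends by auto
  qed (auto intro: continuous_intros)
  then obtain p where p: "real_polynomial_function p" "\<And>z. z \<in> sphere 0 1 \<Longrightarrow> \<bar>F z - p z\<bar> < e"
    using Stone_Weierstrass_real_polynomial_function[of "sphere 0 1" F e] e by auto
  define T where "T x = p (cis (w * x))" for x
  have "trig_polynomial T" unfolding T_def by (rule trig_polynomial_comp_cis[OF p(1)])
  moreover have FT: "\<bar>F (cis (w * x)) - T x\<bar> < e" for x unfolding T_def by (rule p(2)) simp
  moreover have "F (cis (w * x)) = \<Phi> x" if x: "\<bar>x\<bar> \<le> R" for x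
  proof -
    have bd: "\<bar>w * x\<bar> \<le> pi / 2" using w x by (simp add: abs_mult flip: w(2))
    then have cos: "cos (w * x) \<ge> 0" by (intro cos_ge_zero) auto
    have as: "arcsin (sin (w * x)) = w * x" using bd by (intro arcsin_sin) auto
    show ?thesis
    proof (cases "cos (w * x) = 0")
      case False
      then show ?thesis using cos w as by (simp add: F_def u_def)
    next
      case True
      then have "sin (w * x) = 1 \<or> sin (w * x) = - 1"
        using sin_cos_squared_add[of "w * x"] by (simp add: power2_eq_1_iff)
      then have "w * x = pi / 2 \<or> w * x = - (pi / 2)" using as by auto
      then have "w * x = w * R \<or> w * x = w * (- R)" using w(2) by (metis mult_minus_right)
      then have "x = R \<or> x = - R" using w(1) by (metis less_irrefl mult_cancel_left)
      then show ?thesis using True ends by (auto simp: F_def)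
    qed
  qed
  \<comment> \<open>Every value of \<open>F\<close> is a value of \<open>\<Phi>\<close> on the
    interval, so bounds for \<open>\<Phi>\<close> there pass to \<open>T\<close> on the whole line,
    up to e.\<close>
  moreover have "\<exists>y. \<bar>y\<bar> \<le> R \<and> F (cis (w * x)) = \<Phi> y" for x
    using u[of "cis (w * x)"] R by (auto simp: F_def intro: exI[of _ R])
  ultimately show ?thesis using that by metis
qed

section \<open>Approximation of exponentials in L1 of the Gaussian law\<close>

abbreviation gauss :: "real measure" where "gauss \<equiv> std_normal_distribution"

text \<open>Completing the square turns the weighted density into a constant times the normal
  density with mean t.\<close>

lemma integrable_gauss_exp: "integrable gauss (\<lambda>x. exp (t * x))"
proof -
  have "std_normal_density x * exp (t * x) = exp (t\<^sup>2 / 2) * normal_density t 1 x" for x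
  proof -
    have "exp (- x\<^sup>2 / 2) * exp (t * x) = exp (t\<^sup>2 / 2) * exp (- (x - t)\<^sup>2 / 2)"
      by (simp add: power2_eq_square field_simps flip: exp_add)
    then show ?thesis by (simp add: normal_density_def)
  qed
  then show ?thesis
    by (subst integrable_density) auto
qed

lemma integrable_gauss_exp_abs:
  assumes "L \<ge> 0"
  shows "integrable gauss (\<lambda>x. exp (a + L * \<bar>x\<bar>))"
proof (rule Bochner_Integration.integrable_bound)
  show "integrable gauss (\<lambda>x. exp a * (exp (L * x) + exp ((- L) * x)))"
    by (intro integrable_mult_right Bochner_Integration.integrable_add integrable_gauss_exp)
  have "exp (a + L * \<bar>x\<bar>) \<le> exp a * (exp (L * x) + exp ((- L) * x))" for x
  proof -
    have "exp (L * \<bar>x\<bar>) \<le> exp (L * x) + exp ((- L) * x)"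
      by (cases "x \<ge> 0") (simp_all add: add_increasing add_increasing2)
    then show ?thesis by (simp add: exp_add mult_left_mono del: minus_mult_left)
  qed
  then show "AE x in gauss. norm (exp (a + L * \<bar>x\<bar>)) \<le> norm (exp a * (exp (L * x) + exp ((- L) * x)))"
    by (intro AE_I2) (simp add: abs_of_pos add_pos_pos)
qed auto

lemma trig_polynomial_measurable:
  assumes "trig_polynomial T"
  shows "T \<in> borel_measurable borel"
proof -
  obtain xs where xs: "\<And>x. complex_of_real (T x) = trig_sum xs x" using assms by (auto simp: trig_polynomial_def)
  have "continuous_on UNIV (trig_sum xs)"
  proof (induction xs)
    case (Cons p xs)
    then show ?case by (cases p) (auto intro!: continuous_intros)
  qed auto
  then have "continuous_on UNIV (\<lambda>x. Re (complex_of_real (T x)))"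
    unfolding xs by (intro continuous_intros)
  then show ?thesis by (intro borel_measurable_continuous_onI) simp
qed

text \<open>The exponent is cut off outside a large interval before the periodic approximation. In
  the tails the error is at most \<open>2 * h x\<close> plus a constant, and the Gaussian tail
  integral of \<open>h\<close> is small. The lower bound on \<open>T\<close> later keeps the
  approximate normalisation away from 0.\<close>

lemma trig_approximation_of_exp:
  fixes \<psi> :: "real \<Rightarrow> real"
  assumes cont: "continuous_on UNIV \<psi>" and bound: "\<And>x. \<bar>\<psi> x\<bar> \<le> a + L * \<bar>x\<bar>" and L: "L \<ge> 0" and e: "e > 0"
  obtains T \<delta> B where "trig_polynomial T" "0 < \<delta>" "\<And>x. \<delta> \<le> T x" "\<And>x. T x \<le> B"
    "(\<integral>x. \<bar>exp (\<psi> x) - T x\<bar> \<partial>gauss) \<le> e"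
proof -
  interpret G: prob_space gauss by (rule prob_space_normal_density) simp
  define h where "h x = exp (a + L * \<bar>x\<bar>)" for x
  have h_int: "integrable gauss h" unfolding h_def by (rule integrable_gauss_exp_abs[OF L])
  have h_pos: "h x > 0" for x by (simp add: h_def)
  have h_mono: "h x \<le> h y" if "\<bar>x\<bar> \<le> \<bar>y\<bar>" for x y
    using that L by (simp add: h_def mult_left_mono)
  have [measurable]: "\<psi> \<in> borel_measurable borel" using cont by (rule borel_measurable_continuous_onI)
  have [measurable]: "h \<in> borel_measurable borel" unfolding h_def by measurable
  have "(\<lambda>n. \<integral>x. indicator {x. \<bar>x\<bar> > real n} x * (2 * h x) \<partial>gauss) \<longlonglongrightarrow> (\<integral>x. 0 \<partial>gauss)"
  proof (rule integral_dominated_convergence[where w="\<lambda>x. 2 * h x"])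
    show "AE x in gauss. (\<lambda>n. indicator {x. \<bar>x\<bar> > real n} x * (2 * h x)) \<longlonglongrightarrow> 0"
    proof (rule AE_I2)
      fix x :: real
      obtain n0 where n0: "\<bar>x\<bar> \<le> real n0" using real_arch_simple by blast
      have "eventually (\<lambda>n. indicator {x. \<bar>x\<bar> > real n} x * (2 * h x) = 0) sequentially"
        using n0 by (intro eventually_sequentiallyI[of n0]) (auto simp: indicator_def)
      then show "(\<lambda>n. indicator {x. \<bar>x\<bar> > real n} x * (2 * h x)) \<longlonglongrightarrow> 0" by (rule tendsto_eventually)
    qed
    show "AE x in gauss. norm (indicator {x. \<bar>x\<bar> > real n} x * (2 * h x)) \<le> 2 * h x" for n
      using h_pos by (intro AE_I2) (auto simp: indicator_def less_imp_le)
  qed (use h_int in auto)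
  then have "eventually (\<lambda>n. (\<integral>x. indicator {x. \<bar>x\<bar> > real n} x * (2 * h x) \<partial>gauss) < e / 2) sequentially"
    using e by (intro order_tendstoD(2)) auto
  then obtain n where n: "(\<integral>x. indicator {x. \<bar>x\<bar> > real n} x * (2 * h x) \<partial>gauss) < e / 2"
    by (auto simp: eventually_sequentially)
  define R where "R = real n + 1"
  \<comment> \<open>The cut-off factor is 1 for |x| <= n and 0 for |x| = R. Thus
    \<open>\<Phi>\<close> is 1 at both end points, as the wrapping onto the circle requires.\<close>
  define \<Phi> where "\<Phi> x = exp (max 0 (min 1 (R - \<bar>x\<bar>)) * \<psi> x)" for x
  have exp_le_h: "exp \<bar>\<psi> x\<bar> \<le> h x" for x using bound[of x] by (simp add: h_def)
  have \<Phi>_le: "\<Phi> x \<le> h x" and \<Phi>_ge: "1 / h x \<le> \<Phi> x" for x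
  proof -
    have "\<bar>max 0 (min 1 (R - \<bar>x\<bar>)) * \<psi> x\<bar> \<le> 1 * \<bar>\<psi> x\<bar>"
      unfolding abs_mult by (intro mult_right_mono) auto
    then have b: "\<bar>max 0 (min 1 (R - \<bar>x\<bar>)) * \<psi> x\<bar> \<le> a + L * \<bar>x\<bar>" using bound[of x] by simp
    then show "\<Phi> x \<le> h x" by (simp add: \<Phi>_def h_def)
    have "1 / h x = exp (- (a + L * \<bar>x\<bar>))" by (simp only: h_def exp_minus inverse_eq_divide)
    also have "\<dots> \<le> \<Phi> x" using b by (simp add: \<Phi>_def)
    finally show "1 / h x \<le> \<Phi> x" .
  qed
  define m where "m = 1 / h R"
  \<comment> \<open>\<open>m\<close> bounds \<open>\<Phi>\<close> from below on [-R, R], so an error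
    of at most \<open>m / 2\<close> keeps \<open>T\<close> above \<open>m / 2\<close>.\<close>
  define e' where "e' = min (e / 2) (m / 2)"
  have m: "m > 0" using h_pos by (simp add: m_def)
  have e': "e' > 0" "e' \<le> e / 2" "e' \<le> m / 2" using e m by (auto simp: e'_def)
  have R: "R > 0" by (simp add: R_def)
  have "continuous_on {-R..R} \<Phi>"
    unfolding \<Phi>_def by (intro continuous_intros continuous_on_subset[OF cont]) auto
  then obtain T where T: "trig_polynomial T" "\<And>x. \<bar>x\<bar> \<le> R \<Longrightarrow> \<bar>\<Phi> x - T x\<bar> < e'"
      "\<And>x. \<exists>y. \<bar>y\<bar> \<le> R \<and> \<bar>\<Phi> y - T x\<bar> < e'"
    using trig_polynomial_approximation[OF R _ _ e'(1), of \<Phi>] R by (auto simp: \<Phi>_def)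
  have T_ge: "m / 2 \<le> T x" and T_le: "T x \<le> h R + e'" for x
  proof -
    obtain y where y: "\<bar>y\<bar> \<le> R" "\<bar>\<Phi> y - T x\<bar> < e'" using T(3) by blast
    have "h y \<le> h R" using y R by (intro h_mono) simp
    then have "m \<le> 1 / h y" unfolding m_def using h_pos by (intro divide_left_mono) (auto simp: mult_pos_pos)
    then show "m / 2 \<le> T x" using y(2) \<Phi>_ge[of y] e' by linarith
    show "T x \<le> h R + e'" using y(2) \<Phi>_le[of y] \<open>h y \<le> h R\<close> by linarith
  qed
  have Tm: "T \<in> borel_measurable borel" by (rule trig_polynomial_measurable[OF T(1)])
  note [measurable] = Tm
  have pw: "\<bar>exp (\<psi> x) - T x\<bar> \<le> e' + indicator {x. \<bar>x\<bar> > real n} x * (2 * h x)" for x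
  proof (cases "\<bar>x\<bar> > real n")
    case False
    then have "\<Phi> x = exp (\<psi> x)" by (simp add: \<Phi>_def R_def)
    then show ?thesis using T(2)[of x] False by (simp add: R_def)
  next
    case True
    have "T x \<le> h x + e'"
    proof (cases "\<bar>x\<bar> \<le> R")
      case True
      then show ?thesis using T(2)[of x] \<Phi>_le[of x] by linarith
    next
      case False
      then have "h R \<le> h x" using R by (intro h_mono) simp
      then show ?thesis using T_le[of x] by linarith
    qed
    moreover have "exp (\<psi> x) \<le> h x" using exp_le_h[of x] by (meson abs_ge_self exp_le_cancel_iff order_trans)
    moreover have "0 < T x" using T_ge[of x] m by linarith
    ultimately have "\<bar>exp (\<psi> x) - T x\<bar> \<le> e' + 2 * h x"
      using exp_gt_zero[of "\<psi> x"] h_pos[of x] e'(1) by linarith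
    then show ?thesis using True by simp
  qed
  have int3: "integrable gauss (\<lambda>x. indicator {x. \<bar>x\<bar> > real n} x * (2 * h x))"
  proof (rule Bochner_Integration.integrable_bound)
    show "integrable gauss (\<lambda>x. 2 * h x)" using h_int by simp
    show "AE x in gauss. norm (indicator {x. \<bar>x\<bar> > real n} x * (2 * h x)) \<le> norm (2 * h x)"
      using h_pos by (intro AE_I2) (auto simp: indicator_def less_imp_le)
  qed auto
  then have int2: "integrable gauss (\<lambda>x. e' + indicator {x. \<bar>x\<bar> > real n} x * (2 * h x))"
    by simp
  have "(\<integral>x. \<bar>exp (\<psi> x) - T x\<bar> \<partial>gauss) \<le> (\<integral>x. e' + indicator {x. \<bar>x\<bar> > real n} x * (2 * h x) \<partial>gauss)"
  proof (rule integral_mono[OF _ int2 pw])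
    show "integrable gauss (\<lambda>x. \<bar>exp (\<psi> x) - T x\<bar>)"
      by (rule Bochner_Integration.integrable_bound[OF int2]) (use pw in \<open>auto intro!: AE_I2 order_trans[OF pw abs_ge_self]\<close>)
  qed
  also have "\<dots> = e' + (\<integral>x. indicator {x. \<bar>x\<bar> > real n} x * (2 * h x) \<partial>gauss)"
    using int3 G.prob_space by simp
  also have "\<dots> \<le> e" using n e' by linarith
  finally show ?thesis using that[OF T(1), of "m / 2" "h R + e'"] m T_ge T_le by auto
qed


section \<open>Gaussian moments of the cavity field\<close>

lemma prob_space_gauss: "prob_space gauss"
  by (rule prob_space_normal_density) simp

lemma trig_sum_eq_sum: "trig_sum xs x = (\<Sum>m<length xs. fst (xs ! m) * cis (snd (xs ! m) * x))"
  by (induction xs x rule: trig_sum.induct) (simp_all add: sum.lessThan_Suc_shift del: sum.lessThan_Suc)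

lemma cis_prod: "(\<Prod>i\<in>I. cis (f i)) = cis (\<Sum>i\<in>I. f i)"
  by (induction I rule: infinite_finite_induct) (simp_all add: cis_mult)

lemma integrable_cis:
  assumes "finite_measure M" "f \<in> borel_measurable M"
  shows "integrable M (\<lambda>x. cis (f x))"
proof -
  interpret finite_measure M by fact
  have "(\<lambda>x. cis (f x)) \<in> borel_measurable M"
    using assms(2) unfolding cis_conv_exp by measurable
  then show ?thesis by (intro integrable_const_bound[where B=1]) auto
qed

lemma integral_gauss_cis: "(\<integral>z. cis (t * z) \<partial>gauss) = complex_of_real (exp (- t\<^sup>2 / 2))"
  using fun_cong[OF char_std_normal_distribution, of t] by (simp add: char_def cis_conv_exp)

text \<open>The hypotheses in the form in which the estimates use them: linear growth of
  \<open>\<psi>\<close> gives Gaussian integrability of its exponentials, and \<open>c_le_1\<close>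
  makes \<open>1 - c ((norm v)\<^sup>2)\<close> a genuine variance.\<close>

locale cavity_setting = prob_space N
  for N :: "'w measure" and \<psi> c :: "real \<Rightarrow> real"
    and l :: "'w \<Rightarrow> 'h::{real_inner, polish_space} \<Rightarrow> real" and a L :: real +
  assumes psi_cont: "continuous_on UNIV \<psi>"
    and psi_bound: "\<And>x. \<bar>\<psi> x\<bar> \<le> a + L * \<bar>x\<bar>" and L_nonneg: "L \<ge> 0"
    and c_cont: "continuous_on {-1..1} c" and c_one: "c 1 = 1"
    and c_le_1: "\<And>s. 0 \<le> s \<Longrightarrow> s \<le> 1 \<Longrightarrow> c s \<le> 1"
    and field_measurable: "(\<lambda>(\<omega>, v). l \<omega> v) \<in> borel_measurable (N \<Otimes>\<^sub>M ball_space)"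
    and field_gaussian: "centered_gaussian_process N (cball 0 1) l"
    and field_covariance: "\<And>v v'. v \<in> cball 0 1 \<Longrightarrow> v' \<in> cball 0 1 \<Longrightarrow> (\<integral>\<omega>. l \<omega> v * l \<omega> v' \<partial>N) = c (v \<bullet> v')"
begin

lemma space_ball: "space (ball_space :: 'h measure) = cball 0 1"
  by (simp add: space_restrict_space)

lemma field_component: "v \<in> cball 0 1 \<Longrightarrow> (\<lambda>\<omega>. l \<omega> v) \<in> borel_measurable N"
  using measurable_Pair1[OF field_measurable, of v] unfolding space_ball by simp

text \<open>\<open>centered_gaussian_process\<close> speaks of finite sets of points, while sampled
  points may coincide; coefficients of equal points are added up first.\<close>

lemma field_combination:
  assumes I: "finite I" and v: "\<And>i. i \<in> I \<Longrightarrow> v i \<in> cball 0 1"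
  obtains \<sigma> where "distr N borel (\<lambda>\<omega>. \<Sum>i\<in>I. \<alpha> i * l \<omega> (v i)) = distr gauss borel (\<lambda>z. \<sigma> * z)"
proof -
  define b where "b u = (\<Sum>i\<in>{i \<in> I. v i = u}. \<alpha> i)" for u
  have "(\<Sum>u\<in>v ` I. b u * l \<omega> u) = (\<Sum>i\<in>I. \<alpha> i * l \<omega> (v i))" for \<omega>
  proof -
    have "(\<Sum>i\<in>I. \<alpha> i * l \<omega> (v i)) = (\<Sum>u\<in>v ` I. \<Sum>i\<in>{i \<in> I. v i = u}. \<alpha> i * l \<omega> (v i))"
      by (rule sum.image_gen[OF I])
    also have "\<dots> = (\<Sum>u\<in>v ` I. b u * l \<omega> u)"
      by (intro sum.cong refl) (simp add: b_def sum_distrib_right)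
    finally show ?thesis by simp
  qed
  moreover have "\<exists>\<sigma>. distr N borel (\<lambda>\<omega>. \<Sum>u\<in>v ` I. b u * l \<omega> u) = distr gauss borel (\<lambda>z. \<sigma> * z)"
  proof -
    have "finite (v ` I) \<and> v ` I \<subseteq> cball 0 1" using I v by blast
    then show ?thesis
      using field_gaussian[unfolded centered_gaussian_process_def, THEN conjunct2, rule_format, of "v ` I" b] by simp
  qed
  ultimately show ?thesis using that by auto
qed

text \<open>Integrability must come from the Gaussian law. The covariance identity does not provide
  it, because a nonintegrable function has Bochner integral 0.\<close>

lemma field_square_integrable:
  assumes v: "v \<in> cball 0 1"
  shows "integrable N (\<lambda>\<omega>. (l \<omega> v)\<^sup>2)"
proof -
  obtain \<sigma> where \<sigma>: "distr N borel (\<lambda>\<omega>. \<Sum>i\<in>{0::nat}. 1 * l \<omega> v) = distr gauss borel (\<lambda>z. \<sigma> * z)"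
    by (rule field_combination[of "{0::nat}" "\<lambda>_. v" "\<lambda>_. 1"]) (use v in auto)
  have "integrable gauss (\<lambda>z. (\<sigma> * z)\<^sup>2)"
    using std_normal_distribution_even_moments(2)[of 1] by (simp add: power_mult_distrib)
  then have "integrable (distr gauss borel (\<lambda>z. \<sigma> * z)) (\<lambda>y. y\<^sup>2)"
    by (subst integrable_distr_eq) auto
  then have "integrable (distr N borel (\<lambda>\<omega>. l \<omega> v)) (\<lambda>y. y\<^sup>2)" using \<sigma> by simp
  then show ?thesis
    using field_component[OF v] by (subst (asm) integrable_distr_eq) auto
qed

lemma field_product_integrable:
  assumes v: "v \<in> cball 0 1" "v' \<in> cball 0 1"
  shows "integrable N (\<lambda>\<omega>. l \<omega> v * l \<omega> v')"
proof (rule Bochner_Integration.integrable_bound)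
  show "integrable N (\<lambda>\<omega>. (l \<omega> v)\<^sup>2 + (l \<omega> v')\<^sup>2)"
    using v by (intro Bochner_Integration.integrable_add field_square_integrable)
  show "(\<lambda>\<omega>. l \<omega> v * l \<omega> v') \<in> borel_measurable N"
    using v by (intro borel_measurable_times field_component)
  have "\<bar>x * y\<bar> \<le> x\<^sup>2 + y\<^sup>2" for x y :: real
    using sum_squares_bound[of x y] sum_squares_bound[of x "- y"] zero_le_power2[of x] zero_le_power2[of y]
    by (auto simp: abs_le_iff)
  then show "AE \<omega> in N. norm (l \<omega> v * l \<omega> v') \<le> norm ((l \<omega> v)\<^sup>2 + (l \<omega> v')\<^sup>2)"
    by (intro AE_I2) (metis abs_ge_self order_trans real_norm_def)
qed

text \<open>The standard deviation in the Gaussian law is only known to exist; comparing second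
  moments identifies its square with the covariance form.\<close>

lemma expectation_cis:
  assumes I: "finite I" and v: "\<And>i. i \<in> I \<Longrightarrow> v i \<in> cball 0 1"
  shows "(\<integral>\<omega>. cis (\<Sum>i\<in>I. \<alpha> i * l \<omega> (v i)) \<partial>N) =
    complex_of_real (exp (- (\<Sum>i\<in>I. \<Sum>j\<in>I. \<alpha> i * \<alpha> j * c (v i \<bullet> v j)) / 2))"
proof -
  define X where "X \<omega> = (\<Sum>i\<in>I. \<alpha> i * l \<omega> (v i))" for \<omega>
  have X: "X \<in> borel_measurable N"
    unfolding X_def using v by (intro borel_measurable_sum borel_measurable_times borel_measurable_const field_component)
  obtain \<sigma> where \<sigma>: "distr N borel X = distr gauss borel (\<lambda>z. \<sigma> * z)"
    unfolding X_def using field_combination[OF I, of v \<alpha>] v by blast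
  have "\<sigma>\<^sup>2 = (\<integral>z. (\<sigma> * z)\<^sup>2 \<partial>gauss)"
    using std_normal_distribution_even_moments[of 1] by (simp add: power_mult_distrib)
  also have "\<dots> = (\<integral>y. y\<^sup>2 \<partial>distr gauss borel (\<lambda>z. \<sigma> * z))"
    by (subst integral_distr) auto
  also have "\<dots> = (\<integral>\<omega>. (X \<omega>)\<^sup>2 \<partial>N)"
    unfolding \<sigma>[symmetric] using X by (subst integral_distr) auto
  also have "\<dots> = (\<integral>\<omega>. (\<Sum>i\<in>I. \<Sum>j\<in>I. (\<alpha> i * \<alpha> j) * (l \<omega> (v i) * l \<omega> (v j))) \<partial>N)"
    unfolding X_def power2_eq_square sum_product by (simp add: mult_ac)
  also have "\<dots> = (\<Sum>i\<in>I. \<Sum>j\<in>I. \<integral>\<omega>. (\<alpha> i * \<alpha> j) * (l \<omega> (v i) * l \<omega> (v j)) \<partial>N)"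
    by (subst Bochner_Integration.integral_sum, intro Bochner_Integration.integrable_sum integrable_mult_right field_product_integrable v,
      assumption, assumption, intro sum.cong refl Bochner_Integration.integral_sum integrable_mult_right field_product_integrable v)
  also have "\<dots> = (\<Sum>i\<in>I. \<Sum>j\<in>I. \<alpha> i * \<alpha> j * c (v i \<bullet> v j))"
    using v by (intro sum.cong refl) (simp add: field_covariance)
  finally have \<sigma>2: "\<sigma>\<^sup>2 = (\<Sum>i\<in>I. \<Sum>j\<in>I. \<alpha> i * \<alpha> j * c (v i \<bullet> v j))" .
  have cm: "cis \<in> borel_measurable borel"
    by (intro borel_measurable_continuous_onI continuous_intros)
  have "(\<integral>\<omega>. cis (X \<omega>) \<partial>N) = (\<integral>y. cis y \<partial>distr N borel X)"
    using X cm by (subst integral_distr) auto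
  also have "\<dots> = (\<integral>z. cis (\<sigma> * z) \<partial>gauss)"
    unfolding \<sigma> using cm by (subst integral_distr) auto
  also have "\<dots> = complex_of_real (exp (- \<sigma>\<^sup>2 / 2))" by (rule integral_gauss_cis)
  finally show ?thesis unfolding \<sigma>2 X_def .
qed

section \<open>The field with its compensating noise\<close>

definition residual_sd :: "'h \<Rightarrow> real" where "residual_sd v = sqrt (1 - c ((norm v)\<^sup>2))"

lemma residual_sd_square:
  assumes "v \<in> cball 0 1"
  shows "(residual_sd v)\<^sup>2 = 1 - c (v \<bullet> v)"
proof -
  have "norm v \<le> 1" using assms by simp
  then have "(norm v)\<^sup>2 \<le> 1" by (simp add: abs_square_le_1)
  then have "c ((norm v)\<^sup>2) \<le> 1" by (intro c_le_1) auto
  then show ?thesis by (simp add: residual_sd_def power2_norm_eq_inner)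
qed

lemma residual_sd_measurable [measurable]: "residual_sd \<in> borel_measurable ball_space"
proof -
  have n: "continuous_on (cball 0 1) (\<lambda>v::'h. (norm v)\<^sup>2)" by (intro continuous_intros)
  have "continuous_on (cball 0 1) (\<lambda>v::'h. c ((norm v)\<^sup>2))"
  proof (rule continuous_on_compose2[OF c_cont n], rule subsetI)
    fix s assume "s \<in> (\<lambda>v::'h. (norm v)\<^sup>2) ` cball 0 1"
    then have "0 \<le> s" "s \<le> 1" by (auto simp: power_le_one)
    then show "s \<in> {-1..1}" by simp
  qed
  then have "continuous_on (cball 0 1) (\<lambda>v::'h. sqrt (1 - c ((norm v)\<^sup>2)))"
    by (intro continuous_on_real_sqrt continuous_on_diff continuous_on_const)
  then show ?thesis unfolding residual_sd_def[abs_def] by (rule borel_measurable_continuous_on_restrict)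
qed

abbreviation noisy :: "'w \<Rightarrow> 'h \<Rightarrow> real \<Rightarrow> real" where
  "noisy \<omega> v z \<equiv> l \<omega> v + z * residual_sd v"

lemma noisy_measurable [measurable]:
  "(\<lambda>((\<omega>, v), z). noisy \<omega> v z) \<in> borel_measurable ((N \<Otimes>\<^sub>M ball_space) \<Otimes>\<^sub>M gauss)"
proof -
  have [measurable]: "(\<lambda>x. l (fst x) (snd x)) \<in> borel_measurable (N \<Otimes>\<^sub>M ball_space)"
    using field_measurable by (simp add: case_prod_beta)
  show ?thesis unfolding case_prod_beta by measurable
qed

lemma noisy_measurable_at:
  assumes v: "v \<in> cball 0 1"
  shows "(\<lambda>(\<omega>, z). noisy \<omega> v z) \<in> borel_measurable (N \<Otimes>\<^sub>M gauss)"
proof -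
  note [measurable] = field_component[OF v]
  show ?thesis by measurable
qed

text \<open>Field and noise are independent with variances \<open>c (v \<bullet> v)\<close> and
  \<open>1 - c (v \<bullet> v)\<close>, so the product of their characteristic functions is the
  standard one.\<close>

lemma noisy_law:
  assumes v: "v \<in> cball 0 1"
  shows "distr (N \<Otimes>\<^sub>M gauss) borel (\<lambda>(\<omega>, z). noisy \<omega> v z) = gauss"
proof (rule Levy_uniqueness)
  interpret G: prob_space gauss by (rule prob_space_gauss)
  interpret P: pair_prob_space N gauss ..
  note m = noisy_measurable_at[OF v]
  show "real_distribution (distr (N \<Otimes>\<^sub>M gauss) borel (\<lambda>(\<omega>, z). noisy \<omega> v z))"
    using P.real_distribution_distr[OF m] .
  show "real_distribution gauss" by (rule real_dist_normal_dist)
  show "char (distr (N \<Otimes>\<^sub>M gauss) borel (\<lambda>(\<omega>, z). noisy \<omega> v z)) = char gauss"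
  proof
    fix t
    have cm: "cis \<in> borel_measurable borel"
      by (intro borel_measurable_continuous_onI continuous_intros)
    have ctm: "(\<lambda>y. cis (t * y)) \<in> borel_measurable borel"
      by (intro borel_measurable_continuous_onI continuous_intros)
    have "char (distr (N \<Otimes>\<^sub>M gauss) borel (\<lambda>(\<omega>, z). noisy \<omega> v z)) t =
        (\<integral>x. cis (t * (case x of (\<omega>, z) \<Rightarrow> noisy \<omega> v z)) \<partial>(N \<Otimes>\<^sub>M gauss))"
      unfolding char_def cis_conv_exp[symmetric] by (rule integral_distr[OF m ctm])
    also have "\<dots> = (\<integral>(\<omega>, z). cis (t * l \<omega> v) * cis (t * residual_sd v * z) \<partial>(N \<Otimes>\<^sub>M gauss))"
      by (intro Bochner_Integration.integral_cong refl) (auto simp: cis_mult algebra_simps)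
    also have "\<dots> = (\<integral>\<omega>. \<integral>z. cis (t * l \<omega> v) * cis (t * residual_sd v * z) \<partial>gauss \<partial>N)"
    proof (rule P.integral_fst[symmetric])
      note [measurable] = field_component[OF v] cm
      have "integrable (N \<Otimes>\<^sub>M gauss) (\<lambda>x. cis (t * l (fst x) v + t * residual_sd v * snd x))"
        by (rule integrable_cis) (use P.finite_measure_axioms in auto)
      then show "integrable (N \<Otimes>\<^sub>M gauss) (\<lambda>(\<omega>, z). cis (t * l \<omega> v) * cis (t * residual_sd v * z))"
        by (simp add: case_prod_beta' cis_mult)
    qed
    also have "\<dots> = (\<integral>\<omega>. cis (t * l \<omega> v) * complex_of_real (exp (- (t * residual_sd v)\<^sup>2 / 2)) \<partial>N)"
      by (simp only: integral_mult_right_zero integral_gauss_cis)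
    also have "\<dots> = (\<integral>\<omega>. cis (t * l \<omega> v) \<partial>N) * complex_of_real (exp (- (t * residual_sd v)\<^sup>2 / 2))"
      by (rule integral_mult_left_zero)
    also have "\<dots> = complex_of_real (exp (- (t * t * c (v \<bullet> v)) / 2)) * complex_of_real (exp (- (t * residual_sd v)\<^sup>2 / 2))"
      using expectation_cis[of "{0::nat}" "\<lambda>_. v" "\<lambda>_. t"] v by simp
    also have "\<dots> = complex_of_real (exp (- t\<^sup>2 / 2))"
      unfolding of_real_mult[symmetric] exp_add[symmetric] power_mult_distrib residual_sd_square[OF v]
      by (simp add: power2_eq_square field_simps)
    finally show "char (distr (N \<Otimes>\<^sub>M gauss) borel (\<lambda>(\<omega>, z). noisy \<omega> v z)) t = char gauss t"
      by (simp add: char_std_normal_distribution)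
  qed
qed

text \<open>The result is the same for all v in the ball. This is the source of the bounds that are
  uniform in the sampling measure.\<close>

lemma nn_integral_noisy:
  assumes v: "v \<in> cball 0 1" and g [measurable]: "g \<in> borel_measurable borel"
  shows "(\<integral>\<^sup>+\<omega>. \<integral>\<^sup>+z. g (noisy \<omega> v z) \<partial>gauss \<partial>N) = (\<integral>\<^sup>+y. g y \<partial>gauss)"
proof -
  interpret G: prob_space gauss by (rule prob_space_gauss)
  note m = noisy_measurable_at[OF v]
  have "(\<integral>\<^sup>+y. g y \<partial>gauss) = (\<integral>\<^sup>+y. g y \<partial>distr (N \<Otimes>\<^sub>M gauss) borel (\<lambda>(\<omega>, z). noisy \<omega> v z))"
    by (simp add: noisy_law[OF v])
  also have "\<dots> = (\<integral>\<^sup>+x. g (case x of (\<omega>, z) \<Rightarrow> noisy \<omega> v z) \<partial>(N \<Otimes>\<^sub>M gauss))"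
    by (subst nn_integral_distr[OF m]) auto
  also have "\<dots> = (\<integral>\<^sup>+\<omega>. \<integral>\<^sup>+z. g (case (\<omega>, z) of (\<omega>, z) \<Rightarrow> noisy \<omega> v z) \<partial>gauss \<partial>N)"
    by (rule G.nn_integral_fst[symmetric]) (rule measurable_compose[OF m g])
  finally show ?thesis by simp
qed

text \<open>Kept general in g, so that the cavity weight, obtained from \<open>exp \<psi>\<close>,
  and its approximation, obtained from a trigonometric polynomial, are treated alike.\<close>

definition smooth :: "(real \<Rightarrow> real) \<Rightarrow> 'w \<Rightarrow> 'h \<Rightarrow> real" where
  "smooth g \<omega> v = (\<integral>z. g (noisy \<omega> v z) \<partial>gauss)"

lemma smooth_measurable [measurable]:
  assumes [measurable]: "g \<in> borel_measurable borel"
  shows "(\<lambda>(\<omega>, v). smooth g \<omega> v) \<in> borel_measurable (N \<Otimes>\<^sub>M ball_space)"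
proof -
  interpret G: prob_space gauss by (rule prob_space_gauss)
  have "(\<lambda>(p, z). g (noisy (fst p) (snd p) z)) \<in> borel_measurable ((N \<Otimes>\<^sub>M ball_space) \<Otimes>\<^sub>M gauss)"
    using measurable_compose[OF noisy_measurable assms] by (simp add: case_prod_beta')
  then have "(\<lambda>p. \<integral>z. g (noisy (fst p) (snd p) z) \<partial>gauss) \<in> borel_measurable (N \<Otimes>\<^sub>M ball_space)"
    by (rule G.borel_measurable_lebesgue_integral)
  then show ?thesis by (simp add: smooth_def case_prod_beta')
qed

lemma smooth_trig:
  assumes T: "\<And>x. complex_of_real (T x) = trig_sum xs x"
  shows "complex_of_real (smooth T \<omega> v) = (\<Sum>m<length xs. fst (xs ! m) *
    complex_of_real (exp (- (snd (xs ! m) * residual_sd v)\<^sup>2 / 2)) * cis (snd (xs ! m) * l \<omega> v))"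
proof -
  interpret G: prob_space gauss by (rule prob_space_gauss)
  have "complex_of_real (smooth T \<omega> v) = (\<integral>z. trig_sum xs (noisy \<omega> v z) \<partial>gauss)"
    unfolding smooth_def T[symmetric] by (simp add: integral_complex_of_real)
  also have "\<dots> = (\<integral>z. (\<Sum>m<length xs. fst (xs ! m) * cis (snd (xs ! m) * l \<omega> v) * cis (snd (xs ! m) * residual_sd v * z)) \<partial>gauss)"
    unfolding trig_sum_eq_sum by (simp add: cis_mult distrib_left mult_ac)
  also have "\<dots> = (\<Sum>m<length xs. \<integral>z. fst (xs ! m) * cis (snd (xs ! m) * l \<omega> v) * cis (snd (xs ! m) * residual_sd v * z) \<partial>gauss)"
    by (intro Bochner_Integration.integral_sum integrable_mult_right integrable_cis)
      (auto intro: G.finite_measure_axioms)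
  also have "\<dots> = (\<Sum>m<length xs. fst (xs ! m) *
    complex_of_real (exp (- (snd (xs ! m) * residual_sd v)\<^sup>2 / 2)) * cis (snd (xs ! m) * l \<omega> v))"
    by (intro sum.cong refl) (simp only: integral_mult_right_zero integral_gauss_cis, simp)
  finally show ?thesis .
qed

text \<open>The sum runs over the choices of one frequency for each of the n factors, and each
  exponential is a Gaussian characteristic function with covariances \<open>c (q i j)\<close>. At
  sampled matrices the sum is real; elsewhere the real part keeps the function real-valued.\<close>

definition trig_moment :: "(complex \<times> real) list \<Rightarrow> nat \<Rightarrow> (nat \<Rightarrow> nat \<Rightarrow> real) \<Rightarrow> real" where
  "trig_moment xs n q = Re (\<Sum>f\<in>{..<n} \<rightarrow>\<^sub>E {..<length xs}. (\<Prod>i<n. fst (xs ! f i)) *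
     complex_of_real (exp (- (\<Sum>i<n. \<Sum>j<n. snd (xs ! f i) * snd (xs ! f j) * c (q i j)) / 2)))"

lemma trig_moment_continuous: "continuous_on overlap_matrices (trig_moment xs n)"
proof -
  have "continuous_on overlap_matrices (\<lambda>q. c (q i j))" for i j
    using overlap_matrices_abs_le_1
    by (intro continuous_on_compose2[OF c_cont continuous_on_entry]) (force simp: abs_le_iff)
  then show ?thesis
    unfolding trig_moment_def
    by (intro continuous_on_Re continuous_on_sum continuous_on_mult continuous_on_const
        continuous_on_of_real continuous_on_exp continuous_on_divide continuous_on_minus) auto
qed

text \<open>The independent Gaussian noise raises the variances \<open>c (v \<bullet> v)\<close> to \<open>1 = c 1\<close>, so that the
  moments depend on the sampled matrix only.\<close>

lemma expectation_prod_smooth_trig: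
  assumes T: "\<And>x. complex_of_real (T x) = trig_sum xs x" and v: "\<And>i. v i \<in> cball 0 1"
  shows "(\<integral>\<omega>. (\<Prod>i<n. smooth T \<omega> (v i)) \<partial>N) = trig_moment xs n (sampled_matrix v)"
proof -
  define \<alpha> where "\<alpha> f i = snd (xs ! f i)" for f :: "nat \<Rightarrow> nat" and i :: nat
  define C where "C f = (\<Prod>i<n. fst (xs ! f i))" for f :: "nat \<Rightarrow> nat"
  define D where "D f = exp (- (\<Sum>i<n. (\<alpha> f i * residual_sd (v i))\<^sup>2) / 2)" for f
  have prod: "complex_of_real (\<Prod>i<n. smooth T \<omega> (v i)) =
      (\<Sum>f\<in>{..<n} \<rightarrow>\<^sub>E {..<length xs}. (C f * complex_of_real (D f)) * cis (\<Sum>i<n. \<alpha> f i * l \<omega> (v i)))" for \<omega>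
  proof -
    have "complex_of_real (\<Prod>i<n. smooth T \<omega> (v i)) =
      (\<Sum>f\<in>{..<n} \<rightarrow>\<^sub>E {..<length xs}. \<Prod>i<n. fst (xs ! f i) *
        complex_of_real (exp (- (snd (xs ! f i) * residual_sd (v i))\<^sup>2 / 2)) * cis (snd (xs ! f i) * l \<omega> (v i)))"
      unfolding of_real_prod smooth_trig[OF T] by (rule prod_sum_PiE) auto
    also have "\<dots> = (\<Sum>f\<in>{..<n} \<rightarrow>\<^sub>E {..<length xs}. (C f * complex_of_real (D f)) * cis (\<Sum>i<n. \<alpha> f i * l \<omega> (v i)))"
    proof (intro sum.cong refl)
      fix f
      have "D f = (\<Prod>i<n. exp (- (\<alpha> f i * residual_sd (v i))\<^sup>2 / 2))"
        unfolding D_def by (simp add: sum_divide_distrib flip: exp_sum sum_negf)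
      then show "(\<Prod>i<n. fst (xs ! f i) * complex_of_real (exp (- (snd (xs ! f i) * residual_sd (v i))\<^sup>2 / 2)) *
          cis (snd (xs ! f i) * l \<omega> (v i))) = (C f * complex_of_real (D f)) * cis (\<Sum>i<n. \<alpha> f i * l \<omega> (v i))"
        by (simp add: prod.distrib C_def \<alpha>_def cis_prod)
    qed
    finally show ?thesis .
  qed
  have int: "integrable N (\<lambda>\<omega>. cis (\<Sum>i<n. \<alpha> f i * l \<omega> (v i)))" for f
    using v by (intro integrable_cis finite_measure_axioms borel_measurable_sum borel_measurable_times borel_measurable_const field_component)
  have "complex_of_real (\<integral>\<omega>. (\<Prod>i<n. smooth T \<omega> (v i)) \<partial>N) =
      (\<integral>\<omega>. complex_of_real (\<Prod>i<n. smooth T \<omega> (v i)) \<partial>N)"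
    by (rule integral_complex_of_real[symmetric])
  also have "\<dots> = (\<Sum>f\<in>{..<n} \<rightarrow>\<^sub>E {..<length xs}. (C f * complex_of_real (D f)) * (\<integral>\<omega>. cis (\<Sum>i<n. \<alpha> f i * l \<omega> (v i)) \<partial>N))"
    unfolding prod
    by (subst Bochner_Integration.integral_sum) (auto intro!: integrable_mult_right int)
  also have "\<dots> = (\<Sum>f\<in>{..<n} \<rightarrow>\<^sub>E {..<length xs}. C f *
     complex_of_real (exp (- (\<Sum>i<n. \<Sum>j<n. \<alpha> f i * \<alpha> f j * c (sampled_matrix v i j)) / 2)))"
  proof (intro sum.cong refl)
    fix f
    have "(\<Sum>i<n. \<Sum>j<n. \<alpha> f i * \<alpha> f j * c (sampled_matrix v i j)) =
        (\<Sum>i<n. \<Sum>j<n. \<alpha> f i * \<alpha> f j * c (v i \<bullet> v j) + (if i = j then (\<alpha> f i * residual_sd (v i))\<^sup>2 else 0))"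
      by (intro sum.cong refl)
        (auto simp: sampled_matrix_def c_one power_mult_distrib residual_sd_square[OF v] right_diff_distrib,
          simp add: power2_eq_square)
    also have "\<dots> = (\<Sum>i<n. \<Sum>j<n. \<alpha> f i * \<alpha> f j * c (v i \<bullet> v j)) + (\<Sum>i<n. (\<alpha> f i * residual_sd (v i))\<^sup>2)"
      by (simp add: sum.distrib)
    finally have "D f * exp (- (\<Sum>i<n. \<Sum>j<n. \<alpha> f i * \<alpha> f j * c (v i \<bullet> v j)) / 2) =
       exp (- (\<Sum>i<n. \<Sum>j<n. \<alpha> f i * \<alpha> f j * c (sampled_matrix v i j)) / 2)"
      by (simp add: D_def field_simps flip: exp_add)
    then show "(C f * complex_of_real (D f)) * (\<integral>\<omega>. cis (\<Sum>i<n. \<alpha> f i * l \<omega> (v i)) \<partial>N) =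
       C f * complex_of_real (exp (- (\<Sum>i<n. \<Sum>j<n. \<alpha> f i * \<alpha> f j * c (sampled_matrix v i j)) / 2))"
      using v by (subst expectation_cis) (auto simp flip: of_real_mult)
  qed
  finally have eq: "complex_of_real (\<integral>\<omega>. (\<Prod>i<n. smooth T \<omega> (v i)) \<partial>N) = (\<Sum>f\<in>{..<n} \<rightarrow>\<^sub>E {..<length xs}. C f *
     complex_of_real (exp (- (\<Sum>i<n. \<Sum>j<n. \<alpha> f i * \<alpha> f j * c (sampled_matrix v i j)) / 2)))" .
  have "(\<integral>\<omega>. (\<Prod>i<n. smooth T \<omega> (v i)) \<partial>N) = Re (complex_of_real (\<integral>\<omega>. (\<Prod>i<n. smooth T \<omega> (v i)) \<partial>N))"
    by simp
  also have "\<dots> = trig_moment xs n (sampled_matrix v)"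
    unfolding eq trig_moment_def C_def \<alpha>_def ..
  finally show ?thesis .
qed

end


section \<open>Products of densities\<close>

text \<open>The power of a tilted measure over infinitely many coordinates need not have a density,
  so the change of measure is made on finitely many.\<close>

lemma PiM_density:
  fixes f :: "'a \<Rightarrow> ennreal"
  assumes I: "finite I" and M: "prob_space M" and f [measurable]: "f \<in> borel_measurable M"
    and D: "prob_space (density M f)"
  shows "density (PiM I (\<lambda>_. M)) (\<lambda>x. \<Prod>i\<in>I. f (x i)) = PiM I (\<lambda>_. density M f)"
proof -
  interpret M: prob_space M by fact
  interpret D: prob_space "density M f" by fact
  interpret PD: product_prob_space "\<lambda>_. density M f" I by unfold_locales
  interpret PM: product_prob_space "\<lambda>_. M" I by unfold_locales
  show ?thesis
  proof (rule PD.PiM_eqI[OF I])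
    show "sets (density (PiM I (\<lambda>_. M)) (\<lambda>x. \<Prod>i\<in>I. f (x i))) = sets (PiM I (\<lambda>_. density M f))"
      by (simp, intro sets_PiM_cong) auto
    fix A assume A: "\<And>i. i \<in> I \<Longrightarrow> A i \<in> sets (density M f)"
    then have A' [measurable]: "A i \<in> sets M" if "i \<in> I" for i using that by simp
    have "emeasure (density (PiM I (\<lambda>_. M)) (\<lambda>x. \<Prod>i\<in>I. f (x i))) (PiE I A) =
        (\<integral>\<^sup>+x. (\<Prod>i\<in>I. f (x i)) * indicator (PiE I A) x \<partial>PiM I (\<lambda>_. M))"
      using I A' by (intro emeasure_density borel_measurable_prod_ennreal) (auto intro!: sets_PiM_I_finite)
    also have "\<dots> = (\<integral>\<^sup>+x. (\<Prod>i\<in>I. f (x i) * indicator (A i) (x i)) \<partial>PiM I (\<lambda>_. M))"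
    proof (rule nn_integral_cong)
      fix x assume "x \<in> space (PiM I (\<lambda>_. M))"
      then have "x \<in> extensional I" by (simp add: space_PiM PiE_iff)
      then have "indicator (PiE I A) x = (\<Prod>i\<in>I. indicator (A i) (x i) :: ennreal)"
        using I by (auto simp: indicator_def PiE_iff prod_zero_iff)
      then show "(\<Prod>i\<in>I. f (x i)) * indicator (PiE I A) x = (\<Prod>i\<in>I. f (x i) * indicator (A i) (x i))"
        by (simp add: prod.distrib)
    qed
    also have "\<dots> = (\<Prod>i\<in>I. \<integral>\<^sup>+x. f x * indicator (A i) x \<partial>M)"
      using A' by (intro PM.product_nn_integral_prod I) auto
    also have "\<dots> = (\<Prod>i\<in>I. emeasure (density M f) (A i))"
      using A' by (intro prod.cong refl) (simp add: emeasure_density)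
    finally show "emeasure (density (PiM I (\<lambda>_. M)) (\<lambda>x. \<Prod>i\<in>I. f (x i))) (PiE I A) =
        (\<Prod>i\<in>I. emeasure (density M f) (A i))" .
  qed
qed

text \<open>The missing coordinates are filled with a point \<open>x0\<close> of the space, which
  keeps the padded sequence in the region where \<open>dep\<close> applies.\<close>

lemma integral_PiM_restrict:
  fixes F :: "(nat \<Rightarrow> 'a) \<Rightarrow> real"
  assumes M: "prob_space M" and x0: "x0 \<in> space M"
    and F: "F \<in> borel_measurable (PiM UNIV (\<lambda>_::nat. M))"
    and dep: "\<And>v v'. v \<in> space (PiM UNIV (\<lambda>_::nat. M)) \<Longrightarrow> v' \<in> space (PiM UNIV (\<lambda>_::nat. M)) \<Longrightarrow>
      (\<And>i. i < n \<Longrightarrow> v i = v' i) \<Longrightarrow> F v = F v'"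
  shows "(\<lambda>u. F (\<lambda>i. if i < n then u i else x0)) \<in> borel_measurable (PiM {..<n} (\<lambda>_. M))"
    and "(\<integral>v. F v \<partial>PiM UNIV (\<lambda>_::nat. M)) = (\<integral>u. F (\<lambda>i. if i < n then u i else x0) \<partial>PiM {..<n} (\<lambda>_. M))"
proof -
  interpret M: prob_space M by fact
  interpret P: product_prob_space "\<lambda>_. M" "UNIV :: nat set" by unfold_locales
  have ext: "(\<lambda>u i. if i < n then u i else x0) \<in> measurable (PiM {..<n} (\<lambda>_. M)) (PiM UNIV (\<lambda>_::nat. M))"
  proof (rule measurable_PiM_single')
    show "(\<lambda>u. if i < n then u i else x0) \<in> measurable (PiM {..<n} (\<lambda>_. M)) M" for i
      using x0 by (cases "i < n") auto
  qed (use x0 in \<open>auto simp: space_PiM PiE_iff\<close>)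
  show m: "(\<lambda>u. F (\<lambda>i. if i < n then u i else x0)) \<in> borel_measurable (PiM {..<n} (\<lambda>_. M))"
    by (rule measurable_compose[OF ext F])
  have restr: "(\<lambda>v. restrict v {..<n}) \<in> measurable (PiM UNIV (\<lambda>_::nat. M)) (PiM {..<n} (\<lambda>_. M))"
    by (rule measurable_restrict_subset) simp
  have "(\<integral>u. F (\<lambda>i. if i < n then u i else x0) \<partial>PiM {..<n} (\<lambda>_. M)) =
      (\<integral>u. F (\<lambda>i. if i < n then u i else x0) \<partial>distr (PiM UNIV (\<lambda>_::nat. M)) (PiM {..<n} (\<lambda>_. M)) (\<lambda>v. restrict v {..<n}))"
    by (subst P.distr_PiM_restrict_finite) auto
  also have "\<dots> = (\<integral>v. F (\<lambda>i. if i < n then restrict v {..<n} i else x0) \<partial>PiM UNIV (\<lambda>_::nat. M))"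
    by (rule integral_distr[OF restr m])
  also have "\<dots> = (\<integral>v. F v \<partial>PiM UNIV (\<lambda>_::nat. M))"
  proof (intro Bochner_Integration.integral_cong refl dep)
    fix v assume v: "v \<in> space (PiM UNIV (\<lambda>_::nat. M))"
    then show "(\<lambda>i. if i < n then restrict v {..<n} i else x0) \<in> space (PiM UNIV (\<lambda>_::nat. M))"
      using x0 by (auto simp: space_PiM PiE_iff)
  qed auto
  finally show "(\<integral>v. F v \<partial>PiM UNIV (\<lambda>_::nat. M)) = (\<integral>u. F (\<lambda>i. if i < n then u i else x0) \<partial>PiM {..<n} (\<lambda>_. M))" by simp
qed

lemma measurable_coordinate_comp:
  assumes "g \<in> measurable M K" and k: "k \<in> I"
  shows "(\<lambda>v. g (v k)) \<in> measurable (PiM I (\<lambda>_. M)) K"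
  by (rule measurable_compose[OF measurable_component_singleton[OF k, of "\<lambda>_. M"] assms(1)])

text \<open>Passing to the finite product, where the density exists, and back turns sampling from
  the tilted measure into weighted sampling from the original one.\<close>

lemma integral_PiM_density:
  fixes F :: "(nat \<Rightarrow> 'a) \<Rightarrow> real" and r :: "'a \<Rightarrow> real"
  assumes M: "prob_space M" and r: "r \<in> borel_measurable M" and r_nonneg: "\<And>x. x \<in> space M \<Longrightarrow> 0 \<le> r x"
    and D: "prob_space (density M (\<lambda>x. ennreal (r x)))"
    and F: "F \<in> borel_measurable (PiM UNIV (\<lambda>_::nat. M))"
    and dep: "\<And>v v'. v \<in> space (PiM UNIV (\<lambda>_::nat. M)) \<Longrightarrow> v' \<in> space (PiM UNIV (\<lambda>_::nat. M)) \<Longrightarrow>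
      (\<And>i. i < n \<Longrightarrow> v i = v' i) \<Longrightarrow> F v = F v'"
  shows "(\<integral>v. F v \<partial>PiM UNIV (\<lambda>_. density M (\<lambda>x. ennreal (r x)))) =
    (\<integral>v. (\<Prod>i<n. r (v i)) * F v \<partial>PiM UNIV (\<lambda>_::nat. M))"
proof -
  interpret M: prob_space M by fact
  obtain x0 where x0: "x0 \<in> space M" using M.not_empty by blast
  define D where "D = density M (\<lambda>x. ennreal (r x))"
  have space: "space (PiM UNIV (\<lambda>_::nat. D)) = space (PiM UNIV (\<lambda>_::nat. M))" by (simp add: space_PiM D_def)
  have sets: "sets (PiM UNIV (\<lambda>_::nat. D)) = sets (PiM UNIV (\<lambda>_::nat. M))" by (intro sets_PiM_cong) (auto simp: D_def)
  have FD: "F \<in> borel_measurable (PiM UNIV (\<lambda>_. D))"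
    using F measurable_cong_sets[OF sets refl] by blast
  define e where "e u = (\<lambda>i. if i < n then u i else x0)" for u :: "nat \<Rightarrow> 'a"
  have "(\<integral>v. F v \<partial>PiM UNIV (\<lambda>_. D)) = (\<integral>u. F (e u) \<partial>PiM {..<n} (\<lambda>_. D))"
    unfolding e_def
  proof (rule integral_PiM_restrict(2)[OF _ _ FD])
    show "prob_space D" using D by (simp add: D_def)
    show "x0 \<in> space D" using x0 by (simp add: D_def)
  qed (unfold space, rule dep)
  also have "PiM {..<n} (\<lambda>_. D) = density (PiM {..<n} (\<lambda>_. M)) (\<lambda>u. \<Prod>i<n. ennreal (r (u i)))"
    unfolding D_def using r D by (intro PiM_density[symmetric] M) auto
  also have "\<dots> = density (PiM {..<n} (\<lambda>_. M)) (\<lambda>u. ennreal (\<Prod>i<n. r (u i)))"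
  proof (rule density_cong)
    show "AE u in PiM {..<n} (\<lambda>_. M). (\<Prod>i<n. ennreal (r (u i))) = ennreal (\<Prod>i<n. r (u i))"
      using r_nonneg by (intro AE_I2 prod_ennreal) (auto simp: space_PiM PiE_iff)
  qed (use r in \<open>auto intro!: borel_measurable_prod_ennreal borel_measurable_prod measurable_coordinate_comp measurable_compose[OF _ measurable_ennreal]\<close>)
  also have "(\<integral>u. F (e u) \<partial>\<dots>) = (\<integral>u. (\<Prod>i<n. r (u i)) *\<^sub>R F (e u) \<partial>PiM {..<n} (\<lambda>_. M))"
  proof (rule integral_density)
    show "(\<lambda>u. F (e u)) \<in> borel_measurable (PiM {..<n} (\<lambda>_. M))"
      unfolding e_def by (rule integral_PiM_restrict(1)[OF M x0 F dep])
    show "(\<lambda>u. \<Prod>i<n. r (u i)) \<in> borel_measurable (PiM {..<n} (\<lambda>_. M))"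
      by (intro borel_measurable_prod measurable_coordinate_comp r)
    show "AE u in PiM {..<n} (\<lambda>_. M). 0 \<le> (\<Prod>i<n. r (u i))"
      using r_nonneg by (intro AE_I2 prod_nonneg) (auto simp: space_PiM PiE_iff)
  qed
  also have "\<dots> = (\<integral>u. (\<Prod>i<n. r (e u i)) * F (e u) \<partial>PiM {..<n} (\<lambda>_. M))"
    by (simp add: e_def)
  also have "\<dots> = (\<integral>v. (\<Prod>i<n. r (v i)) * F v \<partial>PiM UNIV (\<lambda>_::nat. M))"
    unfolding e_def
  proof (rule integral_PiM_restrict(2)[OF M x0, symmetric])
    show "(\<lambda>v. (\<Prod>i<n. r (v i)) * F v) \<in> borel_measurable (PiM UNIV (\<lambda>_::nat. M))"
      by (intro borel_measurable_times borel_measurable_prod F measurable_coordinate_comp r UNIV_I)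
    fix v v' assume v: "v \<in> space (PiM UNIV (\<lambda>_::nat. M))" "v' \<in> space (PiM UNIV (\<lambda>_::nat. M))"
      and eq: "\<And>i. i < n \<Longrightarrow> v i = v' i"
    show "(\<Prod>i<n. r (v i)) * F v = (\<Prod>i<n. r (v' i)) * F v'"
      using dep[OF v eq] eq by simp
  qed
  finally show ?thesis by (simp add: D_def)
qed

text \<open>\<open>comb_seq k\<close> puts the first k entries of one sequence in front of an
  independent second one without changing the law. Then \<open>F\<close> reads only the first
  sequence and \<open>g\<close> only the initial entry of the second.\<close>

lemma nn_integral_PiM_next:
  fixes F :: "(nat \<Rightarrow> 'a) \<Rightarrow> ennreal"
  assumes M: "prob_space M"
    and F: "F \<in> borel_measurable (PiM UNIV (\<lambda>_::nat. M))" and g: "g \<in> borel_measurable M"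
    and dep: "\<And>v v'. v \<in> space (PiM UNIV (\<lambda>_::nat. M)) \<Longrightarrow> v' \<in> space (PiM UNIV (\<lambda>_::nat. M)) \<Longrightarrow>
      (\<And>i. i < k \<Longrightarrow> v i = v' i) \<Longrightarrow> F v = F v'"
  shows "(\<integral>\<^sup>+v. F v * g (v k) \<partial>PiM UNIV (\<lambda>_::nat. M)) = (\<integral>\<^sup>+v. F v \<partial>PiM UNIV (\<lambda>_::nat. M)) * (\<integral>\<^sup>+x. g x \<partial>M)"
proof -
  interpret M: prob_space M by fact
  interpret sequence_space M by unfold_locales
  have g0: "(\<lambda>v. g (v k)) \<in> borel_measurable S" for k by (rule measurable_coordinate_comp[OF g UNIV_I])
  have H: "(\<lambda>v. F v * g (v k)) \<in> borel_measurable S" using F g0 by (rule borel_measurable_times_ennreal)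
  have "(\<integral>\<^sup>+v. F v * g (v k) \<partial>S) = (\<integral>\<^sup>+v. F v * g (v k) \<partial>distr (S \<Otimes>\<^sub>M S) S (\<lambda>(\<omega>, \<omega>'). comb_seq k \<omega> \<omega>'))"
    by (simp add: PiM_comb_seq)
  also have "\<dots> = (\<integral>\<^sup>+p. F (comb_seq k (fst p) (snd p)) * g (comb_seq k (fst p) (snd p) k) \<partial>(S \<Otimes>\<^sub>M S))"
    by (subst nn_integral_distr[OF measurable_comb_seq]) (use H in \<open>auto simp: case_prod_beta\<close>)
  also have "\<dots> = (\<integral>\<^sup>+p. F (fst p) * g (snd p 0) \<partial>(S \<Otimes>\<^sub>M S))"
  proof (rule nn_integral_cong)
    fix p assume "p \<in> space (S \<Otimes>\<^sub>M S)"
    then have p: "fst p \<in> space S" "snd p \<in> space S" by (auto simp: space_pair_measure)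
    have "comb_seq k (fst p) (snd p) \<in> space S"
      using p by (auto simp: space_PiM PiE_iff comb_seq_def)
    then have "F (comb_seq k (fst p) (snd p)) = F (fst p)"
      using p by (intro dep) (simp_all add: comb_seq_less)
    moreover have "comb_seq k (fst p) (snd p) k = snd p 0" by (simp add: comb_seq_def)
    ultimately show "F (comb_seq k (fst p) (snd p)) * g (comb_seq k (fst p) (snd p) k) = F (fst p) * g (snd p 0)"
      by simp
  qed
  also have "\<dots> = (\<integral>\<^sup>+v. \<integral>\<^sup>+v'. F v * g (v' 0) \<partial>S \<partial>S)"
    by (subst P.nn_integral_fst[symmetric])
      (auto intro!: borel_measurable_times_ennreal measurable_compose[OF measurable_fst F] measurable_compose[OF measurable_snd g0])
  also have "\<dots> = (\<integral>\<^sup>+v. F v \<partial>S) * (\<integral>\<^sup>+v'. g (v' 0) \<partial>S)"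
    using F g0 by (simp add: nn_integral_cmult nn_integral_multc)
  also have "(\<integral>\<^sup>+v'. g (v' 0) \<partial>S) = (\<integral>\<^sup>+x. g x \<partial>distr S M (\<lambda>v. v 0))"
    using g by (subst nn_integral_distr) auto
  also have "\<dots> = (\<integral>\<^sup>+x. g x \<partial>M)" by (subst PiM_component) auto
  finally show ?thesis .
qed

lemma integral_PiM_next:
  fixes F :: "(nat \<Rightarrow> 'a) \<Rightarrow> real"
  assumes M: "prob_space M"
    and F: "F \<in> borel_measurable (PiM UNIV (\<lambda>_::nat. M))" "\<And>v. v \<in> space (PiM UNIV (\<lambda>_::nat. M)) \<Longrightarrow> \<bar>F v\<bar> \<le> B"
    and g: "g \<in> borel_measurable M" "\<And>x. x \<in> space M \<Longrightarrow> \<bar>g x\<bar> \<le> B'"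
    and dep: "\<And>v v'. v \<in> space (PiM UNIV (\<lambda>_::nat. M)) \<Longrightarrow> v' \<in> space (PiM UNIV (\<lambda>_::nat. M)) \<Longrightarrow>
      (\<And>i. i < k \<Longrightarrow> v i = v' i) \<Longrightarrow> F v = F v'"
  shows "(\<integral>v. F v * g (v k) \<partial>PiM UNIV (\<lambda>_::nat. M)) = (\<integral>v. F v \<partial>PiM UNIV (\<lambda>_::nat. M)) * (\<integral>x. g x \<partial>M)"
proof -
  interpret M: prob_space M by fact
  interpret sequence_space M by unfold_locales
  interpret SS: pair_prob_space S S ..
  have g0: "(\<lambda>v. g (v k)) \<in> borel_measurable S" for k by (rule measurable_coordinate_comp[OF g(1) UNIV_I])
  have H: "(\<lambda>v. F v * g (v k)) \<in> borel_measurable S" using F(1) g0 by (rule borel_measurable_times)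
  have "(\<integral>v. F v * g (v k) \<partial>S) = (\<integral>v. F v * g (v k) \<partial>distr (S \<Otimes>\<^sub>M S) S (\<lambda>(\<omega>, \<omega>'). comb_seq k \<omega> \<omega>'))"
    by (simp add: PiM_comb_seq)
  also have "\<dots> = (\<integral>p. F (comb_seq k (fst p) (snd p)) * g (comb_seq k (fst p) (snd p) k) \<partial>(S \<Otimes>\<^sub>M S))"
    by (subst integral_distr[OF measurable_comb_seq]) (use H in \<open>auto simp: case_prod_beta\<close>)
  also have "\<dots> = (\<integral>p. F (fst p) * g (snd p 0) \<partial>(S \<Otimes>\<^sub>M S))"
  proof (rule Bochner_Integration.integral_cong[OF refl])
    fix p assume "p \<in> space (S \<Otimes>\<^sub>M S)"
    then have p: "fst p \<in> space S" "snd p \<in> space S" by (auto simp: space_pair_measure)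
    have "comb_seq k (fst p) (snd p) \<in> space S"
      using p by (auto simp: space_PiM PiE_iff comb_seq_def)
    then have "F (comb_seq k (fst p) (snd p)) = F (fst p)"
      using p by (intro dep) (simp_all add: comb_seq_less)
    moreover have "comb_seq k (fst p) (snd p) k = snd p 0" by (simp add: comb_seq_def)
    ultimately show "F (comb_seq k (fst p) (snd p)) * g (comb_seq k (fst p) (snd p) k) = F (fst p) * g (snd p 0)"
      by simp
  qed
  also have "\<dots> = (\<integral>(v, v'). F v * g (v' 0) \<partial>(S \<Otimes>\<^sub>M S))" by (simp add: case_prod_beta')
  also have "\<dots> = (\<integral>v. \<integral>v'. F v * g (v' 0) \<partial>S \<partial>S)"
  proof (rule SS.integral_fst[symmetric])
    have "integrable (S \<Otimes>\<^sub>M S) (\<lambda>p. F (fst p) * g (snd p 0))"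
    proof (rule SS.integrable_const_bound[where B="B * B'"])
      show "(\<lambda>p. F (fst p) * g (snd p 0)) \<in> borel_measurable (S \<Otimes>\<^sub>M S)"
        by (intro borel_measurable_times measurable_compose[OF measurable_fst F(1)] measurable_compose[OF measurable_snd g0])
      show "AE p in S \<Otimes>\<^sub>M S. norm (F (fst p) * g (snd p 0)) \<le> B * B'"
        using F(2) g(2)
        by (intro AE_I2) (auto simp: space_pair_measure abs_mult space_PiM PiE_iff intro!: mult_mono order_trans[OF abs_ge_zero F(2)])
    qed
    then show "integrable (S \<Otimes>\<^sub>M S) (\<lambda>(v, v'). F v * g (v' 0))" by (simp add: case_prod_beta')
  qed
  also have "\<dots> = (\<integral>v. F v \<partial>S) * (\<integral>v'. g (v' 0) \<partial>S)" by simp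
  also have "(\<integral>v'. g (v' 0) \<partial>S) = (\<integral>x. g x \<partial>distr S M (\<lambda>v. v 0))"
    using g by (subst integral_distr) auto
  also have "\<dots> = (\<integral>x. g x \<partial>M)" by (subst PiM_component) auto
  finally show ?thesis .
qed

lemma nn_integral_PiM_prod:
  fixes r :: "'a \<Rightarrow> real" and n :: nat
  assumes M: "prob_space M" and r: "r \<in> borel_measurable M" "\<And>x. x \<in> space M \<Longrightarrow> 0 \<le> r x"
    and r1: "(\<integral>\<^sup>+x. ennreal (r x) \<partial>M) = 1"
  shows "(\<integral>\<^sup>+v. ennreal (\<Prod>i<n. r (v i)) \<partial>PiM UNIV (\<lambda>_::nat. M)) = 1"
proof (induction n)
  case 0
  interpret prob_space "PiM UNIV (\<lambda>_::nat. M)" by (intro prob_space_PiM M)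
  show ?case by (simp add: emeasure_space_1)
next
  case (Suc n)
  have "(\<integral>\<^sup>+v. ennreal (\<Prod>i<Suc n. r (v i)) \<partial>PiM UNIV (\<lambda>_::nat. M)) =
      (\<integral>\<^sup>+v. ennreal (\<Prod>i<n. r (v i)) * ennreal (r (v n)) \<partial>PiM UNIV (\<lambda>_::nat. M))"
    using r by (intro nn_integral_cong) (auto simp: ennreal_mult' space_PiM PiE_iff intro!: ennreal_mult prod_nonneg)
  also have "\<dots> = (\<integral>\<^sup>+v. ennreal (\<Prod>i<n. r (v i)) \<partial>PiM UNIV (\<lambda>_::nat. M)) * (\<integral>\<^sup>+x. ennreal (r x) \<partial>M)"
    using r by (intro nn_integral_PiM_next M measurable_compose[OF _ measurable_ennreal] borel_measurable_prod measurable_coordinate_comp) auto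
  finally show ?case using Suc r1 by simp
qed

text \<open>Write \<open>A * r - A' * r'\<close> as \<open>(A - A') * r + A' * (r - r')\<close>. In
  each term the undifferenced factor integrates to 1, so every coordinate adds one single-point
  distance.\<close>

lemma nn_integral_PiM_prod_diff:
  fixes r r' :: "'a \<Rightarrow> real" and n :: nat
  assumes M: "prob_space M"
    and r: "r \<in> borel_measurable M" "\<And>x. x \<in> space M \<Longrightarrow> 0 \<le> r x" "(\<integral>\<^sup>+x. ennreal (r x) \<partial>M) = 1"
    and r': "r' \<in> borel_measurable M" "\<And>x. x \<in> space M \<Longrightarrow> 0 \<le> r' x" "(\<integral>\<^sup>+x. ennreal (r' x) \<partial>M) = 1"
  shows "(\<integral>\<^sup>+v. ennreal \<bar>(\<Prod>i<n. r (v i)) - (\<Prod>i<n. r' (v i))\<bar> \<partial>PiM UNIV (\<lambda>_::nat. M)) \<le>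
    of_nat n * (\<integral>\<^sup>+x. ennreal \<bar>r x - r' x\<bar> \<partial>M)"
proof (induction n)
  case (Suc n)
  let ?S = "PiM UNIV (\<lambda>_::nat. M)"
  define A where "A v = (\<Prod>i<n. r (v i))" for v :: "nat \<Rightarrow> 'a"
  define A' where "A' v = (\<Prod>i<n. r' (v i))" for v :: "nat \<Rightarrow> 'a"
  have m: "A \<in> borel_measurable ?S" "A' \<in> borel_measurable ?S"
    unfolding A_def A'_def using r r' by (auto intro!: borel_measurable_prod measurable_coordinate_comp)
  have mc: "(\<lambda>v. r (v n)) \<in> borel_measurable ?S" "(\<lambda>v. r' (v n)) \<in> borel_measurable ?S"
    using r r' by (auto intro!: measurable_coordinate_comp)
  have "(\<integral>\<^sup>+v. ennreal \<bar>(\<Prod>i<Suc n. r (v i)) - (\<Prod>i<Suc n. r' (v i))\<bar> \<partial>?S) \<le>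
      (\<integral>\<^sup>+v. ennreal \<bar>A v - A' v\<bar> * ennreal (r (v n)) + ennreal (A' v) * ennreal \<bar>r (v n) - r' (v n)\<bar> \<partial>?S)"
  proof (rule nn_integral_mono)
    fix v assume "v \<in> space ?S"
    then have v: "v i \<in> space M" for i by (simp add: space_PiM PiE_iff)
    have A'0: "0 \<le> A' v" unfolding A'_def using r' v by (intro prod_nonneg) auto
    have "A v * r (v n) - A' v * r' (v n) = (A v - A' v) * r (v n) + A' v * (r (v n) - r' (v n))"
      by (simp add: algebra_simps)
    then have "\<bar>A v * r (v n) - A' v * r' (v n)\<bar> \<le> \<bar>A v - A' v\<bar> * r (v n) + A' v * \<bar>r (v n) - r' (v n)\<bar>"
      using abs_triangle_ineq[of "(A v - A' v) * r (v n)" "A' v * (r (v n) - r' (v n))"] r(2)[OF v[of n]] A'0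
      by (simp add: abs_mult)
    then show "ennreal \<bar>(\<Prod>i<Suc n. r (v i)) - (\<Prod>i<Suc n. r' (v i))\<bar> \<le>
        ennreal \<bar>A v - A' v\<bar> * ennreal (r (v n)) + ennreal (A' v) * ennreal \<bar>r (v n) - r' (v n)\<bar>"
      using r(2)[OF v[of n]] A'0 by (simp add: A_def A'_def ennreal_leI flip: ennreal_mult ennreal_plus)
  qed
  also have "\<dots> = (\<integral>\<^sup>+v. ennreal \<bar>A v - A' v\<bar> * ennreal (r (v n)) \<partial>?S) + (\<integral>\<^sup>+v. ennreal (A' v) * ennreal \<bar>r (v n) - r' (v n)\<bar> \<partial>?S)"
    using m mc by (intro nn_integral_add) auto
  also have "(\<integral>\<^sup>+v. ennreal \<bar>A v - A' v\<bar> * ennreal (r (v n)) \<partial>?S) = (\<integral>\<^sup>+v. ennreal \<bar>A v - A' v\<bar> \<partial>?S) * (\<integral>\<^sup>+x. ennreal (r x) \<partial>M)"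
  proof (rule nn_integral_PiM_next[OF M])
    show "(\<lambda>v. ennreal \<bar>A v - A' v\<bar>) \<in> borel_measurable ?S" using m by measurable
  qed (use r in \<open>auto simp: A_def A'_def\<close>)
  also have "(\<integral>\<^sup>+v. ennreal (A' v) * ennreal \<bar>r (v n) - r' (v n)\<bar> \<partial>?S) =
      (\<integral>\<^sup>+v. ennreal (A' v) \<partial>?S) * (\<integral>\<^sup>+x. ennreal \<bar>r x - r' x\<bar> \<partial>M)"
  proof (rule nn_integral_PiM_next[OF M, where g="\<lambda>x. ennreal \<bar>r x - r' x\<bar>"])
    show "(\<lambda>v. ennreal (A' v)) \<in> borel_measurable ?S" using m by measurable
  qed (use r r' in \<open>auto simp: A'_def\<close>)
  also have "(\<integral>\<^sup>+v. ennreal (A' v) \<partial>?S) = 1"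
    unfolding A'_def by (rule nn_integral_PiM_prod[OF M r'])
  finally have "(\<integral>\<^sup>+v. ennreal \<bar>(\<Prod>i<Suc n. r (v i)) - (\<Prod>i<Suc n. r' (v i))\<bar> \<partial>?S) \<le>
      (\<integral>\<^sup>+v. ennreal \<bar>A v - A' v\<bar> \<partial>?S) + (\<integral>\<^sup>+x. ennreal \<bar>r x - r' x\<bar> \<partial>M)"
    using r(3) by simp
  also have "\<dots> \<le> of_nat n * (\<integral>\<^sup>+x. ennreal \<bar>r x - r' x\<bar> \<partial>M) + (\<integral>\<^sup>+x. ennreal \<bar>r x - r' x\<bar> \<partial>M)"
    using Suc by (intro add_right_mono) (simp add: A_def A'_def)
  finally show ?case by (simp add: distrib_right add.commute)
qed simp

text \<open>Each factor of the mean of g is realised by one more independent sample point. This is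
  how a polynomial in the normalisation becomes an observable of a larger sampled block.\<close>

lemma integral_PiM_power:
  fixes F :: "(nat \<Rightarrow> 'a) \<Rightarrow> real"
  assumes M: "prob_space M"
    and F: "F \<in> borel_measurable (PiM UNIV (\<lambda>_::nat. M))" "\<And>v. v \<in> space (PiM UNIV (\<lambda>_::nat. M)) \<Longrightarrow> \<bar>F v\<bar> \<le> B"
    and g: "g \<in> borel_measurable M" "\<And>x. x \<in> space M \<Longrightarrow> \<bar>g x\<bar> \<le> B'"
    and dep: "\<And>v v'. v \<in> space (PiM UNIV (\<lambda>_::nat. M)) \<Longrightarrow> v' \<in> space (PiM UNIV (\<lambda>_::nat. M)) \<Longrightarrow>
      (\<And>i. i < n \<Longrightarrow> v i = v' i) \<Longrightarrow> F v = F v'"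
  shows "(\<integral>v. F v * (\<Prod>i<m. g (v (n + i))) \<partial>PiM UNIV (\<lambda>_::nat. M)) = (\<integral>v. F v \<partial>PiM UNIV (\<lambda>_::nat. M)) * (\<integral>x. g x \<partial>M) ^ m"
proof (induction m)
  case (Suc m)
  let ?S = "PiM UNIV (\<lambda>_::nat. M)"
  have "(\<integral>v. F v * (\<Prod>i<Suc m. g (v (n + i))) \<partial>?S) = (\<integral>v. (F v * (\<Prod>i<m. g (v (n + i)))) * g (v (n + m)) \<partial>?S)"
    by (simp add: mult_ac)
  also have "\<dots> = (\<integral>v. F v * (\<Prod>i<m. g (v (n + i))) \<partial>?S) * (\<integral>x. g x \<partial>M)"
  proof (rule integral_PiM_next[OF M _ _ g, where B="B * B' ^ m"])
    show "(\<lambda>v. F v * (\<Prod>i<m. g (v (n + i)))) \<in> borel_measurable ?S"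
      using F g by (intro borel_measurable_times borel_measurable_prod measurable_coordinate_comp UNIV_I)
    show "\<bar>F v * (\<Prod>i<m. g (v (n + i)))\<bar> \<le> B * B' ^ m" if v: "v \<in> space ?S" for v
    proof -
      have "(\<Prod>i<m. \<bar>g (v (n + i))\<bar>) \<le> (\<Prod>i<m. B')"
        using v g by (intro prod_mono) (auto simp: space_PiM PiE_iff)
      then show ?thesis
        using F(2)[OF v] order_trans[OF abs_ge_zero F(2)[OF v]] by (auto simp: abs_mult abs_prod intro!: mult_mono prod_nonneg)
    qed
    fix v v' assume v: "v \<in> space ?S" "v' \<in> space ?S" and eq: "\<And>i. i < n + m \<Longrightarrow> v i = v' i"
    then show "F v * (\<Prod>i<m. g (v (n + i))) = F v' * (\<Prod>i<m. g (v' (n + i)))"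
      using dep[OF v] by simp
  qed
  finally show ?case using Suc by (simp add: mult_ac)
qed simp


section \<open>Tilting a fixed measure\<close>

text \<open>Weierstrass approximation away from the pole. Degree and coefficients are fixed by the
  interval, n and e before any measure or field is chosen.\<close>

lemma reciprocal_power_polynomial:
  fixes \<delta> B e :: real
  assumes \<delta>: "0 < \<delta>" and e: "e > 0"
  obtains \<kappa> :: "nat \<Rightarrow> real" and d :: nat
  where "\<And>x. \<delta> \<le> x \<Longrightarrow> x \<le> B \<Longrightarrow> \<bar>1 / x ^ n - (\<Sum>m\<le>d. \<kappa> m * x ^ m)\<bar> \<le> e"
proof -
  have "continuous_on {\<delta>..B} (\<lambda>x. 1 / x ^ n)" using \<delta> by (intro continuous_intros) auto
  then obtain p where p: "real_polynomial_function p" "\<And>x. x \<in> {\<delta>..B} \<Longrightarrow> \<bar>1 / x ^ n - p x\<bar> < e"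
    using Stone_Weierstrass_real_polynomial_function[of "{\<delta>..B}" "\<lambda>x. 1 / x ^ n" e] e by auto
  obtain \<kappa> d where "p = (\<lambda>x. \<Sum>m\<le>d. \<kappa> m * x ^ m)"
    using p(1) unfolding real_polynomial_function_iff_sum by blast
  then show ?thesis using that[of \<kappa> d] p(2) by (auto intro: less_imp_le)
qed

lemma prod_lessThan_add:
  fixes g :: "nat \<Rightarrow> 'a::comm_monoid_mult"
  shows "(\<Prod>i<n + m. g i) = (\<Prod>i<n. g i) * (\<Prod>i<m. g (n + i))"
  by (induction m) (simp_all add: mult_ac)

context cavity_setting
begin

abbreviation weight :: "'w \<Rightarrow> 'h \<Rightarrow> real" where
  "weight \<equiv> smooth (\<lambda>x. exp (\<psi> x))"

lemma cavity_weight_eq: "cavity_weight \<psi> c (l \<omega>) = weight \<omega>"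
  by (simp add: cavity_weight_def smooth_def residual_sd_def fun_eq_iff)

lemma psi_measurable [measurable]: "\<psi> \<in> borel_measurable borel"
  using psi_cont by (rule borel_measurable_continuous_onI)

lemma exp_psi_integrable: "integrable gauss (\<lambda>z. exp (\<psi> (y + z * s)))"
proof (rule Bochner_Integration.integrable_bound)
  show "integrable gauss (\<lambda>z. exp ((a + L * \<bar>y\<bar>) + (L * \<bar>s\<bar>) * \<bar>z\<bar>))"
    using L_nonneg by (intro integrable_gauss_exp_abs) simp
  have "\<psi> (y + z * s) \<le> (a + L * \<bar>y\<bar>) + (L * \<bar>s\<bar>) * \<bar>z\<bar>" for z
  proof -
    have "\<psi> (y + z * s) \<le> a + L * \<bar>y + z * s\<bar>" using psi_bound[of "y + z * s"] by linarith
    also have "\<dots> \<le> a + L * (\<bar>y\<bar> + \<bar>z\<bar> * \<bar>s\<bar>)"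
      using L_nonneg abs_triangle_ineq[of y "z * s"] by (intro add_left_mono mult_left_mono) (auto simp: abs_mult)
    finally show ?thesis by (simp add: algebra_simps)
  qed
  then show "AE z in gauss. norm (exp (\<psi> (y + z * s))) \<le> norm (exp ((a + L * \<bar>y\<bar>) + (L * \<bar>s\<bar>) * \<bar>z\<bar>))"
    by (intro AE_I2) simp
qed simp

lemma nn_integral_exp_psi_finite:
  assumes "t \<in> {1, -1}"
  shows "(\<integral>\<^sup>+x. ennreal (exp (t * \<psi> x)) \<partial>gauss) = ennreal (\<integral>x. exp (t * \<psi> x) \<partial>gauss)"
proof (rule nn_integral_eq_integral)
  show "integrable gauss (\<lambda>x. exp (t * \<psi> x))"
  proof (rule Bochner_Integration.integrable_bound[OF integrable_gauss_exp_abs[OF L_nonneg, of a]])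
    have "t * \<psi> x \<le> a + L * \<bar>x\<bar>" for x using psi_bound[of x] assms by auto
    then show "AE x in gauss. norm (exp (t * \<psi> x)) \<le> norm (exp (a + L * \<bar>x\<bar>))"
      by (intro AE_I2) simp
  qed simp
qed simp

lemma weight_eq_nn_integral: "ennreal (weight \<omega> v) = (\<integral>\<^sup>+z. ennreal (exp (\<psi> (noisy \<omega> v z))) \<partial>gauss)"
  unfolding smooth_def by (rule nn_integral_eq_integral[symmetric]) (auto intro: exp_psi_integrable)

lemma weight_pos: "0 < weight \<omega> v"
proof (rule ccontr)
  interpret G: prob_space gauss by (rule prob_space_gauss)
  assume "\<not> 0 < weight \<omega> v"
  then have "(\<integral>\<^sup>+z. ennreal (exp (\<psi> (noisy \<omega> v z))) \<partial>gauss) = 0"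
    unfolding weight_eq_nn_integral[symmetric] by (simp add: ennreal_neg)
  then have "AE z in gauss. ennreal (exp (\<psi> (noisy \<omega> v z))) = 0"
    by (subst (asm) nn_integral_0_iff_AE) auto
  then have "AE z in gauss. False" by eventually_elim (simp add: ennreal_eq_0_iff)
  then show False by simp
qed

end

locale cavity_ball_measure = cavity_setting N \<psi> c l a L
  for N :: "'w measure" and \<psi> c :: "real \<Rightarrow> real"
    and l :: "'w \<Rightarrow> 'h::{real_inner, polish_space} \<Rightarrow> real" and a L :: real +
  fixes \<mu> :: "'h measure"
  assumes sets_mu: "sets \<mu> = sets ball_space" and prob_mu: "prob_space \<mu>"
begin

sublocale mu: prob_space \<mu> by (rule prob_mu)

abbreviation samples :: "(nat \<Rightarrow> 'h) measure" where "samples \<equiv> PiM UNIV (\<lambda>_::nat. \<mu>)"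

sublocale samples: prob_space samples by (intro prob_space_PiM prob_mu)

lemma space_mu: "space \<mu> = cball 0 1"
  using sets_eq_imp_space_eq[OF sets_mu] space_ball by simp

lemma space_samples: "v \<in> space samples \<Longrightarrow> v i \<in> cball 0 1"
  using space_mu by (auto simp: space_PiM PiE_iff)

lemma measurable_pair_mu: "measurable (N \<Otimes>\<^sub>M \<mu>) K = measurable (N \<Otimes>\<^sub>M ball_space) K"
  by (intro measurable_cong_sets sets_pair_measure_cong sets_mu refl)

lemma smooth_pair_measurable:
  assumes "g \<in> borel_measurable borel"
  shows "(\<lambda>(\<omega>, v). smooth g \<omega> v) \<in> borel_measurable (N \<Otimes>\<^sub>M \<mu>)"
  unfolding measurable_pair_mu using assms by (rule smooth_measurable)

lemma smooth_section_measurable: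
  assumes "g \<in> borel_measurable borel" "\<omega> \<in> space N"
  shows "smooth g \<omega> \<in> borel_measurable \<mu>"
  using measurable_Pair2[OF smooth_pair_measurable[OF assms(1)] assms(2)] by simp

lemma noisy_nn_integral_measurable:
  fixes g :: "real \<Rightarrow> ennreal"
  assumes g: "g \<in> borel_measurable borel"
  shows "(\<lambda>(\<omega>, v). \<integral>\<^sup>+z. g (noisy \<omega> v z) \<partial>gauss) \<in> borel_measurable (N \<Otimes>\<^sub>M \<mu>)"
proof -
  interpret G: prob_space gauss by (rule prob_space_gauss)
  have "(\<lambda>(p, z). g (noisy (fst p) (snd p) z)) \<in> borel_measurable ((N \<Otimes>\<^sub>M ball_space) \<Otimes>\<^sub>M gauss)"
    using measurable_compose[OF noisy_measurable g] by (simp add: case_prod_beta')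
  then have "(\<lambda>p. \<integral>\<^sup>+z. g (noisy (fst p) (snd p) z) \<partial>gauss) \<in> borel_measurable (N \<Otimes>\<^sub>M ball_space)"
    by (rule G.borel_measurable_nn_integral)
  then show ?thesis unfolding measurable_pair_mu by (simp add: case_prod_beta')
qed

text \<open>Averaging over the field first makes the integrand independent of v, so the whole
  average is one Gaussian integral, the same for every \<open>\<mu>\<close>.\<close>

lemma fubini_noisy:
  fixes g :: "real \<Rightarrow> ennreal"
  assumes g: "g \<in> borel_measurable borel"
  shows "(\<integral>\<^sup>+\<omega>. \<integral>\<^sup>+v. \<integral>\<^sup>+z. g (noisy \<omega> v z) \<partial>gauss \<partial>\<mu> \<partial>N) = (\<integral>\<^sup>+y. g y \<partial>gauss)"
proof -
  interpret P: pair_prob_space N \<mu> ..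
  have "(\<integral>\<^sup>+\<omega>. \<integral>\<^sup>+v. \<integral>\<^sup>+z. g (noisy \<omega> v z) \<partial>gauss \<partial>\<mu> \<partial>N) =
      (\<integral>\<^sup>+v. \<integral>\<^sup>+\<omega>. \<integral>\<^sup>+z. g (noisy \<omega> v z) \<partial>gauss \<partial>N \<partial>\<mu>)"
    by (rule P.Fubini'[symmetric]) (rule noisy_nn_integral_measurable[OF g])
  also have "\<dots> = (\<integral>\<^sup>+v. (\<integral>\<^sup>+y. g y \<partial>gauss) \<partial>\<mu>)"
    using space_mu g by (intro nn_integral_cong nn_integral_noisy) auto
  finally show ?thesis by (simp add: mu.emeasure_space_1)
qed

lemma fubini_section_measurable:
  fixes g :: "real \<Rightarrow> ennreal"
  assumes g: "g \<in> borel_measurable borel"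
  shows "(\<lambda>\<omega>. \<integral>\<^sup>+v. \<integral>\<^sup>+z. g (noisy \<omega> v z) \<partial>gauss \<partial>\<mu>) \<in> borel_measurable N"
  using mu.borel_measurable_nn_integral[OF noisy_nn_integral_measurable[OF g]] by simp

definition total :: "'w \<Rightarrow> real" where "total \<omega> = (\<integral>v. weight \<omega> v \<partial>\<mu>)"

lemma weight_section_measurable: "\<omega> \<in> space N \<Longrightarrow> weight \<omega> \<in> borel_measurable \<mu>"
  by (rule smooth_section_measurable) auto

text \<open>The total weight has a finite mean over the field, so the default branch of
  \<open>cavity_tilt\<close> is taken only on a null set.\<close>

lemma AE_weight_integrable: "AE \<omega> in N. integrable \<mu> (weight \<omega>)"
proof -
  have "(\<integral>\<^sup>+\<omega>. \<integral>\<^sup>+v. ennreal (weight \<omega> v) \<partial>\<mu> \<partial>N) = (\<integral>\<^sup>+y. ennreal (exp (\<psi> y)) \<partial>gauss)"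
    unfolding weight_eq_nn_integral by (rule fubini_noisy) measurable
  also have "\<dots> < \<infinity>" using nn_integral_exp_psi_finite[of 1] by simp
  finally have "AE \<omega> in N. (\<integral>\<^sup>+v. ennreal (weight \<omega> v) \<partial>\<mu>) \<noteq> \<infinity>"
    unfolding weight_eq_nn_integral by (intro nn_integral_PInf_AE fubini_section_measurable) auto
  then show ?thesis
    using AE_space
  proof eventually_elim
    case (elim \<omega>)
    then show ?case
      using weight_section_measurable[of \<omega>] weight_pos[of \<omega>]
      by (intro integrableI_bounded) (auto simp: abs_of_pos less_top)
  qed
qed

lemma total_nn_integral:
  "integrable \<mu> (weight \<omega>) \<Longrightarrow> (\<integral>\<^sup>+v. ennreal (weight \<omega> v) \<partial>\<mu>) = ennreal (total \<omega>)"
  unfolding total_def by (intro nn_integral_eq_integral AE_I2 less_imp_le weight_pos)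

lemma total_pos:
  assumes "integrable \<mu> (weight \<omega>)"
  shows "0 < total \<omega>"
proof (rule ccontr)
  assume "\<not> 0 < total \<omega>"
  then have "(\<integral>\<^sup>+v. ennreal (weight \<omega> v) \<partial>\<mu>) = 0"
    using total_nn_integral[OF assms] by (simp add: ennreal_neg)
  then have "AE v in \<mu>. ennreal (weight \<omega> v) = 0"
    using assms by (subst (asm) nn_integral_0_iff_AE) auto
  then have "AE v in \<mu>. False"
  proof eventually_elim
    case (elim v)
    then show ?case using weight_pos[of \<omega> v] by (simp add: ennreal_eq_0_iff)
  qed
  then show False by simp
qed

text \<open>Jensen's inequality for \<open>1 / x\<close>, from the tangent line at \<open>total \<omega>\<close>.\<close>

lemma inverse_total_le:
  assumes \<omega>: "\<omega> \<in> space N" and int: "integrable \<mu> (weight \<omega>)"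
  shows "ennreal (1 / total \<omega>) \<le> (\<integral>\<^sup>+v. \<integral>\<^sup>+z. ennreal (exp (- \<psi> (noisy \<omega> v z))) \<partial>gauss \<partial>\<mu>)"
proof -
  interpret G: prob_space gauss by (rule prob_space_gauss)
  define t where "t = 1 / total \<omega>"
  have t: "t > 0" using total_pos[OF int] by (simp add: t_def)
  \<comment> \<open>The right-hand side dominates since
    \<open>exp (- y) * (1 - t * exp y)\<^sup>2\<close> is nonnegative; this is the tangent of
    \<open>1 / x\<close> at \<open>1 / t\<close>, evaluated at \<open>exp y\<close>.\<close>
  have tangent: "2 * t \<le> exp (- y) + t\<^sup>2 * exp y" for y
  proof -
    have "0 \<le> exp (- y) * (1 - t * exp y)\<^sup>2" by simp
    also have "\<dots> = exp (- y) - 2 * t * (exp (- y) * exp y) + t\<^sup>2 * ((exp (- y) * exp y) * exp y)"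
      by (simp add: power2_eq_square algebra_simps)
    also have "exp (- y) * exp y = 1" by (simp flip: exp_add)
    finally show ?thesis by simp
  qed
  have m1: "(\<lambda>v. \<integral>\<^sup>+z. ennreal (exp (- \<psi> (noisy \<omega> v z))) \<partial>gauss) \<in> borel_measurable \<mu>"
    using measurable_Pair2[OF noisy_nn_integral_measurable[of "\<lambda>y. ennreal (exp (- \<psi> y))"] \<omega>] by simp
  have "ennreal (2 * t) = (\<integral>\<^sup>+v. \<integral>\<^sup>+z. ennreal (2 * t) \<partial>gauss \<partial>\<mu>)"
    using G.emeasure_space_1 mu.emeasure_space_1 by simp
  also have "\<dots> \<le> (\<integral>\<^sup>+v. \<integral>\<^sup>+z. ennreal (exp (- \<psi> (noisy \<omega> v z))) + ennreal (t\<^sup>2) * ennreal (exp (\<psi> (noisy \<omega> v z))) \<partial>gauss \<partial>\<mu>)"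
    by (intro nn_integral_mono) (simp add: tangent ennreal_leI flip: ennreal_mult ennreal_plus)
  also have "\<dots> = (\<integral>\<^sup>+v. (\<integral>\<^sup>+z. ennreal (exp (- \<psi> (noisy \<omega> v z))) \<partial>gauss) + ennreal (t\<^sup>2) * ennreal (weight \<omega> v) \<partial>\<mu>)"
    unfolding weight_eq_nn_integral
    by (intro nn_integral_cong) (simp add: nn_integral_add nn_integral_cmult)
  also have "\<dots> = (\<integral>\<^sup>+v. \<integral>\<^sup>+z. ennreal (exp (- \<psi> (noisy \<omega> v z))) \<partial>gauss \<partial>\<mu>) + ennreal (t\<^sup>2) * ennreal (total \<omega>)"
    using m1 weight_section_measurable[OF \<omega>]
    by (simp add: nn_integral_add nn_integral_cmult total_nn_integral[OF int])
  also have "ennreal (t\<^sup>2) * ennreal (total \<omega>) = ennreal t"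
    using total_pos[OF int] by (simp add: t_def power2_eq_square flip: ennreal_mult)
  finally have "ennreal t + ennreal t \<le> (\<integral>\<^sup>+v. \<integral>\<^sup>+z. ennreal (exp (- \<psi> (noisy \<omega> v z))) \<partial>gauss \<partial>\<mu>) + ennreal t"
    using t by (simp flip: ennreal_plus)
  then show ?thesis by (simp add: t_def ennreal_add_left_cancel_le add.commute)
qed

lemma cavity_tilt_eq:
  assumes "integrable \<mu> (weight \<omega>)"
  shows "cavity_tilt \<psi> c (l \<omega>) \<mu> = density \<mu> (\<lambda>v. ennreal (weight \<omega> v / total \<omega>))"
  using assms by (simp add: cavity_tilt_def cavity_weight_eq total_def)

lemma normalized_nn_integral:
  fixes w :: "'h \<Rightarrow> real"
  assumes "integrable \<mu> w" "\<And>v. v \<in> space \<mu> \<Longrightarrow> 0 \<le> w v" "0 < (\<integral>v. w v \<partial>\<mu>)"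
  shows "(\<integral>\<^sup>+v. ennreal (w v / (\<integral>v. w v \<partial>\<mu>)) \<partial>\<mu>) = 1"
proof -
  have "(\<integral>\<^sup>+v. ennreal (w v / (\<integral>v. w v \<partial>\<mu>)) \<partial>\<mu>) = ennreal (\<integral>v. w v / (\<integral>v. w v \<partial>\<mu>) \<partial>\<mu>)"
    using assms by (intro nn_integral_eq_integral AE_I2) auto
  then show ?thesis using assms by simp
qed

lemma prob_space_cavity_tilt: "prob_space (cavity_tilt \<psi> c (l \<omega>) \<mu>)"
proof (cases "integrable \<mu> (weight \<omega>)")
  case True
  have "(\<integral>\<^sup>+v. ennreal (weight \<omega> v / total \<omega>) \<partial>\<mu>) = 1"
    unfolding total_def using True total_pos[OF True] weight_pos
    by (intro normalized_nn_integral) (auto simp: total_def less_imp_le)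
  then show ?thesis
    unfolding cavity_tilt_eq[OF True] using True
    by (intro prob_spaceI) (simp add: emeasure_density cong: nn_integral_cong)
next
  case False
  then show ?thesis using prob_mu by (simp add: cavity_tilt_def cavity_weight_eq)
qed

text \<open>After splitting off \<open>(W v - V v) / Z\<close>, the remainder
  \<open>V v * (1 / Z - 1 / Z')\<close> has L1 norm \<open>\<bar>Z' - Z\<bar> / Z\<close>, because
  \<open>V\<close> has integral Z'. Hence only the normalisation of \<open>W\<close> enters the
  bound. For the approximate weight \<open>V\<close>, the lower bound on the normalisation may
  degrade as the accuracy improves.\<close>

lemma normalized_difference:
  fixes W V :: "'h \<Rightarrow> real"
  assumes W: "integrable \<mu> W" and V: "integrable \<mu> V" "\<And>v. v \<in> space \<mu> \<Longrightarrow> 0 \<le> V v"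
    and ZW: "0 < (\<integral>v. W v \<partial>\<mu>)" and ZV: "0 < (\<integral>v. V v \<partial>\<mu>)"
  shows "(\<integral>v. \<bar>W v / (\<integral>v. W v \<partial>\<mu>) - V v / (\<integral>v. V v \<partial>\<mu>)\<bar> \<partial>\<mu>) \<le> 2 * (\<integral>v. \<bar>W v - V v\<bar> \<partial>\<mu>) / (\<integral>v. W v \<partial>\<mu>)"
proof -
  define Z Z' D where "Z = (\<integral>v. W v \<partial>\<mu>)" and "Z' = (\<integral>v. V v \<partial>\<mu>)" and "D = (\<integral>v. \<bar>W v - V v\<bar> \<partial>\<mu>)"
  have pos: "Z > 0" "Z' > 0" using ZW ZV by (auto simp: Z_def Z'_def)
  have "(\<integral>v. \<bar>W v / Z - V v / Z'\<bar> \<partial>\<mu>) \<le> (\<integral>v. \<bar>W v - V v\<bar> / Z + V v * \<bar>1 / Z - 1 / Z'\<bar> \<partial>\<mu>)"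
  proof (rule integral_mono)
    fix v assume v: "v \<in> space \<mu>"
    have "W v / Z - V v / Z' = (W v - V v) / Z + V v * (1 / Z - 1 / Z')"
      by (simp add: diff_divide_distrib right_diff_distrib)
    then have "\<bar>W v / Z - V v / Z'\<bar> \<le> \<bar>(W v - V v) / Z\<bar> + \<bar>V v * (1 / Z - 1 / Z')\<bar>"
      by (simp only: abs_triangle_ineq)
    then show "\<bar>W v / Z - V v / Z'\<bar> \<le> \<bar>W v - V v\<bar> / Z + V v * \<bar>1 / Z - 1 / Z'\<bar>"
      using pos V(2)[OF v] by (simp add: abs_mult abs_divide)
  qed (use W V in auto)
  also have "\<dots> = D / Z + Z' * \<bar>1 / Z - 1 / Z'\<bar>"
    using W V by (simp add: D_def Z'_def)
  also have "Z' * \<bar>1 / Z - 1 / Z'\<bar> = \<bar>Z' - Z\<bar> / Z"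
  proof -
    have "Z' * \<bar>1 / Z - 1 / Z'\<bar> = \<bar>Z' * (1 / Z - 1 / Z')\<bar>" using pos by (simp add: abs_mult)
    also have "Z' * (1 / Z - 1 / Z') = (Z' - Z) / Z" using pos by (simp add: field_simps)
    finally show ?thesis using pos by (simp add: abs_divide)
  qed
  also have "\<bar>Z' - Z\<bar> \<le> D"
  proof -
    have "Z - Z' = (\<integral>v. W v - V v \<partial>\<mu>)" using W V by (simp add: Z_def Z'_def)
    then have "\<bar>Z - Z'\<bar> \<le> D" unfolding D_def by (metis integral_abs_bound)
    then show ?thesis by simp
  qed
  finally show ?thesis using pos by (simp add: Z_def Z'_def D_def divide_right_mono)
qed

text \<open>The first bound is useful where the densities are close; the second holds regardless and
  covers the fields with a small normalisation.\<close>

lemma integral_prod_difference: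
  fixes F :: "(nat \<Rightarrow> 'h) \<Rightarrow> real" and r r' :: "'h \<Rightarrow> real" and n :: nat
  assumes F: "F \<in> borel_measurable samples" "\<And>v. v \<in> space samples \<Longrightarrow> \<bar>F v\<bar> \<le> Bf" and Bf: "0 \<le> Bf"
    and r: "r \<in> borel_measurable \<mu>" "\<And>x. x \<in> space \<mu> \<Longrightarrow> 0 \<le> r x" "(\<integral>\<^sup>+x. ennreal (r x) \<partial>\<mu>) = 1"
    and r': "r' \<in> borel_measurable \<mu>" "\<And>x. x \<in> space \<mu> \<Longrightarrow> 0 \<le> r' x" "(\<integral>\<^sup>+x. ennreal (r' x) \<partial>\<mu>) = 1"
    and int: "integrable \<mu> (\<lambda>x. \<bar>r x - r' x\<bar>)"
  shows "\<bar>(\<integral>v. (\<Prod>i<n. r (v i)) * F v \<partial>samples) - (\<integral>v. (\<Prod>i<n. r' (v i)) * F v \<partial>samples)\<bar> \<le>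
      Bf * (real n * (\<integral>x. \<bar>r x - r' x\<bar> \<partial>\<mu>))"
    and "\<bar>(\<integral>v. (\<Prod>i<n. r (v i)) * F v \<partial>samples) - (\<integral>v. (\<Prod>i<n. r' (v i)) * F v \<partial>samples)\<bar> \<le> 2 * Bf"
proof -
  define A where "A s v = (\<Prod>i<n. s (v i))" for s :: "'h \<Rightarrow> real" and v :: "nat \<Rightarrow> 'h"
  have A: "A s \<in> borel_measurable samples" "\<And>v. v \<in> space samples \<Longrightarrow> 0 \<le> A s v"
    "(\<integral>\<^sup>+v. ennreal (A s v) \<partial>samples) = 1" "integrable samples (\<lambda>v. A s v * F v)"
    if s: "s \<in> borel_measurable \<mu>" "\<And>x. x \<in> space \<mu> \<Longrightarrow> 0 \<le> s x" "(\<integral>\<^sup>+x. ennreal (s x) \<partial>\<mu>) = 1" for s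
  proof -
    show m: "A s \<in> borel_measurable samples"
      unfolding A_def using s by (intro borel_measurable_prod measurable_coordinate_comp UNIV_I)
    show pos: "0 \<le> A s v" if "v \<in> space samples" for v
      unfolding A_def using s that by (intro prod_nonneg) (auto simp: space_PiM PiE_iff)
    show one: "(\<integral>\<^sup>+v. ennreal (A s v) \<partial>samples) = 1"
      unfolding A_def by (rule nn_integral_PiM_prod[OF prob_mu s])
    have "integrable samples (A s)"
      using m pos one by (intro integrableI_nonneg) (auto intro!: AE_I2)
    then have "integrable samples (\<lambda>v. Bf * A s v)" by simp
    then show "integrable samples (\<lambda>v. A s v * F v)"
    proof (rule Bochner_Integration.integrable_bound)
      show "(\<lambda>v. A s v * F v) \<in> borel_measurable samples" using m F by simp
      show "AE v in samples. norm (A s v * F v) \<le> norm (Bf * A s v)"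
      proof (rule AE_I2)
        fix v assume v: "v \<in> space samples"
        have "\<bar>F v\<bar> * A s v \<le> Bf * A s v" using F(2)[OF v] pos[OF v] by (rule mult_right_mono)
        then show "norm (A s v * F v) \<le> norm (Bf * A s v)"
          using pos[OF v] Bf by (simp add: abs_mult mult.commute)
      qed
    qed
  qed
  have "ennreal \<bar>(\<integral>v. A r v * F v \<partial>samples) - (\<integral>v. A r' v * F v \<partial>samples)\<bar> =
      ennreal (norm (\<integral>v. A r v * F v - A r' v * F v \<partial>samples))"
    using A(4)[OF r] A(4)[OF r'] by simp
  also have "\<dots> \<le> (\<integral>\<^sup>+v. ennreal (norm (A r v * F v - A r' v * F v)) \<partial>samples)"
    using A(4)[OF r] A(4)[OF r'] by (intro integral_norm_bound_ennreal) auto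
  also have "\<dots> \<le> (\<integral>\<^sup>+v. ennreal Bf * ennreal \<bar>A r v - A r' v\<bar> \<partial>samples)"
  proof (rule nn_integral_mono)
    fix v assume v: "v \<in> space samples"
    have "\<bar>A r v * F v - A r' v * F v\<bar> = \<bar>F v\<bar> * \<bar>A r v - A r' v\<bar>"
      by (simp add: abs_mult[symmetric] algebra_simps)
    also have "\<dots> \<le> Bf * \<bar>A r v - A r' v\<bar>" using F(2)[OF v] by (intro mult_right_mono) auto
    finally show "ennreal (norm (A r v * F v - A r' v * F v)) \<le> ennreal Bf * ennreal \<bar>A r v - A r' v\<bar>"
      using Bf by (simp add: ennreal_leI flip: ennreal_mult)
  qed
  also have "\<dots> = ennreal Bf * (\<integral>\<^sup>+v. ennreal \<bar>A r v - A r' v\<bar> \<partial>samples)"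
    using A(1)[OF r] A(1)[OF r'] by (intro nn_integral_cmult) auto
  finally have main: "ennreal \<bar>(\<integral>v. A r v * F v \<partial>samples) - (\<integral>v. A r' v * F v \<partial>samples)\<bar> \<le>
      ennreal Bf * (\<integral>\<^sup>+v. ennreal \<bar>A r v - A r' v\<bar> \<partial>samples)" .
  have "(\<integral>\<^sup>+v. ennreal \<bar>A r v - A r' v\<bar> \<partial>samples) \<le> of_nat n * (\<integral>\<^sup>+x. ennreal \<bar>r x - r' x\<bar> \<partial>\<mu>)"
    unfolding A_def by (rule nn_integral_PiM_prod_diff[OF prob_mu r r'])
  also have "\<dots> = ennreal (real n * (\<integral>x. \<bar>r x - r' x\<bar> \<partial>\<mu>))"
    using int by (simp add: nn_integral_eq_integral ennreal_mult ennreal_of_nat_eq_real_of_nat)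
  finally have "ennreal \<bar>(\<integral>v. A r v * F v \<partial>samples) - (\<integral>v. A r' v * F v \<partial>samples)\<bar> \<le>
      ennreal (Bf * (real n * (\<integral>x. \<bar>r x - r' x\<bar> \<partial>\<mu>)))"
    using Bf by (subst ennreal_mult) (auto intro: order_trans[OF main mult_left_mono])
  then show "\<bar>(\<integral>v. (\<Prod>i<n. r (v i)) * F v \<partial>samples) - (\<integral>v. (\<Prod>i<n. r' (v i)) * F v \<partial>samples)\<bar> \<le>
      Bf * (real n * (\<integral>x. \<bar>r x - r' x\<bar> \<partial>\<mu>))"
    using Bf by (simp add: A_def ennreal_le_iff)
  have "(\<integral>\<^sup>+v. ennreal \<bar>A r v - A r' v\<bar> \<partial>samples) \<le> (\<integral>\<^sup>+v. ennreal (A r v) + ennreal (A r' v) \<partial>samples)"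
  proof (rule nn_integral_mono)
    fix v assume v: "v \<in> space samples"
    show "ennreal \<bar>A r v - A r' v\<bar> \<le> ennreal (A r v) + ennreal (A r' v)"
      using A(2)[OF r v] A(2)[OF r' v] by (simp add: ennreal_leI flip: ennreal_plus)
  qed
  also have "\<dots> = 2"
    using A(1)[OF r] A(1)[OF r'] A(3)[OF r] A(3)[OF r'] by (simp add: nn_integral_add)
  finally have "ennreal \<bar>(\<integral>v. A r v * F v \<partial>samples) - (\<integral>v. A r' v * F v \<partial>samples)\<bar> \<le> ennreal Bf * 2"
    by (auto intro: order_trans[OF main mult_left_mono])
  also have "\<dots> = ennreal (2 * Bf)" using Bf by (simp add: ennreal_mult mult.commute)
  finally show "\<bar>(\<integral>v. (\<Prod>i<n. r (v i)) * F v \<partial>samples) - (\<integral>v. (\<Prod>i<n. r' (v i)) * F v \<partial>samples)\<bar> \<le> 2 * Bf"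
    using Bf by (simp add: A_def ennreal_le_iff)
qed

end


context cavity_setting
begin

lemma smooth_bounds:
  assumes T: "T \<in> borel_measurable borel" "\<And>x. \<delta> \<le> T x" "\<And>x. T x \<le> B"
  shows "integrable gauss (\<lambda>z. T (noisy \<omega> v z))" "\<delta> \<le> smooth T \<omega> v" "smooth T \<omega> v \<le> B"
proof -
  interpret G: prob_space gauss by (rule prob_space_gauss)
  note [measurable] = T(1)
  have "\<bar>T x\<bar> \<le> max \<bar>\<delta>\<bar> \<bar>B\<bar>" for x using T(2)[of x] T(3)[of x] by linarith
  then show int: "integrable gauss (\<lambda>z. T (noisy \<omega> v z))"
    by (intro G.integrable_const_bound[where B="max \<bar>\<delta>\<bar> \<bar>B\<bar>"]) auto
  show "\<delta> \<le> smooth T \<omega> v" "smooth T \<omega> v \<le> B"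
    unfolding smooth_def using T by (auto intro!: G.integral_ge_const G.integral_le_const int)
qed

text \<open>Moving the absolute value inside the noise average leaves a function of the noisy field
  alone, to which \<open>fubini_noisy\<close> applies.\<close>

lemma weight_difference:
  assumes T: "T \<in> borel_measurable borel" "\<And>x. \<delta> \<le> T x" "\<And>x. T x \<le> B"
  shows "ennreal \<bar>weight \<omega> v - smooth T \<omega> v\<bar> \<le>
    (\<integral>\<^sup>+z. ennreal \<bar>exp (\<psi> (noisy \<omega> v z)) - T (noisy \<omega> v z)\<bar> \<partial>gauss)"
proof -
  note int = exp_psi_integrable[of "l \<omega> v" "residual_sd v"] smooth_bounds(1)[OF T, of \<omega> v]
  have "weight \<omega> v - smooth T \<omega> v = (\<integral>z. exp (\<psi> (noisy \<omega> v z)) - T (noisy \<omega> v z) \<partial>gauss)"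
    unfolding smooth_def using int by simp
  moreover have "ennreal (norm (\<integral>z. exp (\<psi> (noisy \<omega> v z)) - T (noisy \<omega> v z) \<partial>gauss)) \<le>
      (\<integral>\<^sup>+z. ennreal (norm (exp (\<psi> (noisy \<omega> v z)) - T (noisy \<omega> v z))) \<partial>gauss)"
    using int by (intro integral_norm_bound_ennreal) auto
  ultimately show ?thesis by simp
qed

end

section \<open>Replacing the weight by a smoothed trigonometric polynomial\<close>

context cavity_ball_measure
begin

context
  fixes F :: "(nat \<Rightarrow> 'h) \<Rightarrow> real" and n :: nat and Bf :: real
  assumes F: "F \<in> borel_measurable samples" "\<And>v. v \<in> space samples \<Longrightarrow> \<bar>F v\<bar> \<le> Bf" and Bf: "0 \<le> Bf"
    and dep: "\<And>v v'. v \<in> space samples \<Longrightarrow> v' \<in> space samples \<Longrightarrow>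
      (\<And>i. i < n \<Longrightarrow> v i = v' i) \<Longrightarrow> F v = F v'"
  fixes T :: "real \<Rightarrow> real" and \<delta> B :: real
  assumes T: "T \<in> borel_measurable borel" "\<And>x. \<delta> \<le> T x" "\<And>x. T x \<le> B" and \<delta>: "0 < \<delta>"
begin

lemma smooth_mu:
  assumes \<omega>: "\<omega> \<in> space N"
  shows "integrable \<mu> (smooth T \<omega>)" "\<delta> \<le> (\<integral>v. smooth T \<omega> v \<partial>\<mu>)" "(\<integral>v. smooth T \<omega> v \<partial>\<mu>) \<le> B"
proof -
  have "\<bar>smooth T \<omega> v\<bar> \<le> B" for v
    using smooth_bounds(2,3)[OF T, of \<omega> v] \<delta> by simp
  then show int: "integrable \<mu> (smooth T \<omega>)"
    by (intro mu.integrable_const_bound[where B=B] smooth_section_measurable[OF T(1) \<omega>]) auto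
  show "\<delta> \<le> (\<integral>v. smooth T \<omega> v \<partial>\<mu>)" "(\<integral>v. smooth T \<omega> v \<partial>\<mu>) \<le> B"
    using smooth_bounds(2,3)[OF T] by (auto intro!: mu.integral_ge_const mu.integral_le_const int)
qed

text \<open>Where \<open>\<eta> \<le> total \<omega>\<close>, the L1 distance is divided by
  \<open>\<eta>\<close> only; elsewhere the trivial bound is charged to
  \<open>\<eta> / total \<omega>\<close>, which exceeds 1. The result is linear in \<open>D\<close>
  and in \<open>1 / total \<omega>\<close> separately, and each of them has a controlled
  mean.\<close>

lemma tilt_difference:
  assumes \<omega>: "\<omega> \<in> space N" and good: "integrable \<mu> (weight \<omega>)" and \<eta>: "\<eta> > 0"
  defines "D \<equiv> (\<integral>v. \<bar>weight \<omega> v - smooth T \<omega> v\<bar> \<partial>\<mu>)"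
  shows "\<bar>(\<integral>v. F v \<partial>PiM UNIV (\<lambda>_. cavity_tilt \<psi> c (l \<omega>) \<mu>)) -
      (\<integral>v. (\<Prod>i<n. smooth T \<omega> (v i)) * F v \<partial>samples) / (\<integral>v. smooth T \<omega> v \<partial>\<mu>) ^ n\<bar> \<le>
    2 * Bf * (real n + 1) * (D / \<eta> + \<eta> * (1 / total \<omega>))"
proof -
  define Z where "Z = (\<integral>v. smooth T \<omega> v \<partial>\<mu>)"
  define r where "r v = weight \<omega> v / total \<omega>" for v
  define r' where "r' v = smooth T \<omega> v / Z" for v
  have Z: "Z > 0" using smooth_mu(2)[OF \<omega>] \<delta> by (simp add: Z_def)
  have tot: "total \<omega> > 0" by (rule total_pos[OF good])
  have V_nonneg: "0 \<le> smooth T \<omega> v" for v using smooth_bounds(2)[OF T, of \<omega> v] \<delta> by simp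
  have r: "r \<in> borel_measurable \<mu>" "\<And>x. x \<in> space \<mu> \<Longrightarrow> 0 \<le> r x" "(\<integral>\<^sup>+x. ennreal (r x) \<partial>\<mu>) = 1"
  proof -
    show "r \<in> borel_measurable \<mu>" unfolding r_def using weight_section_measurable[OF \<omega>] by simp
    show "0 \<le> r x" for x unfolding r_def using tot weight_pos[of \<omega> x] by simp
    show "(\<integral>\<^sup>+x. ennreal (r x) \<partial>\<mu>) = 1"
      unfolding r_def total_def using good tot weight_pos
      by (intro normalized_nn_integral) (auto simp: total_def less_imp_le)
  qed
  have r': "r' \<in> borel_measurable \<mu>" "\<And>x. x \<in> space \<mu> \<Longrightarrow> 0 \<le> r' x" "(\<integral>\<^sup>+x. ennreal (r' x) \<partial>\<mu>) = 1"
  proof -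
    show "r' \<in> borel_measurable \<mu>" unfolding r'_def using smooth_section_measurable[OF T(1) \<omega>] by simp
    show "0 \<le> r' x" for x unfolding r'_def using Z V_nonneg by simp
    show "(\<integral>\<^sup>+x. ennreal (r' x) \<partial>\<mu>) = 1"
      unfolding r'_def Z_def using smooth_mu(1)[OF \<omega>] Z V_nonneg
      by (intro normalized_nn_integral) (auto simp: Z_def)
  qed
  have int: "integrable \<mu> (\<lambda>x. \<bar>r x - r' x\<bar>)"
    unfolding r_def r'_def using good smooth_mu(1)[OF \<omega>] by simp
  have rr': "(\<integral>x. \<bar>r x - r' x\<bar> \<partial>\<mu>) \<le> 2 * D / total \<omega>"
    unfolding r_def r'_def D_def Z_def total_def
    using good smooth_mu(1)[OF \<omega>] V_nonneg tot Z
    by (intro normalized_difference) (auto simp: total_def Z_def)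
  have D0: "D \<ge> 0" unfolding D_def by simp
  define X where "X = \<bar>(\<integral>v. (\<Prod>i<n. r (v i)) * F v \<partial>samples) - (\<integral>v. (\<Prod>i<n. r' (v i)) * F v \<partial>samples)\<bar>"
  have X1: "X \<le> Bf * (real n * (2 * D / total \<omega>))"
  proof -
    have "Bf * (real n * (\<integral>x. \<bar>r x - r' x\<bar> \<partial>\<mu>)) \<le> Bf * (real n * (2 * D / total \<omega>))"
      by (intro mult_left_mono rr' Bf of_nat_0_le_iff)
    then show ?thesis
      using integral_prod_difference(1)[OF F Bf r r' int, of n] unfolding X_def by (rule order_trans[rotated])
  qed
  have X2: "X \<le> 2 * Bf"
    unfolding X_def by (rule integral_prod_difference(2)[OF F Bf r r' int])
  have "X \<le> 2 * Bf * (real n + 1) * (D / \<eta> + \<eta> * (1 / total \<omega>))"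
  proof (cases "total \<omega> \<ge> \<eta>")
    case True
    have "D / total \<omega> \<le> D / \<eta>" using True \<eta> D0 tot by (intro divide_left_mono) auto
    also have "\<dots> \<le> D / \<eta> + \<eta> * (1 / total \<omega>)" using \<eta> tot by simp
    finally have "real n * (D / total \<omega>) \<le> (real n + 1) * (D / \<eta> + \<eta> * (1 / total \<omega>))"
      using D0 tot by (intro mult_mono) auto
    then have "2 * Bf * (real n * (D / total \<omega>)) \<le> 2 * Bf * ((real n + 1) * (D / \<eta> + \<eta> * (1 / total \<omega>)))"
      using Bf by (intro mult_left_mono) auto
    moreover have "X \<le> 2 * Bf * (real n * (D / total \<omega>))" using X1 by (simp add: mult_ac)
    ultimately show ?thesis unfolding mult.assoc[of "2 * Bf"] by linarith
  next
    case False
    have "1 \<le> \<eta> * (1 / total \<omega>)" using False tot by simp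
    also have "\<dots> \<le> D / \<eta> + \<eta> * (1 / total \<omega>)" using \<eta> D0 by simp
    finally have "1 * 1 \<le> (real n + 1) * (D / \<eta> + \<eta> * (1 / total \<omega>))"
      by (intro mult_mono) auto
    then have "2 * Bf * 1 \<le> 2 * Bf * ((real n + 1) * (D / \<eta> + \<eta> * (1 / total \<omega>)))"
      using Bf by (intro mult_left_mono) auto
    then show ?thesis using X2 unfolding mult.assoc[of "2 * Bf"] by linarith
  qed
  moreover have "(\<integral>v. F v \<partial>PiM UNIV (\<lambda>_. cavity_tilt \<psi> c (l \<omega>) \<mu>)) = (\<integral>v. (\<Prod>i<n. r (v i)) * F v \<partial>samples)"
    using prob_space_cavity_tilt[of \<omega>] unfolding cavity_tilt_eq[OF good] r_def[symmetric]
    by (intro integral_PiM_density prob_mu r F dep)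
  moreover have "(\<integral>v. (\<Prod>i<n. smooth T \<omega> (v i)) * F v \<partial>samples) / Z ^ n = (\<integral>v. (\<Prod>i<n. r' (v i)) * F v \<partial>samples)"
    by (simp add: r'_def prod_dividef)
  ultimately show ?thesis by (simp add: X_def Z_def)
qed

text \<open>The normalisation lies between \<open>\<delta>\<close> and B, where the polynomial
  approximates. Its m-th power is absorbed by m sample points beyond the n that \<open>F\<close>
  reads, whence the products up to \<open>n + m\<close> with the same \<open>F\<close>.\<close>

lemma polynomial_difference:
  assumes \<omega>: "\<omega> \<in> space N"
    and \<kappa>: "\<And>x. \<delta> \<le> x \<Longrightarrow> x \<le> B \<Longrightarrow> \<bar>1 / x ^ n - (\<Sum>m\<le>d. \<kappa> m * x ^ m)\<bar> \<le> e"
  shows "\<bar>(\<integral>v. (\<Prod>i<n. smooth T \<omega> (v i)) * F v \<partial>samples) / (\<integral>v. smooth T \<omega> v \<partial>\<mu>) ^ n -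
      (\<Sum>m\<le>d. \<kappa> m * (\<integral>v. (\<Prod>i<n + m. smooth T \<omega> (v i)) * F v \<partial>samples))\<bar> \<le> Bf * B ^ n * e"
proof -
  define Z where "Z = (\<integral>v. smooth T \<omega> v \<partial>\<mu>)"
  define G where "G v = (\<Prod>i<n. smooth T \<omega> (v i)) * F v" for v
  have V: "0 \<le> smooth T \<omega> v" "smooth T \<omega> v \<le> B" "\<bar>smooth T \<omega> v\<bar> \<le> B" for v
    using smooth_bounds(2,3)[OF T, of \<omega> v] \<delta> by auto
  have G: "G \<in> borel_measurable samples"
    unfolding G_def
    by (intro borel_measurable_times borel_measurable_prod measurable_coordinate_comp UNIV_I F smooth_section_measurable T \<omega>)
  have GB: "\<bar>G v\<bar> \<le> B ^ n * Bf" if v: "v \<in> space samples" for v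
  proof -
    have "(\<Prod>i<n. smooth T \<omega> (v i)) \<le> (\<Prod>i<n. B)" using V by (intro prod_mono) auto
    moreover have "0 \<le> (\<Prod>i<n. smooth T \<omega> (v i))" using V by (intro prod_nonneg) auto
    ultimately show ?thesis
      using F(2)[OF v] by (auto simp: G_def abs_mult intro!: mult_mono)
  qed
  have "(\<integral>v. (\<Prod>i<n + m. smooth T \<omega> (v i)) * F v \<partial>samples) = (\<integral>v. G v \<partial>samples) * Z ^ m" for m
  proof -
    have "(\<integral>v. (\<Prod>i<n + m. smooth T \<omega> (v i)) * F v \<partial>samples) = (\<integral>v. G v * (\<Prod>i<m. smooth T \<omega> (v (n + i))) \<partial>samples)"
      by (simp add: prod_lessThan_add G_def mult_ac)
    also have "\<dots> = (\<integral>v. G v \<partial>samples) * Z ^ m"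
      unfolding Z_def
    proof (rule integral_PiM_power[OF prob_mu G GB smooth_section_measurable[OF T(1) \<omega>] V(3)])
      fix v v' assume v: "v \<in> space samples" "v' \<in> space samples" "\<And>i. i < n \<Longrightarrow> v i = v' i"
      then show "G v = G v'" using dep[OF v] by (simp add: G_def)
    qed
    finally show ?thesis .
  qed
  then have "(\<integral>v. G v \<partial>samples) / Z ^ n - (\<Sum>m\<le>d. \<kappa> m * (\<integral>v. (\<Prod>i<n + m. smooth T \<omega> (v i)) * F v \<partial>samples)) =
      (\<integral>v. G v \<partial>samples) * (1 / Z ^ n - (\<Sum>m\<le>d. \<kappa> m * Z ^ m))"
    by (simp add: right_diff_distrib sum_distrib_left mult_ac)
  moreover have "\<bar>\<integral>v. G v \<partial>samples\<bar> \<le> B ^ n * Bf"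
  proof -
    have "integrable samples G"
      using G GB by (intro samples.integrable_const_bound[where B="B ^ n * Bf"]) auto
    then have "\<bar>(\<integral>v. G v \<partial>samples) - (\<integral>v. 0 \<partial>samples)\<bar> \<le> B ^ n * Bf"
      using GB by (intro prob_integral_diff_le samples.prob_space_axioms) auto
    then show ?thesis by simp
  qed
  moreover have "\<bar>1 / Z ^ n - (\<Sum>m\<le>d. \<kappa> m * Z ^ m)\<bar> \<le> e"
    unfolding Z_def by (intro \<kappa> smooth_mu \<omega>)
  ultimately have "\<bar>(\<integral>v. G v \<partial>samples) / Z ^ n - (\<Sum>m\<le>d. \<kappa> m * (\<integral>v. (\<Prod>i<n + m. smooth T \<omega> (v i)) * F v \<partial>samples))\<bar> \<le> (B ^ n * Bf) * e"
    by (simp add: abs_mult mult_mono)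
  then show ?thesis by (simp add: G_def Z_def mult_ac)
qed

lemma smooth_samples_measurable:
  "(\<lambda>(\<omega>, v). (\<Prod>i<k. smooth T \<omega> (v i)) * F v) \<in> borel_measurable (N \<Otimes>\<^sub>M samples)"
proof -
  have "(\<lambda>p. smooth T (fst p) (snd p i)) \<in> borel_measurable (N \<Otimes>\<^sub>M samples)" for i
  proof -
    have "(\<lambda>p. (fst p, snd p i)) \<in> measurable (N \<Otimes>\<^sub>M samples) (N \<Otimes>\<^sub>M \<mu>)"
      by (intro measurable_Pair measurable_fst measurable_compose[OF measurable_snd] measurable_component_singleton UNIV_I)
    from measurable_compose[OF this smooth_pair_measurable[OF T(1)]] show ?thesis by simp
  qed
  then show ?thesis
    unfolding case_prod_beta'
    by (intro borel_measurable_times borel_measurable_prod measurable_compose[OF measurable_snd F(1)])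
qed

lemma smooth_samples_bound:
  assumes "v \<in> space samples"
  shows "\<bar>(\<Prod>i<k. smooth T \<omega> (v i)) * F v\<bar> \<le> B ^ k * Bf"
proof -
  have V: "0 \<le> smooth T \<omega> v" "smooth T \<omega> v \<le> B" for v
    using smooth_bounds(2,3)[OF T, of \<omega> v] \<delta> by auto
  have "(\<Prod>i<k. smooth T \<omega> (v i)) \<le> (\<Prod>i<k. B)" using V by (intro prod_mono) auto
  moreover have "0 \<le> (\<Prod>i<k. smooth T \<omega> (v i))" using V by (intro prod_nonneg) auto
  ultimately show ?thesis using F(2)[OF assms] by (auto simp: abs_mult intro!: mult_mono)
qed

text \<open>Boundedness of \<open>T\<close> and \<open>F\<close> permits averaging over the field
  first, with the sample points fixed; the outcome depends on \<open>T\<close> through overlaps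
  only.\<close>

lemma expectation_smooth_samples:
  assumes xs: "\<And>x. complex_of_real (T x) = trig_sum xs x"
  shows "(\<integral>\<omega>. (\<integral>v. (\<Prod>i<k. smooth T \<omega> (v i)) * F v \<partial>samples) \<partial>N) =
      (\<integral>v. trig_moment xs k (sampled_matrix v) * F v \<partial>samples)"
    "integrable N (\<lambda>\<omega>. \<integral>v. (\<Prod>i<k. smooth T \<omega> (v i)) * F v \<partial>samples)"
    "integrable samples (\<lambda>v. trig_moment xs k (sampled_matrix v) * F v)"
proof -
  interpret P: pair_prob_space N samples ..
  have int: "integrable (N \<Otimes>\<^sub>M samples) (\<lambda>(\<omega>, v). (\<Prod>i<k. smooth T \<omega> (v i)) * F v)"
    using smooth_samples_bound
    by (intro P.integrable_const_bound[where B="B ^ k * Bf"] smooth_samples_measurable)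
      (auto simp: space_pair_measure)
  have inner: "(\<integral>\<omega>. (\<Prod>i<k. smooth T \<omega> (v i)) * F v \<partial>N) = trig_moment xs k (sampled_matrix v) * F v"
    if "v \<in> space samples" for v
    using expectation_prod_smooth_trig[where n=k, OF xs space_samples[OF that]] by simp
  show "integrable N (\<lambda>\<omega>. \<integral>v. (\<Prod>i<k. smooth T \<omega> (v i)) * F v \<partial>samples)"
    by (rule P.integrable_fst[OF int])
  have "integrable samples (\<lambda>v. \<integral>\<omega>. (\<Prod>i<k. smooth T \<omega> (v i)) * F v \<partial>N)"
    by (rule P.integrable_snd[OF int])
  moreover have "integrable samples (\<lambda>v. \<integral>\<omega>. (\<Prod>i<k. smooth T \<omega> (v i)) * F v \<partial>N) \<longleftrightarrow>
      integrable samples (\<lambda>v. trig_moment xs k (sampled_matrix v) * F v)"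
    by (intro Bochner_Integration.integrable_cong refl inner)
  ultimately show "integrable samples (\<lambda>v. trig_moment xs k (sampled_matrix v) * F v)" by blast
  have "(\<integral>\<omega>. (\<integral>v. (\<Prod>i<k. smooth T \<omega> (v i)) * F v \<partial>samples) \<partial>N) =
      (\<integral>v. (\<integral>\<omega>. (\<Prod>i<k. smooth T \<omega> (v i)) * F v \<partial>N) \<partial>samples)"
    by (rule P.Fubini_integral[OF int, symmetric])
  also have "\<dots> = (\<integral>v. trig_moment xs k (sampled_matrix v) * F v \<partial>samples)"
    by (intro Bochner_Integration.integral_cong refl inner)
  finally show "(\<integral>\<omega>. (\<integral>v. (\<Prod>i<k. smooth T \<omega> (v i)) * F v \<partial>samples) \<partial>N) =
      (\<integral>v. trig_moment xs k (sampled_matrix v) * F v \<partial>samples)" .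
qed

text \<open>The error bound does not involve \<open>\<mu>\<close>, because the pointwise errors
  average to Gaussian integrals. \<open>A_int\<close> is a hypothesis here since measurability in
  the field follows from the joint measurability of the tilt, which is established
  afterwards.\<close>

lemma tilted_expectation_approximation:
  assumes xs: "\<And>x. complex_of_real (T x) = trig_sum xs x" and \<eta>: "\<eta> > 0"
    and \<kappa>: "\<And>x. \<delta> \<le> x \<Longrightarrow> x \<le> B \<Longrightarrow> \<bar>1 / x ^ n - (\<Sum>m\<le>d. \<kappa> m * x ^ m)\<bar> \<le> e"
    and A_int: "integrable N (\<lambda>\<omega>. \<integral>v. F v \<partial>PiM UNIV (\<lambda>_. cavity_tilt \<psi> c (l \<omega>) \<mu>))"
    and T_int: "integrable gauss (\<lambda>x. \<bar>exp (\<psi> x) - T x\<bar>)"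
  shows "\<bar>(\<integral>\<omega>. (\<integral>v. F v \<partial>PiM UNIV (\<lambda>_. cavity_tilt \<psi> c (l \<omega>) \<mu>)) \<partial>N) -
      (\<integral>v. (\<Sum>m\<le>d. \<kappa> m * trig_moment xs (n + m) (sampled_matrix v)) * F v \<partial>samples)\<bar> \<le>
    2 * Bf * (real n + 1) * ((\<integral>x. \<bar>exp (\<psi> x) - T x\<bar> \<partial>gauss) / \<eta> + \<eta> * (\<integral>x. exp (- \<psi> x) \<partial>gauss)) + Bf * B ^ n * e"
proof -
  define A where "A \<omega> = (\<integral>v. F v \<partial>PiM UNIV (\<lambda>_::nat. cavity_tilt \<psi> c (l \<omega>) \<mu>))" for \<omega>
  define Q where "Q \<omega> = (\<Sum>m\<le>d. \<kappa> m * (\<integral>v. (\<Prod>i<n + m. smooth T \<omega> (v i)) * F v \<partial>samples))" for \<omega>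
  define K where "K = 2 * Bf * (real n + 1)"
  define E1 where "E1 = (\<integral>x. \<bar>exp (\<psi> x) - T x\<bar> \<partial>gauss)"
  define C1 where "C1 = (\<integral>x. exp (- \<psi> x) \<partial>gauss)"
  define X1 where "X1 \<omega> = (\<integral>\<^sup>+v. \<integral>\<^sup>+z. ennreal \<bar>exp (\<psi> (noisy \<omega> v z)) - T (noisy \<omega> v z)\<bar> \<partial>gauss \<partial>\<mu>)" for \<omega>
  define X2 where "X2 \<omega> = (\<integral>\<^sup>+v. \<integral>\<^sup>+z. ennreal (exp (- \<psi> (noisy \<omega> v z))) \<partial>gauss \<partial>\<mu>)" for \<omega>
  note [measurable] = T(1)
  have K: "K \<ge> 0" using Bf by (simp add: K_def)
  have B0: "0 \<le> B" using T(2,3)[of 0] \<delta> by linarith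
  \<comment> \<open>The interval from \<open>\<delta>\<close> to B contains \<open>\<delta>\<close>,
    where an absolute value is bounded by e.\<close>
  have e: "0 \<le> e"
    using \<kappa>[of \<delta>] T(2,3)[of 0] by (meson abs_ge_zero order_refl order_trans)
  have E10: "E1 \<ge> 0" and C10: "C1 \<ge> 0" unfolding E1_def C1_def by simp_all
  have X_meas [measurable]: "X1 \<in> borel_measurable N" "X2 \<in> borel_measurable N"
    unfolding X1_def X2_def by (rule fubini_section_measurable; measurable)+
  have X1: "(\<integral>\<^sup>+\<omega>. X1 \<omega> \<partial>N) = ennreal E1"
    unfolding X1_def E1_def
    by (subst fubini_noisy[of "\<lambda>x. ennreal \<bar>exp (\<psi> x) - T x\<bar>"]) (auto intro!: nn_integral_eq_integral T_int)
  have X2: "(\<integral>\<^sup>+\<omega>. X2 \<omega> \<partial>N) = ennreal C1"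
    unfolding X2_def C1_def
    using nn_integral_exp_psi_finite[of "-1"] by (subst fubini_noisy[of "\<lambda>x. ennreal (exp (- \<psi> x))"]) auto
  have Q_int: "integrable N Q"
    unfolding Q_def by (intro Bochner_Integration.integrable_sum integrable_mult_right expectation_smooth_samples[OF xs])
  \<comment> \<open>Stated in the extended nonnegative reals because \<open>X1\<close> and
    \<open>X2\<close> may be infinite for single fields; only their means are known to be
    finite.\<close>
  have pw: "AE \<omega> in N. ennreal \<bar>A \<omega> - Q \<omega>\<bar> \<le>
      ennreal (K / \<eta>) * X1 \<omega> + ennreal (K * \<eta>) * X2 \<omega> + ennreal (Bf * B ^ n * e)"
    using AE_weight_integrable AE_space
  proof eventually_elim
    case (elim \<omega>)
    define D where "D = (\<integral>v. \<bar>weight \<omega> v - smooth T \<omega> v\<bar> \<partial>\<mu>)"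
    have D0: "D \<ge> 0" by (simp add: D_def)
    have D: "ennreal D \<le> X1 \<omega>"
    proof -
      have "ennreal D = (\<integral>\<^sup>+v. ennreal \<bar>weight \<omega> v - smooth T \<omega> v\<bar> \<partial>\<mu>)"
        unfolding D_def using elim smooth_mu(1)[of \<omega>] by (intro nn_integral_eq_integral[symmetric]) auto
      also have "\<dots> \<le> X1 \<omega>"
        unfolding X1_def by (intro nn_integral_mono weight_difference[OF T])
      finally show ?thesis .
    qed
    have tot: "0 < total \<omega>" using elim by (intro total_pos)
    have Z: "ennreal (1 / total \<omega>) \<le> X2 \<omega>"
      unfolding X2_def using elim by (intro inverse_total_le)
    have "\<bar>A \<omega> - Q \<omega>\<bar> \<le> K * (D / \<eta> + \<eta> * (1 / total \<omega>)) + Bf * B ^ n * e"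
      using tilt_difference[OF elim(2,1) \<eta>] polynomial_difference[where d=d and \<kappa>=\<kappa> and e=e, OF elim(2) \<kappa>]
      unfolding A_def Q_def K_def D_def by linarith
    then have "ennreal \<bar>A \<omega> - Q \<omega>\<bar> \<le> ennreal ((K / \<eta>) * D + (K * \<eta>) * (1 / total \<omega>) + Bf * B ^ n * e)"
      by (intro ennreal_leI) (simp add: algebra_simps)
    also have "\<dots> = ennreal (K / \<eta>) * ennreal D + ennreal (K * \<eta>) * ennreal (1 / total \<omega>) + ennreal (Bf * B ^ n * e)"
      using K \<eta> D0 tot Bf B0 e
      by (subst ennreal_plus, simp, simp, subst ennreal_plus, simp, simp, subst ennreal_mult, simp, simp, subst ennreal_mult) auto
    also have "\<dots> \<le> ennreal (K / \<eta>) * X1 \<omega> + ennreal (K * \<eta>) * X2 \<omega> + ennreal (Bf * B ^ n * e)"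
      using D Z by (intro add_mono mult_left_mono) auto
    finally show ?case .
  qed
  have "ennreal (norm (\<integral>\<omega>. A \<omega> - Q \<omega> \<partial>N)) \<le> (\<integral>\<^sup>+\<omega>. ennreal (norm (A \<omega> - Q \<omega>)) \<partial>N)"
    using A_int Q_int unfolding A_def by (intro integral_norm_bound_ennreal Bochner_Integration.integrable_diff)
  also have "\<dots> \<le> (\<integral>\<^sup>+\<omega>. ennreal (K / \<eta>) * X1 \<omega> + ennreal (K * \<eta>) * X2 \<omega> + ennreal (Bf * B ^ n * e) \<partial>N)"
    using pw by (intro nn_integral_mono_AE) simp
  also have "\<dots> = ennreal (K / \<eta>) * ennreal E1 + ennreal (K * \<eta>) * ennreal C1 + ennreal (Bf * B ^ n * e)"
    by (simp add: nn_integral_add nn_integral_cmult X1 X2 emeasure_space_1)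
  also have "\<dots> = ennreal (K * (E1 / \<eta> + \<eta> * C1) + Bf * B ^ n * e)"
    using K \<eta> E10 C10 Bf B0 e by (simp add: distrib_left mult_ac flip: ennreal_mult ennreal_plus)
  finally have le: "ennreal (norm (\<integral>\<omega>. A \<omega> - Q \<omega> \<partial>N)) \<le> ennreal (K * (E1 / \<eta> + \<eta> * C1) + Bf * B ^ n * e)" .
  have "0 \<le> K * (E1 / \<eta> + \<eta> * C1) + Bf * B ^ n * e" using K \<eta> E10 C10 Bf B0 e by simp
  from le[unfolded ennreal_le_iff[OF this]]
  have "\<bar>\<integral>\<omega>. A \<omega> - Q \<omega> \<partial>N\<bar> \<le> K * (E1 / \<eta> + \<eta> * C1) + Bf * B ^ n * e" by simp
  moreover have "(\<integral>\<omega>. A \<omega> - Q \<omega> \<partial>N) = (\<integral>\<omega>. A \<omega> \<partial>N) - (\<integral>\<omega>. Q \<omega> \<partial>N)"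
    using A_int Q_int unfolding A_def by (rule Bochner_Integration.integral_diff)
  moreover have "(\<integral>\<omega>. Q \<omega> \<partial>N) =
      (\<integral>v. (\<Sum>m\<le>d. \<kappa> m * trig_moment xs (n + m) (sampled_matrix v)) * F v \<partial>samples)"
  proof -
    have "(\<integral>\<omega>. Q \<omega> \<partial>N) = (\<Sum>m\<le>d. \<kappa> m * (\<integral>v. trig_moment xs (n + m) (sampled_matrix v) * F v \<partial>samples))"
      unfolding Q_def
      by (subst Bochner_Integration.integral_sum) (auto intro!: expectation_smooth_samples[OF xs] simp: expectation_smooth_samples(1)[OF xs])
    also have "\<dots> = (\<integral>v. (\<Sum>m\<le>d. \<kappa> m * (trig_moment xs (n + m) (sampled_matrix v) * F v)) \<partial>samples)"
      by (subst Bochner_Integration.integral_sum) (auto intro!: expectation_smooth_samples[OF xs])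
    finally show ?thesis by (simp add: sum_distrib_right mult.assoc)
  qed
  ultimately show ?thesis by (simp add: A_def K_def E1_def C1_def)
qed

end

end


section \<open>Continuity of the cavity mapping\<close>

lemma measurable_integral_samples:
  fixes f :: "_ \<Rightarrow> real"
  assumes f: "f \<in> borel_measurable overlap_space"
  shows "(\<lambda>\<mu>. \<integral>v. f (sampled_matrix v) \<partial>PiM UNIV (\<lambda>_::nat. \<mu>)) \<in>
    borel_measurable (prob_algebra (ball_space :: 'h::{real_inner, second_countable_topology} measure))"
proof -
  have "(\<lambda>\<mu>. integral\<^sup>L (sampled_law \<mu>) f) \<in> borel_measurable (prob_algebra (ball_space :: 'h measure))"
    by (rule measurable_compose[OF measurable_prob_algebraD[OF measurable_sampled_law] integral_measurable_subprob_algebra[OF f]])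
  then show ?thesis
    by (subst (asm) measurable_cong[OF integral_sampled_law(2)[OF _ f]])
qed

lemma integral_samples_bound:
  fixes f :: "_ \<Rightarrow> real" and \<mu> :: "'h::{real_inner, second_countable_topology} measure"
  assumes \<mu>: "\<mu> \<in> space (prob_algebra ball_space)" and f: "continuous_on overlap_matrices f"
    and B: "\<And>q. q \<in> overlap_matrices \<Longrightarrow> \<bar>f q\<bar> \<le> B"
  shows "\<bar>\<integral>v. f (sampled_matrix v) \<partial>PiM UNIV (\<lambda>_::nat. \<mu>)\<bar> \<le> B"
proof -
  have P: "sampled_law \<mu> \<in> space (prob_algebra overlap_space)"
    by (rule measurable_space[OF measurable_sampled_law \<mu>])
  then have "prob_space (sampled_law \<mu>)" "space (sampled_law \<mu>) = overlap_matrices"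
    by (auto simp: space_prob_algebra dest: sets_eq_imp_space_eq)
  then have "\<bar>integral\<^sup>L (sampled_law \<mu>) f - (\<integral>q. 0 \<partial>sampled_law \<mu>)\<bar> \<le> B"
    using B by (intro prob_integral_diff_le prob_overlap_integrable P f) auto
  then show ?thesis
    by (simp add: integral_sampled_law(2)[OF \<mu> continuous_borel_measurable_overlap[OF f]])
qed

section \<open>Measurability of the tilt and uniform approximation\<close>

context cavity_setting
begin

lemma ball_measure: "\<mu> \<in> space (prob_algebra ball_space) \<Longrightarrow> cavity_ball_measure N \<psi> c l a L \<mu>"
  by (intro cavity_ball_measure.intro cavity_setting_axioms cavity_ball_measure_axioms.intro)
    (auto simp: space_prob_algebra)

text \<open>Integrability of the weight is rewritten as finiteness of the nonnegative integral
  \<open>I\<close>, which is jointly measurable in measure and field; the normalisation is then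
  \<open>enn2real (I x)\<close>.\<close>

lemma measurable_cavity_tilt:
  "(\<lambda>(\<mu>, \<omega>). cavity_tilt \<psi> c (l \<omega>) \<mu>) \<in> measurable (prob_algebra ball_space \<Otimes>\<^sub>M N) (prob_algebra ball_space)"
proof -
  let ?X = "prob_algebra (ball_space :: 'h measure) \<Otimes>\<^sub>M N"
  define I where "I x = (\<integral>\<^sup>+v. ennreal (weight (snd x) v) \<partial>fst x)" for x :: "'h measure \<times> 'w"
  define t where "t x = cavity_tilt \<psi> c (l (snd x)) (fst x)" for x :: "'h measure \<times> 'w"
  have fst: "fst \<in> measurable ?X (subprob_algebra ball_space)"
    by (intro measurable_prob_algebraD measurable_fst)
  have wm: "(\<lambda>(x, v). weight (snd x) v) \<in> borel_measurable (?X \<Otimes>\<^sub>M ball_space)"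
  proof -
    have "(\<lambda>p. (snd (fst p), snd p)) \<in> measurable (?X \<Otimes>\<^sub>M ball_space) (N \<Otimes>\<^sub>M ball_space)"
      by (intro measurable_Pair measurable_compose[OF measurable_fst measurable_snd] measurable_snd)
    from measurable_compose[OF this smooth_measurable[of "\<lambda>x. exp (\<psi> x)"]] show ?thesis
      by (simp add: case_prod_beta')
  qed
  have Im: "I \<in> borel_measurable ?X"
    unfolding I_def
    by (rule nn_integral_measurable_subprob_algebra2[OF _ fst])
      (use measurable_compose[OF wm measurable_ennreal] in \<open>simp add: case_prod_beta'\<close>)
  have X: "cavity_ball_measure N \<psi> c l a L (fst x)" "snd x \<in> space N" "sets (fst x) = sets ball_space"
    if "x \<in> space ?X" for x
  proof -
    have x: "fst x \<in> space (prob_algebra ball_space)" "snd x \<in> space N"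
      using that by (auto simp: space_pair_measure)
    show "cavity_ball_measure N \<psi> c l a L (fst x)" "snd x \<in> space N" "sets (fst x) = sets ball_space"
      using x ball_measure[OF x(1)] by (simp_all add: space_prob_algebra)
  qed
  have t_eq: "t x = (if I x < \<infinity> then density (fst x) (\<lambda>v. ennreal (weight (snd x) v / enn2real (I x))) else fst x)"
    if x: "x \<in> space ?X" for x
  proof -
    interpret cavity_ball_measure N \<psi> c l a L "fst x" by (rule X(1)[OF x])
    have iff: "integrable (fst x) (weight (snd x)) \<longleftrightarrow> I x < \<infinity>"
      using weight_section_measurable[OF X(2)[OF x]] weight_pos[of "snd x"]
      by (simp add: integrable_iff_bounded I_def abs_of_pos)
    have "enn2real (I x) = (\<integral>v. weight (snd x) v \<partial>fst x)" if "integrable (fst x) (weight (snd x))"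
      unfolding I_def using weight_pos
      by (subst integral_eq_nn_integral) (use that in \<open>auto simp: less_imp_le\<close>)
    then show ?thesis
      by (simp add: t_def cavity_tilt_def cavity_weight_eq iff)
  qed
  have "t \<in> measurable ?X (prob_algebra ball_space)"
  proof (intro measurable_prob_algebraI measurable_subprob_algebra)
    show prob: "prob_space (t x)" if "x \<in> space ?X" for x
      unfolding t_def by (rule cavity_ball_measure.prob_space_cavity_tilt[OF X(1)[OF that]])
    then show "subprob_space (t x)" if "x \<in> space ?X" for x
      using that by (intro prob_space_imp_subprob_space)
    show "sets (t x) = sets ball_space" if "x \<in> space ?X" for x
      using X(3)[OF that] by (simp add: t_eq[OF that])
    fix A :: "'h set" assume A: "A \<in> sets ball_space"
    have "emeasure (t x) A = (if I x < \<infinity> then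
        \<integral>\<^sup>+v. ennreal (weight (snd x) v / enn2real (I x)) * indicator A v \<partial>fst x else emeasure (fst x) A)"
      if x: "x \<in> space ?X" for x
    proof -
      interpret cavity_ball_measure N \<psi> c l a L "fst x" by (rule X(1)[OF x])
      have [measurable]: "weight (snd x) \<in> borel_measurable (fst x)"
        by (rule weight_section_measurable[OF X(2)[OF x]])
      show ?thesis using A X(3)[OF x] by (simp add: t_eq[OF x] emeasure_density)
    qed
    moreover have "(\<lambda>x. if I x < \<infinity> then
        \<integral>\<^sup>+v. ennreal (weight (snd x) v / enn2real (I x)) * indicator A v \<partial>fst x else emeasure (fst x) A)
        \<in> borel_measurable ?X"
    proof (rule measurable_If)
      show "(\<lambda>x. \<integral>\<^sup>+v. ennreal (weight (snd x) v / enn2real (I x)) * indicator A v \<partial>fst x) \<in> borel_measurable ?X"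
      proof (rule nn_integral_measurable_subprob_algebra2[OF _ fst])
        have wm': "(\<lambda>p. weight (snd (fst p)) (snd p)) \<in> borel_measurable (?X \<Otimes>\<^sub>M ball_space)"
          using wm by (simp add: case_prod_beta')
        have Im': "(\<lambda>p. I (fst p)) \<in> borel_measurable (?X \<Otimes>\<^sub>M ball_space)"
          by (rule measurable_compose[OF measurable_fst Im])
        have Am: "(\<lambda>p. indicator A (snd p) :: ennreal) \<in> borel_measurable (?X \<Otimes>\<^sub>M ball_space)"
          by (rule measurable_compose[OF measurable_snd borel_measurable_indicator[OF A]])
        show "(\<lambda>(x, v). ennreal (weight (snd x) v / enn2real (I x)) * indicator A v) \<in> borel_measurable (?X \<Otimes>\<^sub>M ball_space)"
          unfolding case_prod_beta'
          by (intro borel_measurable_times_ennreal Am measurable_compose[OF _ measurable_ennreal]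
              borel_measurable_divide wm' borel_measurable_enn2real Im')
      qed
      show "(\<lambda>x. emeasure (fst x) A) \<in> borel_measurable ?X"
        by (rule measurable_compose[OF fst measurable_emeasure_subprob_algebra[OF A]])
      show "{x \<in> space ?X. I x < \<infinity>} \<in> sets ?X" using Im by measurable
    qed
    ultimately show "(\<lambda>x. emeasure (t x) A) \<in> borel_measurable ?X"
      by (simp cong: measurable_cong)
  qed
  then show ?thesis by (simp add: t_def[abs_def] case_prod_beta')
qed

lemma cavity_sampling_law_facts:
  assumes M: "M \<in> space (prob_algebra (prob_algebra ball_space))"
  shows "(\<lambda>(\<mu>, \<omega>). cavity_tilt \<psi> c (l \<omega>) \<mu>) \<in> measurable (M \<Otimes>\<^sub>M N) (prob_algebra ball_space)"
    and "cavity_sampling_law \<psi> c N l M \<in> space (prob_algebra (prob_algebra ball_space))"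
proof -
  have sets: "sets M = sets (prob_algebra ball_space)" and prob: "prob_space M"
    using M by (auto simp: space_prob_algebra)
  have sets2: "sets (M \<Otimes>\<^sub>M N) = sets (prob_algebra ball_space \<Otimes>\<^sub>M N)"
    by (intro sets_pair_measure_cong sets refl)
  show m: "(\<lambda>(\<mu>, \<omega>). cavity_tilt \<psi> c (l \<omega>) \<mu>) \<in> measurable (M \<Otimes>\<^sub>M N) (prob_algebra ball_space)"
    using measurable_cavity_tilt measurable_cong_sets[OF sets2 refl] by blast
  interpret P: prob_space "M \<Otimes>\<^sub>M N" by (intro prob_space_pair prob prob_space_axioms)
  show "cavity_sampling_law \<psi> c N l M \<in> space (prob_algebra (prob_algebra ball_space))"
    unfolding cavity_sampling_law_def space_prob_algebra[of "prob_algebra ball_space"]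
    using P.prob_space_distr[OF m] by simp
qed

lemma cavity_approximation:
  assumes f: "cylinder_function f n" and \<epsilon>: "\<epsilon> > 0"
  obtains h where "continuous_on overlap_matrices h"
    "\<And>M. M \<in> space (prob_algebra (prob_algebra ball_space)) \<Longrightarrow>
      \<bar>(\<integral>q. f q \<partial>rost_of (cavity_sampling_law \<psi> c N l M)) - (\<integral>q. h q \<partial>rost_of M)\<bar> \<le> \<epsilon>"
proof -
  note f_cont = cylinder_functionD(1)[OF f]
  note f_meas = continuous_borel_measurable_overlap[OF f_cont]
  obtain Bf where Bf: "Bf > 0" "\<And>q. q \<in> overlap_matrices \<Longrightarrow> \<bar>f q\<bar> \<le> Bf"
    using continuous_overlap_bounded[OF f_cont] by blast
  define C1 where "C1 = (\<integral>x. exp (- \<psi> x) \<partial>gauss)"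
  define K where "K = 2 * Bf * (real n + 1)"
  \<comment> \<open>The constants follow their dependence: \<open>\<eta>\<close> makes the term with
    \<open>1 / total\<close> small, \<open>\<epsilon>1\<close> is the accuracy of \<open>T\<close>
    needed relative to \<open>\<eta>\<close>, and e is chosen after \<open>T\<close> because B comes
    with \<open>T\<close>. The added 1 keeps the denominator positive even where only
    \<open>0 \<le> C1\<close> is known.\<close>
  define \<eta> where "\<eta> = \<epsilon> / (3 * (K * C1 + 1))"
  define \<epsilon>1 where "\<epsilon>1 = \<epsilon> * \<eta> / (3 * K)"
  have C1: "C1 \<ge> 0" by (simp add: C1_def)
  have K: "K > 0" using Bf by (simp add: K_def)
  have KC: "0 \<le> K * C1" using K C1 by simp
  have \<eta>: "\<eta> > 0" using \<epsilon> KC by (simp add: \<eta>_def)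
  have \<epsilon>1: "\<epsilon>1 > 0" using \<epsilon> \<eta> K by (simp add: \<epsilon>1_def)
  obtain T \<delta> B where T: "trig_polynomial T" and \<delta>: "0 < \<delta>" and T_ge: "\<And>x. \<delta> \<le> T x" and T_le: "\<And>x. T x \<le> B"
      and T_approx: "(\<integral>x. \<bar>exp (\<psi> x) - T x\<bar> \<partial>gauss) \<le> \<epsilon>1"
    using trig_approximation_of_exp[OF psi_cont psi_bound L_nonneg \<epsilon>1] by blast
  obtain xs where xs: "\<And>x. complex_of_real (T x) = trig_sum xs x" using T by (auto simp: trig_polynomial_def)
  have Tm: "T \<in> borel_measurable borel" by (rule trig_polynomial_measurable[OF T])
  have T_int: "integrable gauss (\<lambda>x. \<bar>exp (\<psi> x) - T x\<bar>)"
  proof -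
    interpret G: prob_space gauss by (rule prob_space_gauss)
    have "\<bar>T x\<bar> \<le> B" for x using T_ge[of x] T_le[of x] \<delta> by simp
    then have "integrable gauss T" using Tm by (intro G.integrable_const_bound[where B=B]) auto
    then show ?thesis using exp_psi_integrable[of 0 1] by simp
  qed
  have B: "B > 0" using T_ge[of 0] T_le[of 0] \<delta> by linarith
  define e where "e = \<epsilon> / (3 * (Bf * B ^ n))"
  have e: "e > 0" using \<epsilon> Bf B by (simp add: e_def)
  obtain \<kappa> d where \<kappa>: "\<And>x. \<delta> \<le> x \<Longrightarrow> x \<le> B \<Longrightarrow> \<bar>1 / x ^ n - (\<Sum>m\<le>d. \<kappa> m * x ^ m)\<bar> \<le> e"
    using reciprocal_power_polynomial[OF \<delta> e] by metis
  \<comment> \<open>\<open>h\<close> is fixed before any \<open>M\<close> and reads the block of the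
    first \<open>n + d\<close> indices.\<close>
  define h where "h q = (\<Sum>m\<le>d. \<kappa> m * trig_moment xs (n + m) q) * f q" for q
  have h: "continuous_on overlap_matrices h"
    unfolding h_def
    by (intro continuous_on_mult continuous_on_sum continuous_on_const trig_moment_continuous f_cont)
  define g where "g \<mu> = (\<integral>v. f (sampled_matrix v) \<partial>PiM UNIV (\<lambda>_::nat. \<mu>))" for \<mu> :: "'h measure"
  have g_meas: "g \<in> borel_measurable (prob_algebra ball_space)"
    unfolding g_def by (rule measurable_integral_samples[OF f_meas])
  have g_bound: "\<bar>g \<mu>\<bar> \<le> Bf" if "\<mu> \<in> space (prob_algebra ball_space)" for \<mu>
    unfolding g_def using that by (intro integral_samples_bound f_cont Bf)
  have gt_meas: "(\<lambda>(\<mu>, \<omega>). g (cavity_tilt \<psi> c (l \<omega>) \<mu>)) \<in> borel_measurable (prob_algebra ball_space \<Otimes>\<^sub>M N)"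
    using measurable_compose[OF measurable_cavity_tilt g_meas] by (simp add: case_prod_beta')
  have tilt_space: "cavity_tilt \<psi> c (l \<omega>) \<mu> \<in> space (prob_algebra ball_space)"
    if "\<mu> \<in> space (prob_algebra ball_space)" "\<omega> \<in> space N" for \<mu> \<omega>
    using measurable_space[OF measurable_cavity_tilt, of "(\<mu>, \<omega>)"] that by (simp add: space_pair_measure)
  have fixed: "\<bar>(\<integral>\<omega>. g (cavity_tilt \<psi> c (l \<omega>) \<mu>) \<partial>N) - (\<integral>v. h (sampled_matrix v) \<partial>PiM UNIV (\<lambda>_::nat. \<mu>))\<bar> \<le> \<epsilon>"
    if \<mu>: "\<mu> \<in> space (prob_algebra ball_space)" for \<mu>
  proof -
    interpret cavity_ball_measure N \<psi> c l a L \<mu> by (rule ball_measure[OF \<mu>])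
    have om: "sampled_matrix v \<in> overlap_matrices" if "v \<in> space samples" for v
      using space_samples[OF that] by (rule sampled_matrix_in_overlap_matrices)
    have A_int: "integrable N (\<lambda>\<omega>. g (cavity_tilt \<psi> c (l \<omega>) \<mu>))"
    proof (rule integrable_const_bound[where B=Bf])
      show "(\<lambda>\<omega>. g (cavity_tilt \<psi> c (l \<omega>) \<mu>)) \<in> borel_measurable N"
        using measurable_Pair2[OF gt_meas \<mu>] by simp
      show "AE \<omega> in N. norm (g (cavity_tilt \<psi> c (l \<omega>) \<mu>)) \<le> Bf"
        using g_bound tilt_space[OF \<mu>] by (intro AE_I2) simp
    qed
    have "\<bar>(\<integral>\<omega>. g (cavity_tilt \<psi> c (l \<omega>) \<mu>) \<partial>N) -
        (\<integral>v. (\<Sum>m\<le>d. \<kappa> m * trig_moment xs (n + m) (sampled_matrix v)) * f (sampled_matrix v) \<partial>samples)\<bar> \<le>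
      2 * Bf * (real n + 1) * ((\<integral>x. \<bar>exp (\<psi> x) - T x\<bar> \<partial>gauss) / \<eta> + \<eta> * (\<integral>x. exp (- \<psi> x) \<partial>gauss)) + Bf * B ^ n * e"
      unfolding g_def
    proof (rule tilted_expectation_approximation[where \<delta>=\<delta>])
      show "(\<lambda>v. f (sampled_matrix v)) \<in> borel_measurable samples"
        by (rule integral_sampled_law(1)[OF \<mu> f_meas])
      show "\<bar>f (sampled_matrix v)\<bar> \<le> Bf" if "v \<in> space samples" for v using Bf(2)[OF om[OF that]] .
      show "f (sampled_matrix v) = f (sampled_matrix v')"
        if "v \<in> space samples" "v' \<in> space samples" "\<And>i. i < n \<Longrightarrow> v i = v' i" for v v'
        using that by (intro cylinder_functionD(2)[OF f] om) (auto simp: sampled_matrix_def)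
      show "integrable N (\<lambda>\<omega>. \<integral>v. f (sampled_matrix v) \<partial>PiM UNIV (\<lambda>_. cavity_tilt \<psi> c (l \<omega>) \<mu>))"
        using A_int by (simp add: g_def)
    qed (use Bf Tm T_ge T_le \<delta> xs \<eta> \<kappa> T_int in auto)
    also have "\<dots> = K * (\<integral>x. \<bar>exp (\<psi> x) - T x\<bar> \<partial>gauss) / \<eta> + \<eta> * (K * C1) + Bf * B ^ n * e"
      by (simp add: K_def C1_def distrib_left mult_ac)
    also have "\<dots> \<le> \<epsilon> / 3 + \<epsilon> / 3 + \<epsilon> / 3"
    proof (intro add_mono)
      have "K * (\<integral>x. \<bar>exp (\<psi> x) - T x\<bar> \<partial>gauss) / \<eta> \<le> K * \<epsilon>1 / \<eta>"
        using K \<eta> T_approx by (intro divide_right_mono mult_left_mono) auto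
      also have "\<dots> = \<epsilon> / 3" using K \<eta> by (simp add: \<epsilon>1_def)
      finally show "K * (\<integral>x. \<bar>exp (\<psi> x) - T x\<bar> \<partial>gauss) / \<eta> \<le> \<epsilon> / 3" .
      have "\<eta> * (K * C1) \<le> \<eta> * (K * C1 + 1)" using \<eta> by (intro mult_left_mono) auto
      also have "\<dots> = \<epsilon> / 3"
      proof -
        have "\<epsilon> / (3 * s) * s = \<epsilon> / 3" if "s \<noteq> 0" for s :: real using that by simp
        then show ?thesis unfolding \<eta>_def by this (use KC in linarith)
      qed
      finally show "\<eta> * (K * C1) \<le> \<epsilon> / 3" .
      show "Bf * B ^ n * e \<le> \<epsilon> / 3" using Bf B by (simp add: e_def)
    qed
    finally show ?thesis by (simp add: h_def)
  qed
  show ?thesis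
  proof (rule that[OF h])
    fix M :: "'h measure measure" assume M: "M \<in> space (prob_algebra (prob_algebra ball_space))"
    have sets: "sets M = sets (prob_algebra ball_space)" and prob: "prob_space M"
      using M by (auto simp: space_prob_algebra)
    have space: "space M = space (prob_algebra ball_space)" by (rule sets_eq_imp_space_eq[OF sets])
    have sets2: "sets (M \<Otimes>\<^sub>M N) = sets (prob_algebra ball_space \<Otimes>\<^sub>M N)"
      by (intro sets_pair_measure_cong sets refl)
    interpret M: prob_space M by fact
    interpret P: pair_prob_space M N ..
    have gt_int: "integrable (M \<Otimes>\<^sub>M N) (\<lambda>(\<mu>, \<omega>). g (cavity_tilt \<psi> c (l \<omega>) \<mu>))"
    proof (rule P.integrable_const_bound[where B=Bf])
      show "(\<lambda>(\<mu>, \<omega>). g (cavity_tilt \<psi> c (l \<omega>) \<mu>)) \<in> borel_measurable (M \<Otimes>\<^sub>M N)"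
        using gt_meas measurable_cong_sets[OF sets2 refl] by blast
      show "AE p in M \<Otimes>\<^sub>M N. norm (case p of (\<mu>, \<omega>) \<Rightarrow> g (cavity_tilt \<psi> c (l \<omega>) \<mu>)) \<le> Bf"
        using g_bound tilt_space by (intro AE_I2) (auto simp: space_pair_measure space)
    qed
    have "(\<integral>q. f q \<partial>rost_of (cavity_sampling_law \<psi> c N l M)) = (\<integral>\<mu>. g \<mu> \<partial>cavity_sampling_law \<psi> c N l M)"
      unfolding g_def by (rule integral_rost_of[OF cavity_sampling_law_facts(2)[OF M] f_cont])
    also have "\<dots> = (\<integral>p. g (case p of (\<mu>, \<omega>) \<Rightarrow> cavity_tilt \<psi> c (l \<omega>) \<mu>) \<partial>(M \<Otimes>\<^sub>M N))"
      unfolding cavity_sampling_law_def by (rule integral_distr[OF cavity_sampling_law_facts(1)[OF M] g_meas])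
    also have "\<dots> = (\<integral>(\<mu>, \<omega>). g (cavity_tilt \<psi> c (l \<omega>) \<mu>) \<partial>(M \<Otimes>\<^sub>M N))"
      by (simp add: case_prod_beta')
    also have "\<dots> = (\<integral>\<mu>. (\<integral>\<omega>. g (cavity_tilt \<psi> c (l \<omega>) \<mu>) \<partial>N) \<partial>M)"
      by (rule P.integral_fst[OF gt_int, symmetric])
    finally have eq: "(\<integral>q. f q \<partial>rost_of (cavity_sampling_law \<psi> c N l M)) = (\<integral>\<mu>. (\<integral>\<omega>. g (cavity_tilt \<psi> c (l \<omega>) \<mu>) \<partial>N) \<partial>M)" .
    obtain Bh where Bh: "\<And>q. q \<in> overlap_matrices \<Longrightarrow> \<bar>h q\<bar> \<le> Bh"
      using continuous_overlap_bounded[OF h] by blast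
    have h_int: "integrable M (\<lambda>\<mu>. \<integral>v. h (sampled_matrix v) \<partial>PiM UNIV (\<lambda>_::nat. \<mu>))"
    proof (rule M.integrable_const_bound[where B=Bh])
      show "(\<lambda>\<mu>. \<integral>v. h (sampled_matrix v) \<partial>PiM UNIV (\<lambda>_::nat. \<mu>)) \<in> borel_measurable M"
        using measurable_integral_samples[OF continuous_borel_measurable_overlap[OF h]] measurable_cong_sets[OF sets refl]
        by blast
      show "AE \<mu> in M. norm (\<integral>v. h (sampled_matrix v) \<partial>PiM UNIV (\<lambda>_::nat. \<mu>)) \<le> Bh"
        using integral_samples_bound[OF _ h Bh] by (intro AE_I2) (simp add: space)
    qed
    show "\<bar>(\<integral>q. f q \<partial>rost_of (cavity_sampling_law \<psi> c N l M)) - (\<integral>q. h q \<partial>rost_of M)\<bar> \<le> \<epsilon>"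
      unfolding eq integral_rost_of[OF M h]
      using fixed by (intro prob_integral_diff_le prob P.integrable_fst[OF gt_int] h_int) (simp add: space)
  qed
qed

end

section \<open>Continuity in the weak-* topology\<close>

lemma topspace_rost_topology: "topspace rost_topology = rost_laws"
proof -
  have "rost_laws \<in> {{P \<in> rost_laws. (\<integral>q. f q \<partial>P) \<in> U} | f U.
        continuous_on overlap_matrices (f :: (nat \<Rightarrow> nat \<Rightarrow> real) \<Rightarrow> real) \<and> open U}"
    by (rule CollectI, rule exI[of _ "\<lambda>_. 0"], rule exI[of _ UNIV]) auto
  then show ?thesis unfolding rost_topology_def topology_generated_by_topspace by auto
qed

lemma openin_rost_topology:
  fixes f :: "(nat \<Rightarrow> nat \<Rightarrow> real) \<Rightarrow> real"
  assumes "continuous_on overlap_matrices f" "open U"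
  shows "openin rost_topology {P \<in> rost_laws. (\<integral>q. f q \<partial>P) \<in> U}"
  unfolding rost_topology_def using assms by (intro topology_generated_by_Basis) blast

text \<open>A uniform limit of continuous functionals of the law is continuous, and by density of
  the cylinder functions it suffices to approximate their integrals under the image.\<close>

lemma continuous_map_rost_topologyI:
  assumes maps: "\<And>P. P \<in> rost_laws \<Longrightarrow> \<Phi> P \<in> rost_laws"
    and approx: "\<And>f n \<epsilon>. cylinder_function f n \<Longrightarrow> 0 < \<epsilon> \<Longrightarrow>
      \<exists>h. continuous_on overlap_matrices h \<and> (\<forall>P\<in>rost_laws. \<bar>(\<integral>q. f q \<partial>\<Phi> P) - (\<integral>q. h q \<partial>P)\<bar> \<le> \<epsilon>)"
  shows "continuous_map rost_topology rost_topology \<Phi>"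
proof -
  have open_vimage: "openin rost_topology {P \<in> rost_laws. (\<integral>q. f q \<partial>\<Phi> P) \<in> U}"
    if f: "continuous_on overlap_matrices f" and U: "open U" for f :: "_ \<Rightarrow> real" and U
  proof (subst openin_subopen, intro ballI)
    fix P0 assume "P0 \<in> {P \<in> rost_laws. (\<integral>q. f q \<partial>\<Phi> P) \<in> U}"
    then have P0: "P0 \<in> rost_laws" "(\<integral>q. f q \<partial>\<Phi> P0) \<in> U" by auto
    \<comment> \<open>Two errors of \<open>r / 6\<close> give \<open>r / 3\<close> at each of the
      laws \<open>P0\<close> and \<open>P\<close>; the neighbourhood contributes the last third,
      with strict inequality.\<close>
    then obtain r where r: "r > 0" "ball (\<integral>q. f q \<partial>\<Phi> P0) r \<subseteq> U" using U by (meson openE)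
    obtain g n where g: "cylinder_function g n" "\<And>q. q \<in> overlap_matrices \<Longrightarrow> \<bar>f q - g q\<bar> < r / 6"
      using cylinder_approximation[OF f, of "r / 6"] r(1) by auto
    obtain h where h: "continuous_on overlap_matrices h"
        "\<And>P. P \<in> rost_laws \<Longrightarrow> \<bar>(\<integral>q. g q \<partial>\<Phi> P) - (\<integral>q. h q \<partial>P)\<bar> \<le> r / 6"
      using approx[OF g(1), of "r / 6"] r(1) by auto
    have fh: "\<bar>(\<integral>q. f q \<partial>\<Phi> P) - (\<integral>q. h q \<partial>P)\<bar> \<le> r / 3" if P: "P \<in> rost_laws" for P
    proof -
      note \<Phi>P = rost_lawsD[OF maps[OF P]]
      have "\<bar>(\<integral>q. f q \<partial>\<Phi> P) - (\<integral>q. g q \<partial>\<Phi> P)\<bar> \<le> r / 6"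
        using g by (intro prob_integral_diff_le \<Phi>P prob_overlap_integrable f cylinder_functionD(1)[OF g(1)])
          (auto simp: \<Phi>P(4) less_imp_le)
      then show ?thesis using h(2)[OF P] by linarith
    qed
    define V where "V = {P \<in> rost_laws. (\<integral>q. h q \<partial>P) \<in> ball (\<integral>q. h q \<partial>P0) (r / 3)}"
    have "openin rost_topology V" unfolding V_def by (intro openin_rost_topology h open_ball)
    moreover have "P0 \<in> V" using P0 r by (simp add: V_def)
    moreover have "V \<subseteq> {P \<in> rost_laws. (\<integral>q. f q \<partial>\<Phi> P) \<in> U}"
    proof
      fix P assume P: "P \<in> V"
      then have "P \<in> rost_laws" "\<bar>(\<integral>q. h q \<partial>P0) - (\<integral>q. h q \<partial>P)\<bar> < r / 3" by (auto simp: V_def dist_real_def)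
      then have "\<bar>(\<integral>q. f q \<partial>\<Phi> P0) - (\<integral>q. f q \<partial>\<Phi> P)\<bar> < r"
        using fh[of P] fh[OF P0(1)] by linarith
      then show "P \<in> {P \<in> rost_laws. (\<integral>q. f q \<partial>\<Phi> P) \<in> U}"
        using r(2) \<open>P \<in> rost_laws\<close> by (auto simp: dist_real_def subset_eq)
    qed
    ultimately show "\<exists>V. openin rost_topology V \<and> P0 \<in> V \<and> V \<subseteq> {P \<in> rost_laws. (\<integral>q. f q \<partial>\<Phi> P) \<in> U}" by blast
  qed
  have "continuous_map rost_topology (topology_generated_by {{P \<in> rost_laws. (\<integral>q. f q \<partial>P) \<in> U} | f U.
        continuous_on overlap_matrices (f :: (nat \<Rightarrow> nat \<Rightarrow> real) \<Rightarrow> real) \<and> open U}) \<Phi>"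
  proof (rule continuous_on_generated_topo)
    fix W assume "W \<in> {{P \<in> rost_laws. (\<integral>q. f q \<partial>P) \<in> U} | f U.
        continuous_on overlap_matrices (f :: (nat \<Rightarrow> nat \<Rightarrow> real) \<Rightarrow> real) \<and> open U}"
    then obtain f :: "_ \<Rightarrow> real" and U where W: "W = {P \<in> rost_laws. (\<integral>q. f q \<partial>P) \<in> U}"
      "continuous_on overlap_matrices f" "open U" by blast
    have "\<Phi> -` W \<inter> topspace rost_topology = {P \<in> rost_laws. (\<integral>q. f q \<partial>\<Phi> P) \<in> U}"
      using maps by (auto simp: W(1) topspace_rost_topology)
    then show "openin rost_topology (\<Phi> -` W \<inter> topspace rost_topology)"
      using open_vimage[OF W(2,3)] by simp
  next
    show "\<Phi> ` topspace rost_topology \<subseteq> \<Union> {{P \<in> rost_laws. (\<integral>q. f q \<partial>P) \<in> U} | f U.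
        continuous_on overlap_matrices (f :: (nat \<Rightarrow> nat \<Rightarrow> real) \<Rightarrow> real) \<and> open U}"
      using maps topspace_rost_topology unfolding rost_topology_def topology_generated_by_topspace by auto
  qed
  then show ?thesis by (simp add: rost_topology_def)
qed

text \<open>Two orthonormal vectors yield unit vectors with any inner product s in [0, 1]; positive
  semidefiniteness with coefficients 1 and -1 then reads \<open>0 \<le> 2 - 2 * c s\<close>. At s =
  1 the vectors coincide, whence the case split.\<close>

lemma covariance_le_1:
  assumes inf: "\<not> (\<exists>F::'h::real_inner set. finite F \<and> span F = UNIV)"
    and c1: "c 1 = 1"
    and psd: "positive_semidefinite_on (cball (0::'h) 1) (\<lambda>v v'. c (v \<bullet> v'))"
    and s: "0 \<le> s" "s \<le> 1"
  shows "c s \<le> (1::real)"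
proof (cases "s = 1")
  case False
  obtain e :: "nat \<Rightarrow> 'h" where e: "\<And>i j. e i \<bullet> e j = (if i = j then 1 else 0)"
    using orthonormal_sequence[OF inf] by blast
  define v where "v = s *\<^sub>R e 0 + sqrt (1 - s\<^sup>2) *\<^sub>R e 1"
  have s2: "s\<^sup>2 \<le> 1" using s by (simp add: power_le_one)
  have inner: "e 0 \<bullet> e 0 = 1" "e 0 \<bullet> v = s" "v \<bullet> v = 1"
    using s2 by (simp_all add: e v_def inner_add_left inner_add_right power2_eq_square[symmetric])
  have "e 0 \<in> cball 0 1" "v \<in> cball 0 1" using inner by (simp_all add: norm_eq_sqrt_inner)
  moreover have "e 0 \<noteq> v" using inner False by auto
  ultimately have "0 \<le> 1\<^sup>2 * c (e 0 \<bullet> e 0) + 2 * 1 * (- 1) * c (e 0 \<bullet> v) + (- 1)\<^sup>2 * c (v \<bullet> v)"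
    by (rule psd_two_by_two[OF psd])
  then show ?thesis using c1 by (simp add: inner)
qed (use c1 in simp)

text \<open>Mean value inequality from 0. Linear growth makes \<open>exp \<psi>\<close> and
  \<open>exp (- \<psi>)\<close> integrable under Gaussian laws.\<close>

lemma bounded_derivative_linear_growth:
  fixes \<psi> :: "real \<Rightarrow> real"
  assumes d: "\<psi> C1_differentiable_on UNIV" and b: "bounded (range (deriv \<psi>))"
  shows "\<exists>L a. L \<ge> 0 \<and> (\<forall>x. \<bar>\<psi> x\<bar> \<le> a + L * \<bar>x\<bar>)"
proof -
  have deriv: "(\<psi> has_field_derivative deriv \<psi> x) (at x)" for x
  proof -
    have "\<psi> differentiable (at x)" using d by (simp add: C1_differentiable_on_eq)
    then show ?thesis by (simp add: DERIV_deriv_iff_real_differentiable)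
  qed
  obtain L where L: "L > 0" "\<And>x. norm (deriv \<psi> x) \<le> L" using b by (auto simp: bounded_pos)
  have "\<bar>\<psi> x\<bar> \<le> \<bar>\<psi> 0\<bar> + L * \<bar>x\<bar>" for x
    using field_differentiable_bound[of UNIV \<psi> "deriv \<psi>" L x 0] deriv L by auto
  then show ?thesis using L(1) by (intro exI[of _ L] exI[of _ "\<bar>\<psi> 0\<bar>"]) auto
qed

theorem theorem1p4:
  fixes \<psi> c :: "real \<Rightarrow> real"
    and P\<^sub>l :: "'w measure"
    and l :: "'w \<Rightarrow> 'h::{real_inner, polish_space} \<Rightarrow> real"
  assumes "\<not> (\<exists>F::'h set. finite F \<and> span F = UNIV)"
    and "\<psi> C1_differentiable_on UNIV"
    and "bounded (range (deriv \<psi>))"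
    and "continuous_on {-1..1} c"
    and "c 1 = 1"
    and "positive_semidefinite_on (cball (0::'h) 1) (\<lambda>v v'. c (v \<bullet> v'))"
    and "cavity_field c P\<^sub>l l"
  shows "continuous_map rost_topology rost_topology (cavity_map \<psi> c P\<^sub>l l)"
proof -
  obtain L a where aL: "L \<ge> 0" "\<And>x. \<bar>\<psi> x\<bar> \<le> a + L * \<bar>x\<bar>"
    using bounded_derivative_linear_growth[OF assms(2,3)] by auto
  have field: "prob_space P\<^sub>l" "(\<lambda>(\<omega>, v). l \<omega> v) \<in> borel_measurable (P\<^sub>l \<Otimes>\<^sub>M ball_space)"
    "centered_gaussian_process P\<^sub>l (cball 0 1) l"
    "\<And>v v'. v \<in> cball 0 1 \<Longrightarrow> v' \<in> cball 0 1 \<Longrightarrow> (\<integral>\<omega>. l \<omega> v * l \<omega> v' \<partial>P\<^sub>l) = c (v \<bullet> v')"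
    using assms(7) unfolding cavity_field_def by auto
  interpret prob_space P\<^sub>l by fact
  interpret cavity_setting P\<^sub>l \<psi> c l a L
  proof unfold_locales
    show "continuous_on UNIV \<psi>" using assms(2) by (rule C1_differentiable_imp_continuous_on)
    show "c s \<le> 1" if "0 \<le> s" "s \<le> 1" for s
      using covariance_le_1[OF assms(1,5,6) that] .
  qed (use aL assms field in auto)
  define image where "image M = rost_of (cavity_sampling_law \<psi> c P\<^sub>l l M)" for M :: "'h measure measure"
  have image: "image M \<in> rost_laws" if "M \<in> space (prob_algebra (prob_algebra ball_space))" for M
    unfolding image_def by (intro rost_of_in_rost_laws cavity_sampling_law_facts that)
  \<comment> \<open>The same \<open>h\<close> serves both measures, and its integral is taken under
    \<open>rost_of\<close>, which is P in both cases; so the test integrals of the images differ by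
    at most \<open>2 * \<epsilon>\<close>.\<close>
  have unique: "image M = image M'"
    if M: "is_sampling_measure M P" "is_sampling_measure M' P" for M M' P
  proof -
    have sp: "M \<in> space (prob_algebra (prob_algebra ball_space))" "M' \<in> space (prob_algebra (prob_algebra ball_space))"
      and eq: "rost_of M = P" "rost_of M' = P"
      using M by (auto simp: is_sampling_measure_def)
    show ?thesis
    proof (rule overlap_law_eqI)
      fix f n assume f: "cylinder_function f n"
      have "\<bar>(\<integral>q. f q \<partial>image M) - (\<integral>q. f q \<partial>image M')\<bar> \<le> 2 * \<epsilon>" if \<epsilon>: "\<epsilon> > 0" for \<epsilon>
      proof -
        obtain h where h: "\<And>M. M \<in> space (prob_algebra (prob_algebra ball_space)) \<Longrightarrow>
            \<bar>(\<integral>q. f q \<partial>image M) - (\<integral>q. h q \<partial>rost_of M)\<bar> \<le> \<epsilon>"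
          unfolding image_def using cavity_approximation[OF f \<epsilon>] by blast
        show ?thesis using h[OF sp(1)] h[OF sp(2)] unfolding eq by linarith
      qed
      from this[of "\<bar>(\<integral>q. f q \<partial>image M) - (\<integral>q. f q \<partial>image M')\<bar> / 4"]
      show "(\<integral>q. f q \<partial>image M) = (\<integral>q. f q \<partial>image M')"
        by (cases "(\<integral>q. f q \<partial>image M) = (\<integral>q. f q \<partial>image M')") auto
    qed (use image[OF sp(1)] image[OF sp(2)] rost_lawsD(1) in auto)
  qed
  have cavity_map_eq: "cavity_map \<psi> c P\<^sub>l l P = image M" if "is_sampling_measure M P" for M P
    unfolding cavity_map_def
  proof (rule the_equality)
    show "\<exists>M'. is_sampling_measure M' P \<and> image M = rost_of (cavity_sampling_law \<psi> c P\<^sub>l l M')"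
      using that unfolding image_def by blast
  next
    fix P' assume "\<exists>M. is_sampling_measure M P \<and> P' = rost_of (cavity_sampling_law \<psi> c P\<^sub>l l M)"
    then obtain M' where "is_sampling_measure M' P" "P' = image M'" unfolding image_def by blast
    then show "P' = image M" using unique[OF _ that] by blast
  qed
  show ?thesis
  proof (rule continuous_map_rost_topologyI)
    fix P assume "P \<in> rost_laws"
    then obtain M :: "'h measure measure" where M: "is_sampling_measure M P"
      using sampling_measure_exists[OF assms(1)] by blast
    then show "cavity_map \<psi> c P\<^sub>l l P \<in> rost_laws"
      using cavity_map_eq[OF M] image by (simp add: is_sampling_measure_def)
  next
    fix f n and \<epsilon> :: real assume f: "cylinder_function f n" and \<epsilon>: "0 < \<epsilon>"
    obtain h where h: "continuous_on overlap_matrices h" "\<And>M. M \<in> space (prob_algebra (prob_algebra ball_space)) \<Longrightarrow>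
        \<bar>(\<integral>q. f q \<partial>image M) - (\<integral>q. h q \<partial>rost_of M)\<bar> \<le> \<epsilon>"
      unfolding image_def using cavity_approximation[OF f \<epsilon>] by blast
    have "\<bar>(\<integral>q. f q \<partial>cavity_map \<psi> c P\<^sub>l l P) - (\<integral>q. h q \<partial>P)\<bar> \<le> \<epsilon>" if P: "P \<in> rost_laws" for P
    proof -
      obtain M :: "'h measure measure" where M: "is_sampling_measure M P"
        using sampling_measure_exists[OF assms(1) P] by blast
      then show ?thesis using h(2)[of M] cavity_map_eq[OF M] by (simp add: is_sampling_measure_def)
    qed
    then show "\<exists>h. continuous_on overlap_matrices h \<and>
        (\<forall>P\<in>rost_laws. \<bar>(\<integral>q. f q \<partial>cavity_map \<psi> c P\<^sub>l l P) - (\<integral>q. h q \<partial>P)\<bar> \<le> \<epsilon>)"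
      using h(1) by blast
  qed
qed

end
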